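(* Let $n$ be a finite ordinal with $n>2$. (1) There exists a $\mathsf{PEA}_n$ atom structure $\mathbf{At}$ such that the term algebra $\mathfrak{Tm}\mathbf{At}$ is representable as a $\mathsf{PEA}_n$, but $\mathbf{At}$ is not strongly representable. In fact, for every signature $t$ between that of $\mathsf{Df}_n$ and that of $\mathsf{PEA}_n$, the $t$-reduct of the complex algebra $\mathfrak{Cm}\mathbf{At}$ is not representable. (2) Furthermore, there exists an atomic relation algebra $\mathfrak{R}$ such that the set $\mathsf{Mat}_n\mathrm{At}\mathfrak{R}$ of all $n$-dimensional basic matrices over $\mathfrak{R}$ forms an $n$-dimensional polyadic equality basis, the term algebra $\mathfrak{Tm}\,\mathsf{Mat}_n\mathrm{At}\mathfrak{R}$ is representable as a polyadic equality algebra of dimension $n$, while the diagonal-free reduct of $\mathfrak{Cm}\,\mathsf{Mat}_n\mathrm{At}\mathfrak{R}$ is not representable (as a diagonal-free cylindric algebra of dimension $n$). In particular, the relation algebra atom structure $\mathrm{At}\mathfrak{R}$ is weakly but not strongly representable.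
   Context: Signatures. $\mathsf{Df}_n$ has the Boolean operations and cylindrifiers $c_i$ ($i<n$); $\mathsf{PEA}_n$ (polyadic equality algebras of finite dimension $n$) has in addition the diagonal constants $d_{ij}$, replacement operators $s^i_j$ and transposition operators $s_{ij}$ ($i,j<n$). A signature is between them if it is obtained from that of $\mathsf{Df}_n$ by adding some of the families $d_{ij}$, $s^i_j$, $s_{ij}$ (for instance $\mathsf{Df}$, $\mathsf{Sc}$ = substitution algebras with $c_i,s^i_j$; $\mathsf{CA}$ = cylindric algebras with $c_i,d_{ij}$; $\mathsf{PA}$ with $c_i,s^i_j,s_{ij}$; $\mathsf{PEA}$). Representability. In a set algebra with unit ${}^nU$: $c_iX=\{s:\exists t\in X,\ t_j=s_j\ \forall j\ne i\}$, $d_{ij}=\{s:s_i=s_j\}$, $s^i_jX=\{s:s\circ[i|j]\in X\}$, $s_{ij}X=\{s: s\circ[i,j]\in X\}$, where $[i|j]$ sends $i$ to $j$ and fixes everything else and $[i,j]$ swaps $i$ and $j$. An algebra is representable if it is isomorphic to a subalgebra of a direct product of set algebras of the same type. Atom structures. The atom structure $\mathrm{At}\mathfrak A$ of an atomic algebra (Boolean algebra with operators) $\mathfrak A$ has as universe the atoms, with a relation $R_\Omega(a_0,\dots,a_r)\iff \Omega(a_1,\dots,a_r)\ge a_0$ for every extra-Boolean operator $\Omega$. $\mathfrak{Cm}\,S$ is the complex algebra of $S$ (all subsets of $S$, with $\Omega(X_1,\dots,X_r)=\{s:\exists s_i\in X_i,\ R_\Omega(s,s_1,\dots,s_r)\}$),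 and $\mathfrak{Tm}\,S$ is the subalgebra of $\mathfrak{Cm}\,S$ generated by the singletons. An atom structure is weakly representable if at least one atomic algebra having it as atom structure is representable (equivalently, its term algebra is representable), and strongly representable if all atomic algebras having it as atom structure are representable (equivalently its complex algebra is). Basic matrices. For an atomic relation algebra $\mathfrak R$, an $n$-dimensional basic matrix is a map $f:n\times n\to\mathrm{At}\mathfrak R$ with $f(x,x)\le 1'$, $f(y,x)=f(x,y)^{\smile}$ and $f(x,z)\le f(x,y);f(y,z)$ for all $x,y,z<n$. $\mathsf{Mat}_n\mathrm{At}\mathfrak R$, the set of all of them, is regarded as an atom structure with $R_{c_i}(f,g)$ iff $f(x,y)=g(x,y)$ for all $x,y\neq i$, $R_{d_{ij}}(f)$ iff $f(i,j)\le 1'$, $R_{s_{ij}}(f,g)$ iff $f\circ[i,j]=g$, and $R_{s^i_j}(f,g)$ iff $f\circ[i|j]=g$ (here $(f\circ\tau)(x,y)=f(\tau(x),\tau(y))$). A set $\mathcal M$ of basic matrices is an $n$-dimensional cylindric basis if: every atom is $f(0,1)$ for some $f\in\mathcal M$; if $f\in\mathcal M$, $f(x,y)\le a;b$ with $a,b$ atoms and $z\ne x,y$, there is $g\in\mathcal M$ agreeing with $f$ off $z$ with $g(x,z)=a$, $g(z,y)=b$; and if $f,g\in\mathcal M$ agree off $\{x,y\}$ there is $h\in\mathcal M$ agreeing with $f$ off $x$ and with $g$ off $y$. It is a polyadic equality basis if it is moreover closed under $f\mapsto f\circ\tau$ for all $\tau:n\to n$. *)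

theory Defs
  imports Main "HOL-Library.FuncSet" "HOL-Combinatorics.Transposition"
begin

section \<open>Boolean algebras with operators\<close>

text \<open>
  A signature is a partial arity map on the extra-Boolean operation symbols. An algebra interprets
  every symbol of the type \<open>'o\<close>, on argument lists of any length, but every notion below
  is relative to a signature \<open>t\<close> and only looks at the symbols of \<open>t\<close>, applied to
  argument lists of the right length over the universe. So a notion at \<open>t\<close>
  applied to \<open>A\<close> is the notion applied to the \<open>t\<close>-reduct of \<open>A\<close>.
\<close>

type_synonym 'o signature = "'o \<rightharpoonup> nat"

record ('o, 'a) alg =
  univ :: "'a set"
  join :: "'a \<Rightarrow> 'a \<Rightarrow> 'a"
  meet :: "'a \<Rightarrow> 'a \<Rightarrow> 'a"
  cpl :: "'a \<Rightarrow> 'a"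
  bzero :: "'a"
  bone :: "'a"
  oper :: "'o \<Rightarrow> 'a list \<Rightarrow> 'a"

definition subuniverse :: "'o signature \<Rightarrow> ('o, 'a) alg \<Rightarrow> 'a set \<Rightarrow> bool" where
  "subuniverse t A X \<longleftrightarrow> X \<subseteq> univ A \<and> bzero A \<in> X \<and> bone A \<in> X
     \<and> (\<forall>x\<in>X. cpl A x \<in> X) \<and> (\<forall>x\<in>X. \<forall>y\<in>X. join A x y \<in> X \<and> meet A x y \<in> X)
     \<and> (\<forall>f k xs. t f = Some k \<and> length xs = k \<and> set xs \<subseteq> X \<longrightarrow> oper A f xs \<in> X)"

definition algebra :: "'o signature \<Rightarrow> ('o, 'a) alg \<Rightarrow> bool" where
  "algebra t A \<longleftrightarrow> subuniverse t A (univ A)"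

definition is_hom :: "'o signature \<Rightarrow> ('a \<Rightarrow> 'b) \<Rightarrow> ('o, 'a) alg \<Rightarrow> ('o, 'b) alg \<Rightarrow> bool" where
  "is_hom t h A B \<longleftrightarrow> h ` univ A \<subseteq> univ B \<and> h (bzero A) = bzero B \<and> h (bone A) = bone B
     \<and> (\<forall>x\<in>univ A. h (cpl A x) = cpl B (h x))
     \<and> (\<forall>x\<in>univ A. \<forall>y\<in>univ A. h (join A x y) = join B (h x) (h y)
                                \<and> h (meet A x y) = meet B (h x) (h y))
     \<and> (\<forall>f k xs. t f = Some k \<and> length xs = k \<and> set xs \<subseteq> univ A
                  \<longrightarrow> h (oper A f xs) = oper B f (map h xs))"

definition isomorphic :: "'o signature \<Rightarrow> ('o, 'a) alg \<Rightarrow> ('o, 'b) alg \<Rightarrow> bool" where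
  "isomorphic t A B \<longleftrightarrow> (\<exists>h. is_hom t h A B \<and> bij_betw h (univ A) (univ B))"

definition iso_to_subalgebra :: "'o signature \<Rightarrow> ('o, 'a) alg \<Rightarrow> ('o, 'b) alg \<Rightarrow> bool" where
  "iso_to_subalgebra t A B \<longleftrightarrow> (\<exists>X. subuniverse t B X \<and> isomorphic t A (B\<lparr>univ := X\<rparr>))"

definition prod_alg :: "'i set \<Rightarrow> ('i \<Rightarrow> ('o, 'b) alg) \<Rightarrow> ('o, 'i \<Rightarrow> 'b) alg" where
  "prod_alg I B = \<lparr>
     univ = (\<Pi>\<^sub>E i\<in>I. univ (B i)),
     join = (\<lambda>x y. \<lambda>i\<in>I. join (B i) (x i) (y i)),
     meet = (\<lambda>x y. \<lambda>i\<in>I. meet (B i) (x i) (y i)),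
     cpl = (\<lambda>x. \<lambda>i\<in>I. cpl (B i) (x i)),
     bzero = (\<lambda>i\<in>I. bzero (B i)),
     bone = (\<lambda>i\<in>I. bone (B i)),
     oper = (\<lambda>f xs. \<lambda>i\<in>I. oper (B i) f (map (\<lambda>x. x i) xs)) \<rparr>"

text \<open>Huntington's axioms.\<close>

definition boolean :: "('o, 'a) alg \<Rightarrow> bool" where
  "boolean A \<longleftrightarrow>
     (\<forall>x\<in>univ A. \<forall>y\<in>univ A. join A x y = join A y x \<and> meet A x y = meet A y x)
   \<and> (\<forall>x\<in>univ A. \<forall>y\<in>univ A. \<forall>z\<in>univ A.
        join A x (meet A y z) = meet A (join A x y) (join A x z)
      \<and> meet A x (join A y z) = join A (meet A x y) (meet A x z))
   \<and> (\<forall>x\<in>univ A. join A x (bzero A) = x \<and> meet A x (bone A) = x)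
   \<and> (\<forall>x\<in>univ A. join A x (cpl A x) = bone A \<and> meet A x (cpl A x) = bzero A)"

definition below :: "('o, 'a) alg \<Rightarrow> 'a \<Rightarrow> 'a \<Rightarrow> bool" where
  "below A x y \<longleftrightarrow> join A x y = y"

definition atoms :: "('o, 'a) alg \<Rightarrow> 'a set" where
  "atoms A = {a \<in> univ A. a \<noteq> bzero A \<and> (\<forall>x\<in>univ A. below A x a \<longrightarrow> x = bzero A \<or> x = a)}"

definition atomic :: "('o, 'a) alg \<Rightarrow> bool" where
  "atomic A \<longleftrightarrow> (\<forall>x\<in>univ A. x \<noteq> bzero A \<longrightarrow> (\<exists>a\<in>atoms A. below A a x))"


section \<open>Atom structures\<close>

record ('o, 's) atom_structure =
  points :: "'s set"
  rel :: "'o \<Rightarrow> 's \<Rightarrow> 's list \<Rightarrow> bool"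

definition At :: "('o, 'a) alg \<Rightarrow> ('o, 'a) atom_structure" where
  "At A = \<lparr> points = atoms A, rel = (\<lambda>f a as. below A a (oper A f as)) \<rparr>"

definition Cm :: "('o, 's) atom_structure \<Rightarrow> ('o, 's set) alg" where
  "Cm S = \<lparr>
     univ = Pow (points S),
     join = (\<union>),
     meet = (\<inter>),
     cpl = (\<lambda>X. points S - X),
     bzero = {},
     bone = points S,
     oper = (\<lambda>f Xs. {s \<in> points S. \<exists>ss. list_all2 (\<in>) ss Xs \<and> rel S f s ss}) \<rparr>"

definition Tm :: "'o signature \<Rightarrow> ('o, 's) atom_structure \<Rightarrow> ('o, 's set) alg" where
  "Tm t S = (Cm S)\<lparr>univ := \<Inter>{X. subuniverse t (Cm S) X \<and> (\<forall>s\<in>points S. {s} \<in> X)}\<rparr>"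

definition atstr_iso ::
  "'o signature \<Rightarrow> ('o, 's) atom_structure \<Rightarrow> ('o, 'r) atom_structure \<Rightarrow> bool" where
  "atstr_iso t S S' \<longleftrightarrow> (\<exists>h. bij_betw h (points S) (points S')
     \<and> (\<forall>f k s ss. t f = Some k \<and> length ss = k \<and> s \<in> points S \<and> set ss \<subseteq> points S
          \<longrightarrow> (rel S f s ss \<longleftrightarrow> rel S' f (h s) (map h ss))))"

text \<open>
  An atomic algebra in which the operators are completely additive (as in
  \<open>PEA\<close> and \<open>RA\<close> below) with atom structure \<open>S\<close> is isomorphic
  to a subalgebra of \<open>Cm S\<close>. So it is enough to consider algebras whose elements are of type
  \<open>'s set\<close>. The parameters \<open>K\<close> and \<open>Rep\<close> are the class of
  abstract algebras (\<open>PEA\<close> or \<open>RA\<close>) and its representability predicate.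
\<close>

definition atstr_of_class ::
  "'o signature \<Rightarrow> (('o, 's set) alg \<Rightarrow> bool) \<Rightarrow> ('o, 's) atom_structure \<Rightarrow> bool" where
  "atstr_of_class t K S \<longleftrightarrow> (\<exists>A. K A \<and> atomic A \<and> atstr_iso t (At A) S)"

definition weakly_representable ::
  "'o signature \<Rightarrow> (('o, 's set) alg \<Rightarrow> bool) \<Rightarrow> (('o, 's set) alg \<Rightarrow> bool)
    \<Rightarrow> ('o, 's) atom_structure \<Rightarrow> bool" where
  "weakly_representable t K Rep S \<longleftrightarrow>
     (\<exists>A. K A \<and> atomic A \<and> atstr_iso t (At A) S \<and> Rep A)"

definition strongly_representable ::
  "'o signature \<Rightarrow> (('o, 's set) alg \<Rightarrow> bool) \<Rightarrow> (('o, 's set) alg \<Rightarrow> bool)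
    \<Rightarrow> ('o, 's) atom_structure \<Rightarrow> bool" where
  "strongly_representable t K Rep S \<longleftrightarrow>
     (\<forall>A. K A \<and> atomic A \<and> atstr_iso t (At A) S \<longrightarrow> Rep A)"


section \<open>Polyadic equality algebras and their reducts\<close>

text \<open>\<open>Repl i j\<close> stands for $s^i_j$ and \<open>Swap i j\<close> for $s_{ij}$.\<close>

datatype pea_op = Cyl nat | Diag nat nat | Repl nat nat | Swap nat nat

datatype family = Diagonals | Replacements | Transpositions

text \<open>
  \<open>pea_sig n F\<close> is the signature of \<open>Df\<^sub>n\<close> together with the families in
  \<open>F\<close>. Hence \<open>pea_sig n {}\<close> is that of \<open>Df\<^sub>n\<close>,
  \<open>pea_sig n UNIV\<close> that of \<open>PEA\<^sub>n\<close>, and the signatures between the two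
  are those of the form \<open>pea_sig n F\<close>.
\<close>

fun pea_sig :: "nat \<Rightarrow> family set \<Rightarrow> pea_op signature" where
  "pea_sig n F (Cyl i) = (if i < n then Some 1 else None)"
| "pea_sig n F (Diag i j) = (if Diagonals \<in> F \<and> i < n \<and> j < n then Some 0 else None)"
| "pea_sig n F (Repl i j) = (if Replacements \<in> F \<and> i < n \<and> j < n then Some 1 else None)"
| "pea_sig n F (Swap i j) = (if Transpositions \<in> F \<and> i < n \<and> j < n then Some 1 else None)"

text \<open>The finite schema of Sain and Thompson, with equality.\<close>

definition PEA :: "nat \<Rightarrow> (pea_op, 'a) alg \<Rightarrow> bool" where
  "PEA n A \<longleftrightarrow> algebra (pea_sig n UNIV) A \<and> boolean A \<and>
     (let c = (\<lambda>i x. oper A (Cyl i) [x]); d = (\<lambda>i j. oper A (Diag i j) []);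
          s = (\<lambda>i j x. oper A (Repl i j) [x]); p = (\<lambda>i j x. oper A (Swap i j) [x])
      in \<forall>i<n. \<forall>j<n.
           s i j (d i j) = bone A
         \<and> s i j (bzero A) = bzero A \<and> s i j (bone A) = bone A
         \<and> p i j (bzero A) = bzero A \<and> p i j (bone A) = bone A
         \<and> (\<forall>x\<in>univ A.
              s i i x = x \<and> p i i x = x \<and> p i j x = p j i x
            \<and> below A x (c i x)
            \<and> s i j (c i x) = c i x
            \<and> (i \<noteq> j \<longrightarrow> c i (s i j x) = s i j x)
            \<and> (\<forall>k<n. k \<noteq> i \<and> k \<noteq> j \<longrightarrow> s i j (c k x) = c k (s i j x))
            \<and> s i j (cpl A x) = cpl A (s i j x)
            \<and> p i j (cpl A x) = cpl A (p i j x)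
            \<and> p i j (p i j x) = x
            \<and> (\<forall>k<n. i \<noteq> j \<and> i \<noteq> k \<and> j \<noteq> k \<longrightarrow> p i j (p i k x) = p j k (p i j x))
            \<and> p i j (s i j x) = s j i x
            \<and> below A (meet A x (d i j)) (s i j x)
            \<and> (\<forall>y\<in>univ A.
                 c i (join A x y) = join A (c i x) (c i y)
               \<and> s i j (join A x y) = join A (s i j x) (s i j y)
               \<and> s i j (meet A x y) = meet A (s i j x) (s i j y)
               \<and> p i j (join A x y) = join A (p i j x) (p i j y)
               \<and> p i j (meet A x y) = meet A (p i j x) (p i j y))))"

definition seqs :: "nat \<Rightarrow> 'u set \<Rightarrow> (nat \<Rightarrow> 'u) set" where
  "seqs n U = {..<n} \<rightarrow>\<^sub>E U"

text \<open>\<open>s \<circ> id(i := j)\<close> and \<open>s \<circ> transpose i j\<close> are again in \<open>seqs n U\<close> when \<open>i, j < n\<close>.\<close>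

primrec set_op :: "nat \<Rightarrow> 'u set \<Rightarrow> pea_op \<Rightarrow> (nat \<Rightarrow> 'u) set list \<Rightarrow> (nat \<Rightarrow> 'u) set" where
  "set_op n U (Cyl i) Xs = {s \<in> seqs n U. \<exists>t \<in> Xs ! 0. \<forall>j<n. j \<noteq> i \<longrightarrow> t j = s j}"
| "set_op n U (Diag i j) Xs = {s \<in> seqs n U. s i = s j}"
| "set_op n U (Repl i j) Xs = {s \<in> seqs n U. s \<circ> id(i := j) \<in> Xs ! 0}"
| "set_op n U (Swap i j) Xs = {s \<in> seqs n U. s \<circ> transpose i j \<in> Xs ! 0}"

definition set_alg :: "nat \<Rightarrow> 'u set \<Rightarrow> (pea_op, (nat \<Rightarrow> 'u) set) alg" where
  "set_alg n U = \<lparr>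
     univ = Pow (seqs n U),
     join = (\<union>),
     meet = (\<inter>),
     cpl = (\<lambda>X. seqs n U - X),
     bzero = {},
     bone = seqs n U,
     oper = set_op n U \<rparr>"

text \<open>
  HOL cannot quantify over the types of the index set and of the bases. Indexing by elements of
  \<open>A\<close> and taking the bases inside \<open>'a list\<close>, an infinite type at least as large
  as \<open>'a\<close>, is no restriction: by the downward Loewenheim-Skolem argument,
  a representation over arbitrary types yields one of this form. See the lemma
  \<open>representableI\<close> at the end of this theory (\<open>ra_representableI\<close> for
  relation algebras).
\<close>

definition representable :: "nat \<Rightarrow> pea_op signature \<Rightarrow> (pea_op, 'a) alg \<Rightarrow> bool" where
  "representable n t A \<longleftrightarrow> (\<exists>(I :: 'a set) (U :: 'a \<Rightarrow> 'a list set).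
     iso_to_subalgebra t A (prod_alg I (\<lambda>i. set_alg n (U i))))"

abbreviation PEA_atom_structure :: "nat \<Rightarrow> (pea_op, 's) atom_structure \<Rightarrow> bool" where
  "PEA_atom_structure n \<equiv> atstr_of_class (pea_sig n UNIV) (PEA n)"

abbreviation PEA_strongly_representable :: "nat \<Rightarrow> (pea_op, 's) atom_structure \<Rightarrow> bool" where
  "PEA_strongly_representable n \<equiv>
     strongly_representable (pea_sig n UNIV) (PEA n) (representable n (pea_sig n UNIV))"


section \<open>Relation algebras\<close>

datatype ra_op = Ident | Conv | Comp

definition ra_sig :: "ra_op signature" where
  "ra_sig = [Ident \<mapsto> 0, Conv \<mapsto> 1, Comp \<mapsto> 2]"

abbreviation ident :: "(ra_op, 'a) alg \<Rightarrow> 'a" where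
  "ident R \<equiv> oper R Ident []"

abbreviation conv :: "(ra_op, 'a) alg \<Rightarrow> 'a \<Rightarrow> 'a" where
  "conv R x \<equiv> oper R Conv [x]"

abbreviation comp :: "(ra_op, 'a) alg \<Rightarrow> 'a \<Rightarrow> 'a \<Rightarrow> 'a" where
  "comp R x y \<equiv> oper R Comp [x, y]"

definition RA :: "(ra_op, 'a) alg \<Rightarrow> bool" where
  "RA R \<longleftrightarrow> algebra ra_sig R \<and> boolean R \<and>
     (\<forall>x\<in>univ R.
        comp R x (ident R) = x
      \<and> conv R (conv R x) = x
      \<and> (\<forall>y\<in>univ R.
           conv R (join R x y) = join R (conv R x) (conv R y)
         \<and> conv R (comp R x y) = comp R (conv R y) (conv R x)
         \<and> below R (comp R (conv R x) (cpl R (comp R x y))) (cpl R y)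
         \<and> (\<forall>z\<in>univ R.
              comp R (comp R x y) z = comp R x (comp R y z)
            \<and> comp R (join R x y) z = join R (comp R x z) (comp R y z))))"

primrec rel_op :: "'u set \<Rightarrow> ra_op \<Rightarrow> ('u \<times> 'u) set list \<Rightarrow> ('u \<times> 'u) set" where
  "rel_op U Ident Xs = Id_on U"
| "rel_op U Conv Xs = (Xs ! 0)\<inverse>"
| "rel_op U Comp Xs = Xs ! 0 O Xs ! 1"

definition rel_alg :: "'u set \<Rightarrow> (ra_op, ('u \<times> 'u) set) alg" where
  "rel_alg U = \<lparr>
     univ = Pow (U \<times> U),
     join = (\<union>),
     meet = (\<inter>),
     cpl = (\<lambda>X. U \<times> U - X),
     bzero = {},
     bone = U \<times> U,
     oper = rel_op U \<rparr>"

definition ra_representable :: "(ra_op, 'a) alg \<Rightarrow> bool" where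
  "ra_representable A \<longleftrightarrow> (\<exists>(I :: 'a set) (U :: 'a \<Rightarrow> 'a list set).
     iso_to_subalgebra ra_sig A (prod_alg I (\<lambda>i. rel_alg (U i))))"

abbreviation RA_weakly_representable :: "(ra_op, 's) atom_structure \<Rightarrow> bool" where
  "RA_weakly_representable \<equiv> weakly_representable ra_sig RA ra_representable"

abbreviation RA_strongly_representable :: "(ra_op, 's) atom_structure \<Rightarrow> bool" where
  "RA_strongly_representable \<equiv> strongly_representable ra_sig RA ra_representable"


section \<open>Basic matrices and bases\<close>

type_synonym 'r mat = "nat \<times> nat \<Rightarrow> 'r"

definition basic_matrices :: "nat \<Rightarrow> (ra_op, 'r) alg \<Rightarrow> 'r mat set" where
  "basic_matrices n R = {f \<in> {..<n} \<times> {..<n} \<rightarrow>\<^sub>E atoms R.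
     (\<forall>x<n. below R (f (x, x)) (ident R))
   \<and> (\<forall>x<n. \<forall>y<n. f (y, x) = conv R (f (x, y)))
   \<and> (\<forall>x<n. \<forall>y<n. \<forall>z<n. below R (f (x, z)) (comp R (f (x, y)) (f (y, z))))}"

definition mat_comp :: "nat \<Rightarrow> 'r mat \<Rightarrow> (nat \<Rightarrow> nat) \<Rightarrow> 'r mat" where
  "mat_comp n f \<tau> = (\<lambda>(x, y) \<in> {..<n} \<times> {..<n}. f (\<tau> x, \<tau> y))"

definition agree_off :: "nat \<Rightarrow> nat set \<Rightarrow> 'r mat \<Rightarrow> 'r mat \<Rightarrow> bool" where
  "agree_off n D f g \<longleftrightarrow> (\<forall>x<n. \<forall>y<n. x \<notin> D \<and> y \<notin> D \<longrightarrow> f (x, y) = g (x, y))"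

primrec mat_rel ::
  "nat \<Rightarrow> (ra_op, 'r) alg \<Rightarrow> pea_op \<Rightarrow> 'r mat \<Rightarrow> 'r mat list \<Rightarrow> bool" where
  "mat_rel n R (Cyl i) f gs \<longleftrightarrow> agree_off n {i} f (gs ! 0)"
| "mat_rel n R (Diag i j) f gs \<longleftrightarrow> below R (f (i, j)) (ident R)"
| "mat_rel n R (Repl i j) f gs \<longleftrightarrow> mat_comp n f (id(i := j)) = gs ! 0"
| "mat_rel n R (Swap i j) f gs \<longleftrightarrow> mat_comp n f (transpose i j) = gs ! 0"

definition Mat :: "nat \<Rightarrow> (ra_op, 'r) alg \<Rightarrow> (pea_op, 'r mat) atom_structure" where
  "Mat n R = \<lparr> points = basic_matrices n R, rel = mat_rel n R \<rparr>"

definition cylindric_basis :: "nat \<Rightarrow> (ra_op, 'r) alg \<Rightarrow> 'r mat set \<Rightarrow> bool" where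
  "cylindric_basis n R M \<longleftrightarrow> M \<subseteq> basic_matrices n R
   \<and> (\<forall>a\<in>atoms R. \<exists>f\<in>M. f (0, 1) = a)
   \<and> (\<forall>f\<in>M. \<forall>a\<in>atoms R. \<forall>b\<in>atoms R. \<forall>x<n. \<forall>y<n. \<forall>z<n.
        below R (f (x, y)) (comp R a b) \<and> z \<noteq> x \<and> z \<noteq> y
        \<longrightarrow> (\<exists>g\<in>M. agree_off n {z} f g \<and> g (x, z) = a \<and> g (z, y) = b))
   \<and> (\<forall>f\<in>M. \<forall>g\<in>M. \<forall>x<n. \<forall>y<n. agree_off n {x, y} f g
        \<longrightarrow> (\<exists>h\<in>M. agree_off n {x} f h \<and> agree_off n {y} g h))"

definition polyadic_equality_basis :: "nat \<Rightarrow> (ra_op, 'r) alg \<Rightarrow> 'r mat set \<Rightarrow> bool" where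
  "polyadic_equality_basis n R M \<longleftrightarrow> cylindric_basis n R M
   \<and> (\<forall>f\<in>M. \<forall>\<tau>. \<tau> ` {..<n} \<subseteq> {..<n} \<longrightarrow> mat_comp n f \<tau> \<in> M)"


section \<open>Representations over arbitrary index sets and bases\<close>

lemma words_embed:
  fixes p q :: 'a
  assumes "p \<noteq> q"
  shows "\<exists>e :: (nat \<times> 'a \<times> 'a) list \<Rightarrow> 'a list. inj e"
proof -
  define enc :: "nat \<times> 'a \<times> 'a \<Rightarrow> 'a list" where "enc = (\<lambda>(i, a, b). replicate i p @ [q, a, b])"
  have pre: "i = j \<and> u = v" if "replicate i p @ q # u = replicate j p @ q # v" for i j u v
    using that
  proof (induction i arbitrary: j)
    case 0 then show ?case using assms by (cases j) auto
  next
    case (Suc i) then show ?case using assms by (cases j) auto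
  qed
  have "xs = ys" if "concat (map enc xs) = concat (map enc ys)" for xs ys
    using that
  proof (induction xs arbitrary: ys)
    case Nil then show ?case by (cases ys) (auto simp: enc_def)
  next
    case (Cons x xs)
    then obtain y ys' where ys: "ys = y # ys'" by (cases ys) (auto simp: enc_def split: prod.splits)
    obtain i a b j c d where xy: "x = (i, a, b)" "y = (j, c, d)" by (cases x, cases y) auto
    from Cons.prems have "replicate i p @ q # a # b # concat (map enc xs)
        = replicate j p @ q # c # d # concat (map enc ys')"
      by (simp add: ys xy enc_def)
    from pre[OF this] have "x = y" "concat (map enc xs) = concat (map enc ys')" by (auto simp: xy)
    then show ?case using Cons.IH ys by auto
  qed
  then have "inj (\<lambda>w. concat (map enc w))" by (auto intro: injI)
  then show ?thesis by blast
qed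

lemma skolem_hull:
  fixes sk :: "nat \<Rightarrow> 'a \<times> 'a \<Rightarrow> 'u list \<Rightarrow> 'u" and ar :: "nat \<Rightarrow> nat" and p q :: 'a
  assumes "p \<noteq> q"
    and U: "\<And>i a us. length us = ar i \<Longrightarrow> set us \<subseteq> U \<Longrightarrow> sk i a us \<in> U"
  obtains V and e :: "'u \<Rightarrow> 'a list"
  where "V \<subseteq> U" "inj_on e V"
    "\<And>i a us. length us = ar i \<Longrightarrow> set us \<subseteq> V \<Longrightarrow> sk i a us \<in> V"
proof -
  define step where "step = (\<lambda>(i, a) st. sk i a (take (ar i) st) # drop (ar i) st)"
  define run where "run = (\<lambda>w. foldr step w)"
  have run_append: "run (v @ w) st = run v (run w st)" for v w st by (simp add: run_def)
  define V where "V = {v \<in> U. \<exists>w. \<forall>st. run w st = v # st}"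
  have closed: "sk i a us \<in> V" if l: "length us = ar i" and us: "set us \<subseteq> V" for i a us
  proof -
    from us have "\<exists>w. \<forall>st. run w st = us @ st"
    proof (induction us)
      case Nil show ?case by (rule exI[of _ "[]"]) (simp add: run_def)
    next
      case (Cons u us)
      then obtain w w' where "\<forall>st. run w st = us @ st" "\<forall>st. run w' st = u # st"
        by (auto simp: V_def)
      then have "\<forall>st. run (w' @ w) st = (u # us) @ st" by (simp add: run_append)
      then show ?case by blast
    qed
    then obtain w where w: "\<And>st. run w st = us @ st" by blast
    have "run ((i, a) # w) st = sk i a us # st" for st
      using w[of st] l by (simp add: run_def step_def)
    moreover have "set us \<subseteq> U" using us by (auto simp: V_def)
    ultimately show ?thesis using U[OF l] unfolding V_def by blast
  qed
  obtain e0 :: "(nat \<times> 'a \<times> 'a) list \<Rightarrow> 'a list" where e0: "inj e0"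
    using words_embed[OF assms(1)] by blast
  define wd where "wd = (\<lambda>v. SOME w. \<forall>st. run w st = v # st)"
  have wd: "run (wd v) [] = [v]" if "v \<in> V" for v
    using that someI_ex[of "\<lambda>w. \<forall>st. run w st = v # st"] by (auto simp: V_def wd_def)
  have "inj_on wd V" using wd by (metis inj_onI list.inject)
  then have "inj_on (\<lambda>v. e0 (wd v)) V" using e0 by (auto simp: inj_on_def)
  moreover have "V \<subseteq> U" by (auto simp: V_def)
  ultimately show ?thesis using closed that by blast
qed

lemma iso_to_subalgebra_hom:
  assumes "iso_to_subalgebra t A (prod_alg I B)" "algebra t A"
  obtains g where "inj_on g (univ A)" "g ` univ A \<subseteq> (\<Pi>\<^sub>E i\<in>I. univ (B i))"
    "\<And>i. i \<in> I \<Longrightarrow> is_hom t (\<lambda>a. g a i) A (B i)"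
proof -
  from assms(1) obtain X g where X: "subuniverse t (prod_alg I B) X"
    and h: "is_hom t g A (prod_alg I B\<lparr>univ := X\<rparr>)" and b: "bij_betw g (univ A) X"
    unfolding iso_to_subalgebra_def isomorphic_def by auto
  have sub: "g ` univ A \<subseteq> (\<Pi>\<^sub>E i\<in>I. univ (B i))"
    using b X by (auto simp: bij_betw_def subuniverse_def prod_alg_def)
  have "is_hom t (\<lambda>a. g a i) A (B i)" if "i \<in> I" for i
    using h sub that unfolding is_hom_def prod_alg_def by (auto simp: PiE_iff comp_def)
  with sub b show ?thesis using that by (auto simp: bij_betw_def)
qed

lemma hom_iso_to_subalgebra:
  assumes A: "algebra t A"
    and inj: "inj_on g (univ A)"
    and ext: "\<And>a. a \<in> univ A \<Longrightarrow> g a \<in> extensional I"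
    and hom: "\<And>i. i \<in> I \<Longrightarrow> is_hom t (\<lambda>a. g a i) A (B i)"
  shows "iso_to_subalgebra t A (prod_alg I B)"
proof -
  have sub: "g ` univ A \<subseteq> (\<Pi>\<^sub>E i\<in>I. univ (B i))"
  proof
    fix x assume "x \<in> g ` univ A"
    then obtain a where a: "a \<in> univ A" "x = g a" by blast
    have "g a i \<in> univ (B i)" if "i \<in> I" for i
      using hom[OF that] a(1) unfolding is_hom_def by blast
    then show "x \<in> (\<Pi>\<^sub>E i\<in>I. univ (B i))" using ext a by (auto simp: PiE_iff)
  qed
  have A': "bzero A \<in> univ A" "bone A \<in> univ A" "\<And>x. x \<in> univ A \<Longrightarrow> cpl A x \<in> univ A"
    "\<And>x y. x \<in> univ A \<Longrightarrow> y \<in> univ A \<Longrightarrow> join A x y \<in> univ A"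
    "\<And>x y. x \<in> univ A \<Longrightarrow> y \<in> univ A \<Longrightarrow> meet A x y \<in> univ A"
    "\<And>f k xs. t f = Some k \<Longrightarrow> length xs = k \<Longrightarrow> set xs \<subseteq> univ A \<Longrightarrow> oper A f xs \<in> univ A"
    using A by (auto simp: algebra_def subuniverse_def)
  have pt: "g a = r" if "a \<in> univ A" "r \<in> extensional I" "\<And>i. i \<in> I \<Longrightarrow> g a i = r i" for a r
    using that ext by (intro extensionalityI[of _ I]) auto
  have H: "g (bzero A) i = bzero (B i)" "g (bone A) i = bone (B i)"
    "\<And>x. x \<in> univ A \<Longrightarrow> g (cpl A x) i = cpl (B i) (g x i)"
    "\<And>x y. x \<in> univ A \<Longrightarrow> y \<in> univ A \<Longrightarrow> g (join A x y) i = join (B i) (g x i) (g y i)"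
    "\<And>x y. x \<in> univ A \<Longrightarrow> y \<in> univ A \<Longrightarrow> g (meet A x y) i = meet (B i) (g x i) (g y i)"
    "\<And>f k xs. t f = Some k \<Longrightarrow> length xs = k \<Longrightarrow> set xs \<subseteq> univ A
      \<Longrightarrow> g (oper A f xs) i = oper (B i) f (map (\<lambda>a. g a i) xs)" if "i \<in> I" for i
    using hom[OF that] unfolding is_hom_def by blast+
  have ops: "g (bzero A) = bzero (prod_alg I B)" "g (bone A) = bone (prod_alg I B)"
    "\<And>x. x \<in> univ A \<Longrightarrow> g (cpl A x) = cpl (prod_alg I B) (g x)"
    "\<And>x y. x \<in> univ A \<Longrightarrow> y \<in> univ A \<Longrightarrow> g (join A x y) = join (prod_alg I B) (g x) (g y)"
    "\<And>x y. x \<in> univ A \<Longrightarrow> y \<in> univ A \<Longrightarrow> g (meet A x y) = meet (prod_alg I B) (g x) (g y)"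
    "\<And>f k xs. t f = Some k \<Longrightarrow> length xs = k \<Longrightarrow> set xs \<subseteq> univ A
      \<Longrightarrow> g (oper A f xs) = oper (prod_alg I B) f (map g xs)"
    subgoal by (rule pt[OF A'(1)]) (simp_all add: prod_alg_def H(1))
    subgoal by (rule pt[OF A'(2)]) (simp_all add: prod_alg_def H(2))
    subgoal for x by (rule pt[OF A'(3)]) (simp_all add: prod_alg_def H(3))
    subgoal for x y by (rule pt[OF A'(4)]) (simp_all add: prod_alg_def H(4))
    subgoal for x y by (rule pt[OF A'(5)]) (simp_all add: prod_alg_def H(5))
    subgoal for f k xs by (rule pt[OF A'(6)]) (simp_all add: prod_alg_def H(6) comp_def)
    done
  have oper_cl: "oper (prod_alg I B) f xs \<in> g ` univ A"
    if f: "t f = Some k" "length xs = k" "set xs \<subseteq> g ` univ A" for f k xs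
  proof -
    have "xs \<in> lists (g ` univ A)" using f(3) by auto
    then obtain ys where "set ys \<subseteq> univ A" "xs = map g ys"
      unfolding lists_image by (auto simp: lists_eq_set)
    with f(1,2) have "oper (prod_alg I B) f xs = g (oper A f ys)" "oper A f ys \<in> univ A"
      by (simp_all add: ops(6) A'(6))
    then show ?thesis by blast
  qed
  have "subuniverse t (prod_alg I B) (g ` univ A)"
    unfolding subuniverse_def
  proof (intro conjI allI ballI impI)
    show "g ` univ A \<subseteq> univ (prod_alg I B)" using sub by (simp add: prod_alg_def)
    show "bzero (prod_alg I B) \<in> g ` univ A" "bone (prod_alg I B) \<in> g ` univ A"
      unfolding ops(1,2)[symmetric] using A'(1,2) by simp_all
  next
    fix x assume "x \<in> g ` univ A"
    then obtain a where "a \<in> univ A" "x = g a" by auto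
    then show "cpl (prod_alg I B) x \<in> g ` univ A" using A'(3)[of a] ops(3)[of a, symmetric] by simp
  next
    fix x y assume "x \<in> g ` univ A" "y \<in> g ` univ A"
    then obtain a b where "a \<in> univ A" "x = g a" "b \<in> univ A" "y = g b" by auto
    then show "join (prod_alg I B) x y \<in> g ` univ A" "meet (prod_alg I B) x y \<in> g ` univ A"
      using A'(4,5)[of a b] ops(4,5)[of a b, symmetric] by simp_all
  next
    fix f k xs assume "t f = Some k \<and> length xs = k \<and> set xs \<subseteq> g ` univ A"
    then show "oper (prod_alg I B) f xs \<in> g ` univ A" using oper_cl by blast
  qed
  moreover have "is_hom t g A (prod_alg I B\<lparr>univ := g ` univ A\<rparr>)"
    unfolding is_hom_def by (simp add: ops)
  moreover have "bij_betw g (univ A) (univ (prod_alg I B\<lparr>univ := g ` univ A\<rparr>))"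
    using inj by (auto simp: bij_betw_def)
  ultimately show ?thesis unfolding iso_to_subalgebra_def isomorphic_def by blast
qed

text \<open>Passing from an arbitrary family of bases to one of the form used in the definitions.\<close>

lemma change_base:
  fixes A :: "('o, 'a) alg" and SA :: "'u set \<Rightarrow> ('o, 'b set) alg" and SB :: "'v set \<Rightarrow> ('o, 'c set) alg"
  assumes A: "algebra t A"
    and rep: "iso_to_subalgebra t A (prod_alg (I :: 'i set) (\<lambda>i. SA (U i)))"
    and SA: "\<And>U. join (SA U) = (\<union>)" "\<And>U. meet (SA U) = (\<inter>)"
      "\<And>U. cpl (SA U) = (\<lambda>X. bone (SA U) - X)" "\<And>U. bzero (SA U) = {}"
      "\<And>U. univ (SA U) = Pow (bone (SA U))"
    and SB: "\<And>U. join (SB U) = (\<union>)" "\<And>U. meet (SB U) = (\<inter>)"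
      "\<And>U. cpl (SB U) = (\<lambda>X. bone (SB U) - X)" "\<And>U. bzero (SB U) = {}"
      "\<And>U. univ (SB U) = Pow (bone (SB U))"
    and down: "\<And>U h d. is_hom t h A (SA U) \<Longrightarrow> d \<in> univ A \<Longrightarrow> d \<noteq> bzero A \<Longrightarrow> h d \<noteq> {}
                 \<Longrightarrow> \<exists>V h'. is_hom t h' A (SB V) \<and> h' d \<noteq> {}"
  shows "\<exists>(J :: 'a set) V. iso_to_subalgebra t A (prod_alg J (\<lambda>j. SB (V j)))"
proof -
  obtain g where g: "inj_on g (univ A)" "g ` univ A \<subseteq> (\<Pi>\<^sub>E i\<in>I. univ (SA (U i)))"
    "\<And>i. i \<in> I \<Longrightarrow> is_hom t (\<lambda>a. g a i) A (SA (U i))"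
    using iso_to_subalgebra_hom[OF rep A] by blast
  have A': "bzero A \<in> univ A" "\<And>x. x \<in> univ A \<Longrightarrow> cpl A x \<in> univ A"
    "\<And>x y. x \<in> univ A \<Longrightarrow> y \<in> univ A \<Longrightarrow> join A x y \<in> univ A"
    "\<And>x y. x \<in> univ A \<Longrightarrow> y \<in> univ A \<Longrightarrow> meet A x y \<in> univ A"
    using A by (auto simp: algebra_def subuniverse_def)
  define J where "J = univ A - {bzero A}"
  have "\<exists>V h'. is_hom t h' A (SB V) \<and> h' d \<noteq> {}" if "d \<in> J" for d
  proof -
    have d: "d \<in> univ A" "d \<noteq> bzero A" using that by (auto simp: J_def)
    then have "g d \<noteq> g (bzero A)" using g(1) A'(1) by (metis inj_on_def)
    moreover have "g d \<in> extensional I" "g (bzero A) \<in> extensional I"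
      using g(2) d(1) A'(1) by (auto simp: PiE_iff)
    ultimately obtain i where i: "i \<in> I" "g d i \<noteq> g (bzero A) i"
      by (meson extensionalityI)
    have "g (bzero A) i = {}" using g(3)[OF i(1)] by (simp add: is_hom_def SA)
    with i have "g d i \<noteq> {}" by auto
    then show ?thesis using down[OF g(3)[OF i(1)] d] by blast
  qed
  then obtain V k where k: "\<And>d. d \<in> J \<Longrightarrow> is_hom t (k d) A (SB (V d))" "\<And>d. d \<in> J \<Longrightarrow> k d d \<noteq> {}"
    by metis
  define h where "h = (\<lambda>a. \<lambda>d\<in>J. k d a)"
  have "inj_on h (univ A)"
  proof (rule inj_onI, rule ccontr)
    fix b c assume bc: "b \<in> univ A" "c \<in> univ A" "h b = h c" "b \<noteq> c"
    define d where "d = join A (meet A b (cpl A c)) (meet A c (cpl A b))"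
    have dA: "d \<in> univ A" using bc A' by (simp add: d_def)
    have "g b \<in> extensional I" "g c \<in> extensional I" "g b \<noteq> g c"
      using g bc by (auto simp: PiE_iff inj_on_def)
    then obtain i where i: "i \<in> I" "g b i \<noteq> g c i" by (meson extensionalityI)
    have hi: "is_hom t (\<lambda>a. g a i) A (SA (U i))" using g(3) i(1) .
    have "g d i = (g b i \<inter> (bone (SA (U i)) - g c i)) \<union> (g c i \<inter> (bone (SA (U i)) - g b i))"
      using hi bc A' by (simp add: is_hom_def d_def SA)
    moreover have "g b i \<subseteq> bone (SA (U i))" "g c i \<subseteq> bone (SA (U i))"
      using hi bc unfolding is_hom_def SA by auto
    ultimately have "g d i \<noteq> {}" using i(2) by blast
    moreover have "g (bzero A) i = {}" using hi by (simp add: is_hom_def SA)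
    ultimately have dJ: "d \<in> J" using dA by (auto simp: J_def)
    have "k d b = k d c" using bc(3) dJ by (metis h_def restrict_apply')
    moreover have "k d d = (k d b \<inter> (bone (SB (V d)) - k d c)) \<union> (k d c \<inter> (bone (SB (V d)) - k d b))"
      using k(1)[OF dJ] bc A' unfolding is_hom_def by (subst (2) d_def) (simp add: SB)
    ultimately show False using k(2)[OF dJ] by blast
  qed
  moreover have "is_hom t (\<lambda>a. h a d) A (SB (V d))" if "d \<in> J" for d
    using k(1)[OF that] that by (simp add: h_def)
  moreover have "h a \<in> extensional J" for a by (simp add: h_def)
  ultimately have "iso_to_subalgebra t A (prod_alg J (\<lambda>j. SB (V j)))"
    by (intro hom_iso_to_subalgebra[OF A]) auto
  then show ?thesis by blast
qed


lemma set_alg_down: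
  fixes A :: "(pea_op, 'a) alg" and U :: "'u set"
  assumes n: "n > 0" and t: "t \<subseteq>\<^sub>m pea_sig n UNIV" and A: "algebra t A"
    and h: "is_hom t h A (set_alg n U)"
    and d: "d \<in> univ A" "d \<noteq> bzero A" "h d \<noteq> {}"
  shows "\<exists>(V :: 'a list set) h'. is_hom t h' A (set_alg n V) \<and> h' d \<noteq> {}"
proof -
  have hsub: "h a \<subseteq> seqs n U" if "a \<in> univ A" for a
    using h that by (auto simp: is_hom_def set_alg_def)
  obtain s0 where s0: "s0 \<in> h d" using d by blast
  then have s0U: "s0 \<in> seqs n U" using hsub d by blast
  define sq where "sq = (\<lambda>us :: 'u list. \<lambda>j\<in>{..<n}. us ! j)"
  define ar where "ar = (\<lambda>i. if i < n then n else 0)"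
  define sk where "sk = (\<lambda>i (a, _ :: 'a) (us :: 'u list).
    if i < n then (if \<exists>v\<in>U. (sq us)(i := v) \<in> h a then SOME v. v \<in> U \<and> (sq us)(i := v) \<in> h a else s0 0)
    else s0 ((i - n) mod n))"
  have s0_in: "s0 j \<in> U" if "j < n" for j using s0U that by (auto simp: seqs_def)
  have skU: "sk i ab us \<in> U" for i ab us
  proof -
    have "(SOME v. v \<in> U \<and> (sq us)(i := v) \<in> h a) \<in> U" if "\<exists>v\<in>U. (sq us)(i := v) \<in> h a" for a
      using someI_ex[of "\<lambda>v. v \<in> U \<and> (sq us)(i := v) \<in> h a"] that by blast
    then show ?thesis using s0_in n by (auto simp: sk_def split: prod.splits)
  qed
  obtain V and e :: "'u \<Rightarrow> 'a list" where V: "V \<subseteq> U" "inj_on e V"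
    and cl: "\<And>i a us. length us = ar i \<Longrightarrow> set us \<subseteq> V \<Longrightarrow> sk i a us \<in> V"
    by (rule skolem_hull[OF d(2), of ar U sk], rule skU, rule that; assumption)
  have s0V: "s0 \<in> seqs n V"
  proof -
    have "s0 j \<in> V" if "j < n" for j
      using cl[of "[]" "n + j" "(d, d)"] that by (simp add: ar_def sk_def)
    then show ?thesis using s0U by (auto simp: seqs_def PiE_iff)
  qed
  have wit: "\<exists>v\<in>V. s(i := v) \<in> h a"
    if s: "s \<in> seqs n V" and i: "i < n" and w: "\<exists>v\<in>U. s(i := v) \<in> h a" for s i a
  proof -
    define us where "us = map s [0..<n]"
    have us: "sq us = s" using s by (auto simp: sq_def us_def seqs_def PiE_iff extensional_def fun_eq_iff)
    have sV: "s j \<in> V" if "j < n" for j using s that by (auto simp: seqs_def)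
    have "set us \<subseteq> V" using sV by (simp add: us_def image_subset_iff)
    then have v: "sk i (a, a) us \<in> V" using cl[of us i "(a, a)"] i by (simp add: ar_def us_def)
    have "sk i (a, a) us = (SOME v. v \<in> U \<and> s(i := v) \<in> h a)" using i w by (simp add: sk_def us)
    moreover have "s(i := (SOME v. v \<in> U \<and> s(i := v) \<in> h a)) \<in> h a"
      using someI_ex[OF w[unfolded Bex_def]] by (rule conjunct2)
    ultimately have "s(i := sk i (a, a) us) \<in> h a" by simp
    with v show ?thesis by blast
  qed
  define E where "E = (\<lambda>s :: nat \<Rightarrow> 'u. \<lambda>j\<in>{..<n}. e (s j))"
  define W where "W = e ` V"
  have Einj: "inj_on E (seqs n V)"
  proof (rule inj_onI)
    fix s t assume st: "s \<in> seqs n V" "t \<in> seqs n V" "E s = E t"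
    have "s j = t j" if "j < n" for j
    proof -
      have "e (s j) = e (t j)" using fun_cong[OF st(3), of j] that by (simp add: E_def)
      then show ?thesis using st V(2) that by (auto simp: seqs_def inj_on_def)
    qed
    then show "s = t" using st(1,2) unfolding seqs_def by (intro PiE_ext[of s _ _ t]) auto
  qed
  have Eimg: "E ` seqs n V = seqs n W"
  proof
    show "E ` seqs n V \<subseteq> seqs n W"
    proof (rule image_subsetI)
      fix s assume "s \<in> seqs n V"
      then show "E s \<in> seqs n W" unfolding E_def seqs_def W_def restrict_PiE_iff
        by (auto dest: PiE_mem)
    qed
    show "seqs n W \<subseteq> E ` seqs n V"
    proof
      fix r assume r: "r \<in> seqs n W"
      define s where "s = (\<lambda>j\<in>{..<n}. inv_into V e (r j))"
      have rW: "r j \<in> e ` V" if "j < n" for j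
        using r that unfolding seqs_def W_def by (auto dest: PiE_mem)
      have "s \<in> seqs n V" unfolding s_def seqs_def
        by (rule restrict_PiE_iff[THEN iffD2]) (simp add: rW inv_into_into)
      moreover have "E s = r"
      proof (rule extensionalityI[of _ "{..<n}"])
        show "E s \<in> extensional {..<n}" by (simp add: E_def)
        show "r \<in> extensional {..<n}" using r by (simp add: seqs_def PiE_iff)
        show "E s j = r j" if "j \<in> {..<n}" for j
          using that by (simp add: E_def s_def f_inv_into_f[OF rW])
      qed
      ultimately show "r \<in> E ` seqs n V" by blast
    qed
  qed
  define k where "k = (\<lambda>a. E ` (h a \<inter> seqs n V))"
  have k_mem: "E s \<in> k a \<longleftrightarrow> s \<in> h a" if "s \<in> seqs n V" for s a
    using that Einj by (auto simp: k_def inj_on_def)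
  have k_sub: "k a \<subseteq> seqs n W" for a using Eimg by (auto simp: k_def)
  have eqI: "X = Y" if "X \<subseteq> seqs n W" "Y \<subseteq> seqs n W" "\<And>s. s \<in> seqs n V \<Longrightarrow> E s \<in> X \<longleftrightarrow> E s \<in> Y" for X Y
    using that unfolding Eimg[symmetric] by (intro equalityI subsetI) (auto elim!: subsetD[THEN imageE])
  have VU: "seqs n V \<subseteq> seqs n U" using V(1) by (auto simp: seqs_def PiE_iff)
  have EW: "E s \<in> seqs n W" if "s \<in> seqs n V" for s unfolding Eimg[symmetric] using that by (rule imageI)
  have Efun: "E (s \<circ> f) = E s \<circ> f" if "\<And>j. j < n \<longleftrightarrow> f j < n" for s f
    using that by (auto simp: E_def fun_eq_iff)
  have Eupd: "E s \<circ> id(i := j) = E (s \<circ> id(i := j))" "E s \<circ> transpose i j = E (s \<circ> transpose i j)"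
    if "i < n" "j < n" for s i j
    using that by (auto simp: Efun transpose_def)
  have Efix: "E s i = E s j \<longleftrightarrow> s i = s j" if "s \<in> seqs n V" "i < n" "j < n" for s i j
  proof -
    have "s i \<in> V" "s j \<in> V" using that by (auto simp: seqs_def)
    then show ?thesis using V(2) that by (auto simp: E_def inj_on_def)
  qed
  have comp_in: "s \<circ> id(i := j) \<in> seqs n V" "s \<circ> transpose i j \<in> seqs n V"
    if "s \<in> seqs n V" "i < n" "j < n" for s i j
    using that by (auto simp: seqs_def PiE_iff extensional_def transpose_def)
  have h_oper: "h (oper A f xs) = set_op n U f (map h xs)"
    if "t f = Some m" "length xs = m" "set xs \<subseteq> univ A" for f m xs
    using h that by (auto simp: is_hom_def set_alg_def)
  have k_oper: "k (oper A f xs) = set_op n W f (map k xs)"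
    if f: "t f = Some m" and len: "length xs = m" and xs: "set xs \<subseteq> univ A" for f m xs
  proof -
    have sub: "set_op n W f (map k xs) \<subseteq> seqs n W" by (cases f) auto
    have "E s \<in> k (oper A f xs) \<longleftrightarrow> E s \<in> set_op n W f (map k xs)" if s: "s \<in> seqs n V" for s
    proof -
      have sig: "pea_sig n UNIV f = Some m" using t f by (auto simp: map_le_def dom_def)
      have ho: "E s \<in> k (oper A f xs) \<longleftrightarrow> s \<in> set_op n U f (map h xs)"
        using k_mem[OF s] h_oper[OF f len xs] by simp
      have sU: "s \<in> seqs n U" using s VU by blast
      show "E s \<in> k (oper A f xs) \<longleftrightarrow> E s \<in> set_op n W f (map k xs)"
      proof (cases f)
        case (Cyl i)
        have i: "i < n" and m: "m = 1" using sig Cyl by (auto split: if_splits)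
        then obtain x where x: "xs = [x]" "x \<in> univ A" using len xs by (auto simp: length_Suc_conv)
        have "(\<exists>r\<in>h x. \<forall>j<n. j \<noteq> i \<longrightarrow> r j = s j) \<longleftrightarrow> (\<exists>r\<in>k x. \<forall>j<n. j \<noteq> i \<longrightarrow> r j = E s j)"
        proof
          assume "\<exists>r\<in>h x. \<forall>j<n. j \<noteq> i \<longrightarrow> r j = s j"
          then obtain r where r: "r \<in> h x" "\<forall>j<n. j \<noteq> i \<longrightarrow> r j = s j" by blast
          have rU: "r \<in> seqs n U" using r hsub x by blast
          have "s(i := r i) = r" using r(2) sU rU i
            by (intro PiE_ext[where k="{..<n}" and s="\<lambda>_. U"]) (auto simp: seqs_def PiE_iff extensional_def)
          moreover have "r i \<in> U" using rU i by (auto simp: seqs_def)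
          ultimately obtain v where v: "v \<in> V" "s(i := v) \<in> h x" using wit[OF s i, of x] r(1) by metis
          have "s(i := v) \<in> seqs n V" using s v(1) i by (auto simp: seqs_def PiE_iff extensional_def)
          then have "E (s(i := v)) \<in> k x" using k_mem v(2) by blast
          moreover have "\<forall>j<n. j \<noteq> i \<longrightarrow> E (s(i := v)) j = E s j" by (simp add: E_def)
          ultimately show "\<exists>r\<in>k x. \<forall>j<n. j \<noteq> i \<longrightarrow> r j = E s j" by blast
        next
          assume "\<exists>r\<in>k x. \<forall>j<n. j \<noteq> i \<longrightarrow> r j = E s j"
          then obtain r where r: "r \<in> h x" "r \<in> seqs n V" "\<forall>j<n. j \<noteq> i \<longrightarrow> E r j = E s j"
            by (auto simp: k_def)
          have "r j = s j" if "j < n" "j \<noteq> i" for j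
          proof -
            have "e (r j) = e (s j)" using r(3) that by (auto simp: E_def)
            then show ?thesis using V(2) r(2) s that by (auto simp: seqs_def inj_on_def)
          qed
          then show "\<exists>r\<in>h x. \<forall>j<n. j \<noteq> i \<longrightarrow> r j = s j" using r(1) by blast
        qed
        then show ?thesis using ho Cyl x sU EW[OF s] by simp
      next
        case (Diag i j)
        have ij: "i < n" "j < n" using sig Diag by (auto split: if_splits)
        show ?thesis using ho Diag sU EW[OF s] Efix[OF s ij] by simp
      next
        case (Repl i j)
        have ij: "i < n" "j < n" and m: "m = 1" using sig Repl by (auto split: if_splits)
        then obtain x where x: "xs = [x]" using len by (auto simp: length_Suc_conv)
        show ?thesis using ho Repl sU EW[OF s] x Eupd(1)[OF ij] k_mem[OF comp_in(1)[OF s ij]] by simp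
      next
        case (Swap i j)
        have ij: "i < n" "j < n" and m: "m = 1" using sig Swap by (auto split: if_splits)
        then obtain x where x: "xs = [x]" using len by (auto simp: length_Suc_conv)
        show ?thesis using ho Swap sU EW[OF s] x Eupd(2)[OF ij] k_mem[OF comp_in(2)[OF s ij]] by simp
      qed
    qed
    then show ?thesis using eqI[OF k_sub sub] by blast
  qed
  have h_bool: "h (bzero A) = {}" "h (bone A) = seqs n U"
    "\<And>x. x \<in> univ A \<Longrightarrow> h (cpl A x) = seqs n U - h x"
    "\<And>x y. x \<in> univ A \<Longrightarrow> y \<in> univ A \<Longrightarrow> h (join A x y) = h x \<union> h y"
    "\<And>x y. x \<in> univ A \<Longrightarrow> y \<in> univ A \<Longrightarrow> h (meet A x y) = h x \<inter> h y"
    using h by (simp_all add: is_hom_def set_alg_def)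
  have k_bool: "k (bzero A) = {}" "k (bone A) = seqs n W"
    "\<And>x. x \<in> univ A \<Longrightarrow> k (cpl A x) = seqs n W - k x"
    "\<And>x y. x \<in> univ A \<Longrightarrow> y \<in> univ A \<Longrightarrow> k (join A x y) = k x \<union> k y"
    "\<And>x y. x \<in> univ A \<Longrightarrow> y \<in> univ A \<Longrightarrow> k (meet A x y) = k x \<inter> k y"
  proof -
    show "k (bzero A) = {}" by (simp add: h_bool(1) k_def)
    show "k (bone A) = seqs n W"
      by (rule eqI[OF k_sub]) (use VU EW in \<open>auto simp: k_mem h_bool(2)\<close>)
    show "k (cpl A x) = seqs n W - k x" if "x \<in> univ A" for x
      by (rule eqI[OF k_sub]) (use VU EW in \<open>auto simp: k_mem h_bool(3)[OF that]\<close>)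
    show "k (join A x y) = k x \<union> k y" if "x \<in> univ A" "y \<in> univ A" for x y
      using h_bool(4)[OF that] by (auto simp: k_def)
    show "k (meet A x y) = k x \<inter> k y" if "x \<in> univ A" "y \<in> univ A" for x y
    proof (rule eqI[OF k_sub])
      show "k x \<inter> k y \<subseteq> seqs n W" using k_sub by blast
    qed (simp add: k_mem h_bool(5)[OF that])
  qed
  have "is_hom t k A (set_alg n W)"
    unfolding is_hom_def using k_sub by (simp add: set_alg_def k_bool k_oper image_subset_iff)
  moreover have "k d \<noteq> {}" using s0 s0V by (auto simp: k_def)
  ultimately show ?thesis by blast
qed

lemma representableI:
  fixes A :: "(pea_op, 'a) alg" and I :: "'i set" and U :: "'i \<Rightarrow> 'u set"
  assumes "n > 0" "t \<subseteq>\<^sub>m pea_sig n UNIV" "algebra t A"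
    and "iso_to_subalgebra t A (prod_alg I (\<lambda>i. set_alg n (U i)))"
  shows "representable n t A"
  unfolding representable_def
  by (rule change_base[OF assms(3,4)]) (simp_all add: set_alg_def[of n] set_alg_down[OF assms(1-3), unfolded set_alg_def])

lemma rel_alg_down:
  fixes A :: "(ra_op, 'a) alg" and U :: "'u set"
  assumes A: "algebra ra_sig A" and h: "is_hom ra_sig h A (rel_alg U)"
    and d: "d \<in> univ A" "d \<noteq> bzero A" "h d \<noteq> {}"
  shows "\<exists>(V :: 'a list set) h'. is_hom ra_sig h' A (rel_alg V) \<and> h' d \<noteq> {}"
proof -
  have hsub: "h a \<subseteq> U \<times> U" if "a \<in> univ A" for a
    using h that by (auto simp: is_hom_def rel_alg_def)
  obtain u0 v0 where uv: "(u0, v0) \<in> h d" using d by auto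
  then have uvU: "u0 \<in> U" "v0 \<in> U" using hsub d by auto
  have hc: "h (comp A a b) = h a O h b" if "a \<in> univ A" "b \<in> univ A" for a b
  proof -
    have "h (oper A Comp [a, b]) = oper (rel_alg U) Comp (map h [a, b])"
      using h that unfolding is_hom_def by (metis (no_types) ra_sig_def fun_upd_same length_Cons list.size(3) One_nat_def
          Suc_1 empty_set empty_subsetI insert_subset list.simps(15))
    then show ?thesis by (simp add: rel_alg_def)
  qed
  have hv: "h (conv A a) = (h a)\<inverse>" if "a \<in> univ A" for a
    using h that unfolding is_hom_def ra_sig_def rel_alg_def
    by (auto dest!: spec[of _ Conv] spec[of _ "[a]"])
  have hi: "h (ident A) = Id_on U"
    using h unfolding is_hom_def ra_sig_def rel_alg_def
    by (auto dest!: spec[of _ Ident] spec[of _ "[]"])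
  define ar where "ar = (\<lambda>i::nat. if i = 0 then 2 else 0 :: nat)"
  define P where "P = (\<lambda>a b u w v. v \<in> U \<and> (u, v) \<in> h a \<and> (v, w) \<in> h b)"
  define sk where "sk = (\<lambda>(i :: nat) (a, b) us.
    if i = 0 then (if Ex (P a b (us ! 0) (us ! 1)) then Eps (P a b (us ! 0) (us ! 1)) else u0)
    else if i = 1 then u0 else v0)"
  have skU: "sk i ab us \<in> U" for i ab us
  proof (cases ab)
    case (Pair a b)
    have "Eps (P a b (us ! 0) (us ! 1)) \<in> U" if "Ex (P a b (us ! 0) (us ! 1))"
      using someI_ex[OF that] by (simp only: P_def)
    then show ?thesis using uvU by (simp add: sk_def Pair del: split_paired_Ex)
  qed
  obtain V and e :: "'u \<Rightarrow> 'a list" where V: "V \<subseteq> U" "inj_on e V"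
    and cl: "\<And>i a us. length us = ar i \<Longrightarrow> set us \<subseteq> V \<Longrightarrow> sk i a us \<in> V"
    by (rule skolem_hull[OF d(2), of ar U sk], rule skU, rule that; assumption)
  have uvV: "u0 \<in> V" "v0 \<in> V"
    using cl[of "[]" 1 "(d, d)"] cl[of "[]" 2 "(d, d)"] by (simp_all add: ar_def sk_def)
  have wit: "\<exists>v\<in>V. (u, v) \<in> h a \<and> (v, w) \<in> h b"
    if "u \<in> V" "w \<in> V" "(u, w) \<in> h a O h b" "a \<in> univ A" "b \<in> univ A" for u w a b
  proof -
    have ex: "Ex (P a b u w)" using that hsub unfolding P_def by blast
    then have "sk 0 (a, b) [u, w] = Eps (P a b u w)" by (simp add: sk_def)
    moreover have "P a b u w (Eps (P a b u w))" using someI_ex[OF ex] .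
    moreover have "sk 0 (a, b) [u, w] \<in> V" using cl[of "[u, w]" 0 "(a, b)"] that by (simp add: ar_def)
    ultimately show ?thesis by (auto simp: P_def)
  qed
  define W where "W = e ` V"
  define k where "k = (\<lambda>a. {(e u, e v) | u v. u \<in> V \<and> v \<in> V \<and> (u, v) \<in> h a})"
  have k_mem: "(e u, e v) \<in> k a \<longleftrightarrow> (u, v) \<in> h a" if "u \<in> V" "v \<in> V" for u v a
    using that V(2) by (auto simp: k_def inj_on_def)
  have k_sub: "k a \<subseteq> W \<times> W" for a by (auto simp: k_def W_def)
  have eqI: "X = Y" if "X \<subseteq> W \<times> W" "Y \<subseteq> W \<times> W"
    "\<And>u v. u \<in> V \<Longrightarrow> v \<in> V \<Longrightarrow> (e u, e v) \<in> X \<longleftrightarrow> (e u, e v) \<in> Y" for X Y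
    using that unfolding W_def by blast
  have kc: "k (comp A a b) = k a O k b" if ab: "a \<in> univ A" "b \<in> univ A" for a b
  proof (rule eqI[OF k_sub])
    show "k a O k b \<subseteq> W \<times> W" using k_sub by blast
    fix u w assume uw: "u \<in> V" "w \<in> V"
    have "(e u, e w) \<in> k (comp A a b) \<longleftrightarrow> (u, w) \<in> h a O h b" using k_mem uw hc ab by simp
    also have "\<dots> \<longleftrightarrow> (\<exists>v\<in>V. (u, v) \<in> h a \<and> (v, w) \<in> h b)" using wit[OF uw _ ab] by blast
    also have "\<dots> \<longleftrightarrow> (\<exists>v\<in>V. (e u, e v) \<in> k a \<and> (e v, e w) \<in> k b)" using k_mem uw by blast
    also have "\<dots> \<longleftrightarrow> (e u, e w) \<in> k a O k b" using k_sub[of a] unfolding W_def by blast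
    finally show "(e u, e w) \<in> k (comp A a b) \<longleftrightarrow> (e u, e w) \<in> k a O k b" .
  qed
  have kv: "k (conv A a) = (k a)\<inverse>" if "a \<in> univ A" for a
    using hv[OF that] by (auto simp: k_def)
  have ki: "k (ident A) = Id_on W"
    using hi V by (auto simp: k_def W_def)
  have k_oper: "k (oper A f xs) = rel_op W f (map k xs)"
    if f: "ra_sig f = Some m" and len: "length xs = m" and xs: "set xs \<subseteq> univ A" for f m xs
  proof (cases f)
    case Ident
    then show ?thesis using f len ki by (simp add: ra_sig_def)
  next
    case Conv
    then obtain x where "xs = [x]" "x \<in> univ A" using f len xs by (auto simp: ra_sig_def length_Suc_conv)
    then show ?thesis using Conv kv by simp
  next
    case Comp
    then have "length xs = Suc (Suc 0)" using f len by (simp add: ra_sig_def)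
    then obtain x y where "xs = [x, y]" "x \<in> univ A" "y \<in> univ A"
      using xs by (auto simp: length_Suc_conv)
    then show ?thesis using Comp kc by simp
  qed
  have h_bool: "h (bzero A) = {}" "h (bone A) = U \<times> U"
    "\<And>x. x \<in> univ A \<Longrightarrow> h (cpl A x) = U \<times> U - h x"
    "\<And>x y. x \<in> univ A \<Longrightarrow> y \<in> univ A \<Longrightarrow> h (join A x y) = h x \<union> h y"
    "\<And>x y. x \<in> univ A \<Longrightarrow> y \<in> univ A \<Longrightarrow> h (meet A x y) = h x \<inter> h y"
    using h by (simp_all add: is_hom_def rel_alg_def)
  have k_bool: "k (bzero A) = {}" "k (bone A) = W \<times> W"
    "\<And>x. x \<in> univ A \<Longrightarrow> k (cpl A x) = W \<times> W - k x"
    "\<And>x y. x \<in> univ A \<Longrightarrow> y \<in> univ A \<Longrightarrow> k (join A x y) = k x \<union> k y"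
    "\<And>x y. x \<in> univ A \<Longrightarrow> y \<in> univ A \<Longrightarrow> k (meet A x y) = k x \<inter> k y"
  proof -
    show "k (bzero A) = {}" by (simp add: h_bool(1) k_def)
    show "k (bone A) = W \<times> W"
      by (rule eqI[OF k_sub]) (use V(1) W_def in \<open>auto simp: k_mem h_bool(2)\<close>)
    show "k (cpl A x) = W \<times> W - k x" if "x \<in> univ A" for x
      by (rule eqI[OF k_sub]) (use V(1) W_def in \<open>auto simp: k_mem h_bool(3)[OF that]\<close>)
    show "k (join A x y) = k x \<union> k y" if "x \<in> univ A" "y \<in> univ A" for x y
      using h_bool(4)[OF that] by (auto simp: k_def)
    show "k (meet A x y) = k x \<inter> k y" if "x \<in> univ A" "y \<in> univ A" for x y
    proof (rule eqI[OF k_sub])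
      show "k x \<inter> k y \<subseteq> W \<times> W" using k_sub by blast
    qed (simp add: k_mem h_bool(5)[OF that])
  qed
  have "is_hom ra_sig k A (rel_alg W)"
    unfolding is_hom_def using k_sub by (simp add: rel_alg_def k_bool k_oper image_subset_iff)
  moreover have "k d \<noteq> {}" using uv uvV by (auto simp: k_def)
  ultimately show ?thesis by blast
qed

lemma ra_representableI:
  fixes A :: "(ra_op, 'a) alg" and I :: "'i set" and U :: "'i \<Rightarrow> 'u set"
  assumes "algebra ra_sig A"
    and "iso_to_subalgebra ra_sig A (prod_alg I (\<lambda>i. rel_alg (U i)))"
  shows "ra_representable A"
  unfolding ra_representable_def
  by (rule change_base[OF assms])
    (simp_all add: rel_alg_def rel_alg_down[OF assms(1), unfolded rel_alg_def])

end

theory Submission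
  imports Defs "HOL-Library.Ramsey" "HOL-Library.Nat_Bijection"
begin

text \<open>
  Both parts come from one symmetric integral relation algebra, a blow-up of a finite Monk algebra.
  Its atoms are the identity and atoms that carry a colour, of which there are finitely many, and a
  block, of which there are infinitely many; a block contains a fixed finite number of atoms of
  each colour. Two atoms are adjacent if they are distinct and in the same block. A triangle of
  non-identity atoms of one colour is consistent iff two of its sides are adjacent, and all
  triangles that are not monochromatic are consistent.

  The complex algebra contains infinite sets of atoms. Choosing one atom of a fixed colour in every
  block gives a set without consistent triangles (\<open>no_triangle\<close>), and finitely many such sets
  cover all atoms except the identity. In a representation, infinitely many atoms must hold
  between one point and others, and by Ramsey's theorem three of those other points span a triangle
  inside one of the sets, a contradiction. Diagonals are not needed in the signature for this: for
  the diagonal-free reduct of the algebra of matrices (\<open>not_representable_Cm\<close>) the argument is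
  carried out on the first three coordinates of sequences, where the images of the diagonal elements
  of the complex algebra, as mere elements, transfer relations from one pair of coordinates to
  another.

  The term algebra does not see these sets. All its elements are invariant under a change of a
  matrix that keeps the colours, the atoms in the first \<open>k\<close> blocks, and the pattern of
  equalities between blocks, for some \<open>k\<close> (\<open>sim\<close>). That this property survives
  cylindrification (\<open>sim_extend\<close>) is due to the size of the blocks. So there is room for
  new ideal labels, one for each colour, that stand for an atom in an infinitely remote block. The
  ideal label of a colour is adjacent to itself, hence large sets of points may be labelled with it
  alone. A base of points is built as an inductively defined set of finite trees (\<open>base\<close>):
  each tree prescribes its labels to fewer than \<open>n\<close> older points, and all other pairs get an
  ideal label of a colour that avoids every prescribed one at both ends (\<open>tri_lam\<close>). A set
  \<open>X\<close> of matrices is represented by the sequences of points whose labels, with the ideal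
  ones replaced by distinct atoms of block \<open>p\<close>, form a matrix in \<open>X\<close> for all large
  \<open>p\<close> (\<open>limit_set\<close>, \<open>gen\<close>). Invariance makes this a Boolean homomorphism, and
  extension of points makes it commute with cylindrifications (\<open>lim_Cyl\<close>). The same
  construction with single labels represents the finite-cofinite algebra over the atoms of the
  relation algebra.

  With enough colours and with large enough blocks, consistent matrices extend and amalgamate
  (\<open>mats_extend\<close>, \<open>mats_amalgamate\<close>); this gives the polyadic equality basis and the
  axioms of polyadic equality algebras.
\<close>

section \<open>Complex algebras and their subalgebras\<close>

lemma Cm_simps [simp]:
  "univ (Cm S) = Pow (points S)" "join (Cm S) = (\<union>)" "meet (Cm S) = (\<inter>)"
  "cpl (Cm S) X = points S - X" "bzero (Cm S) = {}" "bone (Cm S) = points S"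
  by (simp_all add: Cm_def)

lemma list_all2_in_Nil: "list_all2 (\<in>) ss [] \<longleftrightarrow> ss = []"
  and list_all2_in_1: "list_all2 (\<in>) ss [X] \<longleftrightarrow> (\<exists>s. ss = [s] \<and> s \<in> X)"
  and list_all2_in_2: "list_all2 (\<in>) ss [X, Y] \<longleftrightarrow> (\<exists>s t. ss = [s, t] \<and> s \<in> X \<and> t \<in> Y)"
  by (auto simp: list_all2_Cons2)

lemma list_all2_in_singletons: "list_all2 (\<in>) ss' (map (\<lambda>s. {s}) ss) \<longleftrightarrow> ss' = ss"
  by (auto simp: list_all2_conv_all_nth list_eq_iff_nth_eq)

lemma Cm_oper:
  "oper (Cm S) f [] = {s \<in> points S. rel S f s []}"
  "oper (Cm S) f [X] = {s \<in> points S. \<exists>t\<in>X. rel S f s [t]}"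
  "oper (Cm S) f [X, Y] = {s \<in> points S. \<exists>t\<in>X. \<exists>u\<in>Y. rel S f s [t, u]}"
  by (auto simp: Cm_def list_all2_in_Nil list_all2_in_1 list_all2_in_2)

lemma subuniverse_Cm: "subuniverse t (Cm S) (Pow (points S))"
  by (auto simp: subuniverse_def Cm_def)

lemma algebra_Cm: "algebra t (Cm S)"
  by (simp add: algebra_def subuniverse_Cm)

lemma algebra_subuniverse:
  assumes "subuniverse t A X"
  shows "algebra t (A\<lparr>univ := X\<rparr>)"
  using assms by (auto simp: algebra_def subuniverse_def)

lemma subuniverse_Tm: "subuniverse t (Cm S) (univ (Tm t S))"
proof -
  let ?F = "{X. subuniverse t (Cm S) X \<and> (\<forall>s\<in>points S. {s} \<in> X)}"
  have "Pow (points S) \<in> ?F" using subuniverse_Cm by auto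
  then have "\<Inter>?F \<subseteq> Pow (points S)" by (rule Inter_lower)
  moreover have "oper (Cm S) f xs \<in> \<Inter>?F"
    if "t f = Some k" "length xs = k" "set xs \<subseteq> \<Inter>?F" for f k xs
  proof
    fix X assume X: "X \<in> ?F"
    with that(3) have "set xs \<subseteq> X" by blast
    with X that(1,2) show "oper (Cm S) f xs \<in> X" unfolding subuniverse_def by blast
  qed
  ultimately have "subuniverse t (Cm S) (\<Inter>?F)"
    unfolding subuniverse_def by (auto simp del: Cm_simps(4))
  then show ?thesis by (simp add: Tm_def)
qed

lemma univ_Tm_subset:
  assumes "subuniverse t (Cm S) T" "\<And>s. s \<in> points S \<Longrightarrow> {s} \<in> T"
  shows "univ (Tm t S) \<subseteq> T"
  using assms by (auto simp: Tm_def)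

lemma boolean_subuniverse_Cm:
  assumes "T \<subseteq> Pow (points S)"
  shows "boolean ((Cm S)\<lparr>univ := T\<rparr>)"
  using assms unfolding boolean_def by (auto simp: subset_iff)

lemma below_Cm [simp]: "below ((Cm S)\<lparr>univ := T\<rparr>) X Y \<longleftrightarrow> X \<subseteq> Y"
  by (auto simp: below_def)

lemma below_Cm' [simp]: "below (Cm S) X Y \<longleftrightarrow> X \<subseteq> Y"
  by (auto simp: below_def)

lemma atoms_Cm:
  assumes "T \<subseteq> Pow (points S)" "\<And>s. s \<in> points S \<Longrightarrow> {s} \<in> T"
  shows "atoms ((Cm S)\<lparr>univ := T\<rparr>) = (\<lambda>s. {s}) ` points S"
proof -
  have "\<exists>s\<in>points S. a = {s}"
    if "a \<in> T" "a \<noteq> {}" "\<forall>x\<in>T. x \<subseteq> a \<longrightarrow> x = {} \<or> x = a" for a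
  proof -
    obtain s where "s \<in> a" using \<open>a \<noteq> {}\<close> by blast
    with that assms have "s \<in> points S" "{s} = a" by blast+
    then show ?thesis by blast
  qed
  then show ?thesis using assms unfolding atoms_def by auto
qed

lemma atomic_Cm:
  assumes "T \<subseteq> Pow (points S)" "\<And>s. s \<in> points S \<Longrightarrow> {s} \<in> T"
  shows "atomic ((Cm S)\<lparr>univ := T\<rparr>)"
proof -
  have "\<exists>s\<in>points S. {s} \<subseteq> X" if "X \<in> T" "X \<noteq> {}" for X
    using assms that by (meson PowD empty_subsetI equals0I insert_subset subsetD)
  then show ?thesis unfolding atomic_def by (simp add: atoms_Cm[OF assms])
qed

lemma At_Cm_iso:
  assumes "T \<subseteq> Pow (points S)" "\<And>s. s \<in> points S \<Longrightarrow> {s} \<in> T"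
  shows "atstr_iso t (At ((Cm S)\<lparr>univ := T\<rparr>)) S"
proof -
  have "rel (At ((Cm S)\<lparr>univ := T\<rparr>)) f s ss \<longleftrightarrow> rel S f (the_elem s) (map the_elem ss)"
    if "s \<in> (\<lambda>s. {s}) ` points S" "set ss \<subseteq> (\<lambda>s. {s}) ` points S" for f s ss
  proof -
    from that(1) obtain r where r: "r \<in> points S" "s = {r}" by blast
    have "ss = map (\<lambda>s. {s}) (map the_elem ss)" using that(2) by (induction ss) auto
    then obtain rs where rs: "ss = map (\<lambda>s. {s}) rs" by blast
    show ?thesis using r rs by (auto simp: At_def Cm_def comp_def below_def list_all2_in_singletons)
  qed
  moreover have "bij_betw the_elem ((\<lambda>s. {s}) ` points S) (points S)"
    by (auto simp: bij_betw_def inj_on_def image_image)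
  ultimately show ?thesis
    unfolding atstr_iso_def by (intro exI[of _ the_elem]) (simp add: At_def atoms_Cm[OF assms])
qed

lemma Cm_univ: "(Cm S)\<lparr>univ := Pow (points S)\<rparr> = Cm S"
  by (simp add: Cm_def)

lemma atoms_Cm_full: "atoms (Cm S) = (\<lambda>s. {s}) ` points S"
  using atoms_Cm[of "Pow (points S)" S] by (simp add: Cm_univ)

lemma atomic_Cm_full: "atomic (Cm S)"
  using atomic_Cm[of "Pow (points S)" S] by (simp add: Cm_univ)

lemma At_Cm_iso_full: "atstr_iso t (At (Cm S)) S"
  using At_Cm_iso[of "Pow (points S)" S] by (simp add: Cm_univ)

lemma atstr_of_classI:
  assumes "K (Cm S)"
  shows "atstr_of_class t K S"
  unfolding atstr_of_class_def using assms
  by (intro exI[of _ "Cm S"] conjI atomic_Cm_full At_Cm_iso_full)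

lemma not_strongly_representableI:
  assumes "K (Cm S)" "\<not> Rep (Cm S)"
  shows "\<not> strongly_representable t K Rep S"
proof
  assume "strongly_representable t K Rep S"
  then have "K (Cm S) \<and> atomic (Cm S) \<and> atstr_iso t (At (Cm S)) S \<longrightarrow> Rep (Cm S)"
    unfolding strongly_representable_def ..
  then show False using assms by (simp add: atomic_Cm_full At_Cm_iso_full)
qed


section \<open>Representations by homomorphisms\<close>

lemma pea_sig_mono: "pea_sig n F \<subseteq>\<^sub>m pea_sig n UNIV"
  unfolding map_le_def
proof
  fix f assume "f \<in> dom (pea_sig n F)"
  then show "pea_sig n F f = pea_sig n UNIV f" by (cases f) (auto split: if_splits)
qed

lemma representable_of_hom:
  assumes "n > 0" "algebra (pea_sig n F) A"
    and "is_hom (pea_sig n F) h A (set_alg n U)" "inj_on h (univ A)"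
  shows "representable n (pea_sig n F) A"
proof (rule representableI[OF assms(1) pea_sig_mono assms(2)])
  show "iso_to_subalgebra (pea_sig n F) A (prod_alg (UNIV :: unit set) (\<lambda>_. set_alg n U))"
    using assms by (intro hom_iso_to_subalgebra[where g = "\<lambda>a _. h a"])
      (auto simp: inj_on_def fun_eq_iff)
qed

lemma ra_representable_of_hom:
  assumes "algebra ra_sig A" "is_hom ra_sig h A (rel_alg U)" "inj_on h (univ A)"
  shows "ra_representable A"
proof (rule ra_representableI[OF assms(1)])
  show "iso_to_subalgebra ra_sig A (prod_alg (UNIV :: unit set) (\<lambda>_. rel_alg U))"
    using assms by (intro hom_iso_to_subalgebra[where g = "\<lambda>a _. h a"])
      (auto simp: inj_on_def fun_eq_iff)
qed

lemma nontrivial_hom: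
  assumes iso: "iso_to_subalgebra t A (prod_alg I B)" and A: "algebra t A" and ne: "bzero A \<noteq> bone A"
  obtains h i where "is_hom t h A (B i)" "bzero (B i) \<noteq> bone (B i)"
proof -
  obtain g where g: "inj_on g (univ A)" "g ` univ A \<subseteq> (\<Pi>\<^sub>E i\<in>I. univ (B i))"
    "\<And>i. i \<in> I \<Longrightarrow> is_hom t (\<lambda>a. g a i) A (B i)"
    using iso_to_subalgebra_hom[OF iso A] by metis
  have U: "bzero A \<in> univ A" "bone A \<in> univ A" using A by (auto simp: algebra_def subuniverse_def)
  then have "g (bzero A) \<noteq> g (bone A)" using g(1) ne by (auto simp: inj_on_def)
  moreover have "g (bzero A) \<in> extensional I" "g (bone A) \<in> extensional I"
    using g(2) U by (auto simp: PiE_iff)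
  ultimately obtain i where "i \<in> I" "g (bzero A) i \<noteq> g (bone A) i"
    by (meson extensionalityI)
  with g(3) that[of "\<lambda>a. g a i" i] show ?thesis by (auto simp: is_hom_def)
qed

lemma representable_homE:
  assumes "representable n t A" "algebra t A" "bzero A \<noteq> bone A"
  obtains h and U :: "'a list set" where "is_hom t h (A :: (pea_op, 'a) alg) (set_alg n U)" "seqs n U \<noteq> {}"
proof -
  obtain I :: "'a set" and U :: "'a \<Rightarrow> 'a list set"
    where "iso_to_subalgebra t A (prod_alg I (\<lambda>i. set_alg n (U i)))"
    using assms(1) unfolding representable_def by blast
  then obtain h i where "is_hom t h A (set_alg n (U i))" "bzero (set_alg n (U i)) \<noteq> bone (set_alg n (U i))"
    by (rule nontrivial_hom[OF _ assms(2,3)])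
  then show ?thesis by (intro that[of h "U i"]) (auto simp: set_alg_def)
qed

lemma ra_representable_homE:
  assumes "ra_representable A" "algebra ra_sig A" "bzero A \<noteq> bone A"
  obtains h and U :: "'a list set" where "is_hom ra_sig h (A :: (ra_op, 'a) alg) (rel_alg U)" "U \<noteq> {}"
proof -
  obtain I :: "'a set" and U :: "'a \<Rightarrow> 'a list set"
    where "iso_to_subalgebra ra_sig A (prod_alg I (\<lambda>i. rel_alg (U i)))"
    using assms(1) unfolding ra_representable_def by blast
  then obtain h i where "is_hom ra_sig h A (rel_alg (U i))" "bzero (rel_alg (U i)) \<noteq> bone (rel_alg (U i))"
    by (rule nontrivial_hom[OF _ assms(2,3)])
  then show ?thesis by (intro that[of h "U i"]) (auto simp: rel_alg_def)
qed

text \<open>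
  A Boolean homomorphism that sends no element but the empty set to the empty set is injective.
\<close>

lemma inj_on_Cm_hom:
  assumes T: "subuniverse t (Cm S) T"
    and cpl: "\<And>X. X \<in> T \<Longrightarrow> h (points S - X) = W - h X"
    and meet: "\<And>X Y. X \<in> T \<Longrightarrow> Y \<in> T \<Longrightarrow> h (X \<inter> Y) = h X \<inter> h Y"
    and ne: "\<And>X. X \<in> T \<Longrightarrow> X \<noteq> {} \<Longrightarrow> h X \<noteq> {}"
  shows "inj_on h T"
proof -
  have "X \<subseteq> Y" if "X \<in> T" "Y \<in> T" "h X = h Y" for X Y
  proof (rule ccontr)
    assume "\<not> X \<subseteq> Y"
    moreover have "X \<subseteq> points S" "points S - Y \<in> T" "X \<inter> (points S - Y) \<in> T"
      using T that by (auto simp: subuniverse_def)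
    ultimately have "h (X \<inter> (points S - Y)) \<noteq> {}" using ne by blast
    moreover have "h (X \<inter> (points S - Y)) = h X \<inter> (W - h Y)"
      using meet[OF that(1) \<open>points S - Y \<in> T\<close>] cpl[OF that(2)] by simp
    ultimately show False using that by blast
  qed
  then show ?thesis by (intro inj_onI subset_antisym) auto
qed

text \<open>Infinitely many points always carry a monochromatic triangle.\<close>

lemma infinite_triangle:
  fixes col :: "nat \<Rightarrow> nat \<Rightarrow> nat"
  assumes "\<And>a b. a < b \<Longrightarrow> col a b < C"
  obtains a b c where "a < b" "b < c" "col a b = col b c" "col a b = col a c"
proof -
  let ?f = "\<lambda>X. col (Min X) (Max X)"
  have "?f {x, y} < C" if "x \<noteq> y" for x y :: nat
    using assms[of "min x y" "max x y"] that by simp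
  then have "\<forall>x\<in>(UNIV :: nat set). \<forall>y\<in>UNIV. x \<noteq> y \<longrightarrow> ?f {x, y} < C" by blast
  from Ramsey2[where f = ?f, OF infinite_UNIV_nat this]
  obtain Y t where Y: "infinite Y" "\<forall>x\<in>Y. \<forall>y\<in>Y. x \<noteq> y \<longrightarrow> ?f {x, y} = t"
    by (elim exE conjE) (rule that)
  obtain a where a: "a \<in> Y" using Y(1) by fastforce
  obtain b where b: "b \<in> Y" "a < b" using Y(1) by (meson infinite_nat_iff_unbounded)
  obtain c where c: "c \<in> Y" "b < c" using Y(1) by (meson infinite_nat_iff_unbounded)
  have "col x y = t" if "x \<in> Y" "y \<in> Y" "x < y" for x y
    using Y(2)[rule_format, OF that(1,2)] that(3) by simp
  then show ?thesis using a b c by (intro that[of a b c]) auto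
qed


section \<open>Eventually invariant sets and limits\<close>

text \<open>
  The relations \<open>E k\<close> are similarities that become finer as \<open>k\<close> grows. The sets invariant
  under one of them form a Boolean algebra (for symmetric, decreasing \<open>E\<close>).
\<close>

definition invariant_sets :: "'s set \<Rightarrow> (nat \<Rightarrow> 's \<Rightarrow> 's \<Rightarrow> bool) \<Rightarrow> 's set set" where
  "invariant_sets P E = {X. X \<subseteq> P \<and> (\<exists>k>0. \<forall>s\<in>P. \<forall>t\<in>P. E k s t \<longrightarrow> (s \<in> X \<longleftrightarrow> t \<in> X))}"

text \<open>
  Each \<open>w\<close> in \<open>W\<close> is approximated by the points \<open>\<gamma> p w\<close>. Membership of \<open>w\<close> in
  the limit of \<open>X\<close> is eventual membership of the approximations in \<open>X\<close>.
\<close>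

definition limit_set :: "'w set \<Rightarrow> (nat \<Rightarrow> 'w \<Rightarrow> 's) \<Rightarrow> 's set \<Rightarrow> 'w set" where
  "limit_set W \<gamma> X = {w \<in> W. \<exists>B. \<forall>p\<ge>B. \<gamma> p w \<in> X}"

text \<open>
  If the approximations of every \<open>w\<close> are eventually similar to each other at every level \<open>k\<close>,
  then membership in an invariant set is eventually constant along them, and the limit is a Boolean
  homomorphism on invariant sets.
\<close>

locale limit_points =
  fixes P :: "'s set" and E :: "nat \<Rightarrow> 's \<Rightarrow> 's \<Rightarrow> bool" and W :: "'w set" and \<gamma> :: "nat \<Rightarrow> 'w \<Rightarrow> 's"
  assumes E_sym: "\<And>k s t. E k s t \<Longrightarrow> E k t s"
    and E_mono: "\<And>k k' s t. E k s t \<Longrightarrow> k' \<le> k \<Longrightarrow> E k' s t"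
    and in_P: "\<And>p w. w \<in> W \<Longrightarrow> 0 < p \<Longrightarrow> \<gamma> p w \<in> P"
    and eventually_E: "\<And>k w. w \<in> W \<Longrightarrow> 0 < k \<Longrightarrow> \<exists>B. \<forall>p\<ge>B. \<forall>p'\<ge>B. E k (\<gamma> p w) (\<gamma> p' w)"
begin

abbreviation "invs \<equiv> invariant_sets P E"
abbreviation "lim \<equiv> limit_set W \<gamma>"

lemma invsI:
  assumes "0 < k" "X \<subseteq> P" "\<And>s t. s \<in> P \<Longrightarrow> t \<in> P \<Longrightarrow> E k s t \<Longrightarrow> s \<in> X \<Longrightarrow> t \<in> X"
  shows "X \<in> invs"
  unfolding invariant_sets_def using assms E_sym by blast

lemma invs_subset: "X \<in> invs \<Longrightarrow> X \<subseteq> P"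
  by (simp add: invariant_sets_def)

lemma invsE2:
  assumes "X \<in> invs" "Y \<in> invs"
  obtains k where "0 < k" "X \<subseteq> P" "Y \<subseteq> P"
    "\<And>s t. s \<in> P \<Longrightarrow> t \<in> P \<Longrightarrow> E k s t \<Longrightarrow> s \<in> X \<longleftrightarrow> t \<in> X"
    "\<And>s t. s \<in> P \<Longrightarrow> t \<in> P \<Longrightarrow> E k s t \<Longrightarrow> s \<in> Y \<longleftrightarrow> t \<in> Y"
proof -
  from assms obtain k l where "0 < k" "X \<subseteq> P" "\<forall>s\<in>P. \<forall>t\<in>P. E k s t \<longrightarrow> (s \<in> X \<longleftrightarrow> t \<in> X)"
    "0 < l" "Y \<subseteq> P" "\<forall>s\<in>P. \<forall>t\<in>P. E l s t \<longrightarrow> (s \<in> Y \<longleftrightarrow> t \<in> Y)"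
    unfolding invariant_sets_def by blast
  moreover have "E k s t" "E l s t" if "E (max k l) s t" for s t using E_mono[OF that] by auto
  ultimately show ?thesis using that[of "max k l"] by auto
qed

lemma invsE:
  assumes "X \<in> invs"
  obtains k where "0 < k" "X \<subseteq> P" "\<And>s t. s \<in> P \<Longrightarrow> t \<in> P \<Longrightarrow> E k s t \<Longrightarrow> s \<in> X \<longleftrightarrow> t \<in> X"
  by (rule invsE2[OF assms assms]) (rule that)

lemma invs_bounds: "{} \<in> invs" "P \<in> invs"
  by (rule invsI[of 1]; simp)+

lemma invs_compl: "X \<in> invs \<Longrightarrow> P - X \<in> invs"
  by (erule invsE, erule invsI) blast+

lemma invs_Int: "X \<in> invs \<Longrightarrow> Y \<in> invs \<Longrightarrow> X \<inter> Y \<in> invs"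
  by (erule invsE2, assumption, erule invsI) blast+

lemma invs_Un: "X \<in> invs \<Longrightarrow> Y \<in> invs \<Longrightarrow> X \<union> Y \<in> invs"
  by (erule invsE2, assumption, erule invsI) blast+

lemma lim_subset: "lim X \<subseteq> W"
  by (auto simp: limit_set_def)

lemma lim_iff:
  assumes X: "X \<in> invs" and w: "w \<in> W"
  obtains B where "0 < B" "\<And>p. B \<le> p \<Longrightarrow> \<gamma> p w \<in> X \<longleftrightarrow> w \<in> lim X"
proof -
  from X obtain k where k: "0 < k" "\<And>s t. s \<in> P \<Longrightarrow> t \<in> P \<Longrightarrow> E k s t \<Longrightarrow> s \<in> X \<longleftrightarrow> t \<in> X"
    by (rule invsE) blast
  obtain B where B: "\<And>p p'. B \<le> p \<Longrightarrow> B \<le> p' \<Longrightarrow> E k (\<gamma> p w) (\<gamma> p' w)"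
    using eventually_E[OF w k(1)] by blast
  have eq: "\<gamma> p w \<in> X \<longleftrightarrow> \<gamma> p' w \<in> X" if "max B 1 \<le> p" "max B 1 \<le> p'" for p p'
    using that by (intro k(2) in_P[OF w] B) auto
  have "\<gamma> p w \<in> X \<longleftrightarrow> w \<in> lim X" if p: "max B 1 \<le> p" for p
  proof
    assume "\<gamma> p w \<in> X"
    then have "\<forall>p'\<ge>max B 1. \<gamma> p' w \<in> X" using eq[OF p] by blast
    then show "w \<in> lim X" using w unfolding limit_set_def by blast
  next
    assume "w \<in> lim X"
    then obtain C where "\<And>p. C \<le> p \<Longrightarrow> \<gamma> p w \<in> X" unfolding limit_set_def by blast
    then have "\<gamma> (max p C) w \<in> X" by simp
    then show "\<gamma> p w \<in> X" using eq[OF p, of "max p C"] le_trans[OF p max.cobounded1] by blast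
  qed
  then show ?thesis using that[of "max B 1"] by simp
qed

lemma lim_empty: "lim {} = {}"
  by (auto simp: limit_set_def)

lemma lim_all: "lim P = W"
  unfolding limit_set_def using in_P by (auto intro!: exI[of _ 1])

lemma lim_Int: "lim (X \<inter> Y) = lim X \<inter> lim Y"
proof
  show "lim X \<inter> lim Y \<subseteq> lim (X \<inter> Y)"
  proof
    fix w assume "w \<in> lim X \<inter> lim Y"
    then obtain B C where "w \<in> W" "\<forall>p\<ge>B. \<gamma> p w \<in> X" "\<forall>p\<ge>C. \<gamma> p w \<in> Y"
      unfolding limit_set_def by blast
    then have "w \<in> W \<and> (\<forall>p\<ge>max B C. \<gamma> p w \<in> X \<inter> Y)" by simp
    then show "w \<in> lim (X \<inter> Y)" unfolding limit_set_def by blast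
  qed
qed (auto simp: limit_set_def)

lemma lim_compl:
  assumes "X \<in> invs"
  shows "lim (P - X) = W - lim X"
proof -
  have "w \<in> lim (P - X) \<longleftrightarrow> w \<notin> lim X" if w: "w \<in> W" for w
  proof -
    obtain B where B: "0 < B" "\<And>p. B \<le> p \<Longrightarrow> \<gamma> p w \<in> X \<longleftrightarrow> w \<in> lim X"
      using lim_iff[OF assms w] by blast
    obtain C where C: "\<And>p. C \<le> p \<Longrightarrow> \<gamma> p w \<in> P - X \<longleftrightarrow> w \<in> lim (P - X)"
      using lim_iff[OF invs_compl[OF assms] w] by blast
    show ?thesis using B(2)[of "max B C"] C[of "max B C"] in_P[OF w, of "max B C"] B(1) by auto
  qed
  then show ?thesis using lim_subset by blast
qed

lemma lim_Un:
  assumes "X \<in> invs" "Y \<in> invs"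
  shows "lim (X \<union> Y) = lim X \<union> lim Y"
proof -
  have "X \<union> Y = P - ((P - X) \<inter> (P - Y))" using invs_subset assms by blast
  then have "lim (X \<union> Y) = W - ((W - lim X) \<inter> (W - lim Y))"
    using assms lim_compl invs_compl invs_Int lim_Int by metis
  then show ?thesis using lim_subset by blast
qed

lemma inj_on_lim:
  assumes "T \<subseteq> invs" "subuniverse t (Cm S) T" "points S = P"
    and "\<And>s. s \<in> P \<Longrightarrow> \<exists>w\<in>W. \<forall>p. \<gamma> p w = s"
  shows "inj_on lim T"
proof (rule inj_on_Cm_hom[OF assms(2), where W = W])
  show "lim (points S - X) = W - lim X" if "X \<in> T" for X
    unfolding assms(3) using that assms(1) by (intro lim_compl) blast
  show "lim X \<noteq> {}" if X: "X \<in> T" "X \<noteq> {}" for X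
  proof -
    obtain s where "s \<in> X" "s \<in> P" using X assms(1) invs_subset by blast
    moreover from assms(4)[OF \<open>s \<in> P\<close>] obtain w where "w \<in> W" "\<And>p. \<gamma> p w = s" by blast
    ultimately have "w \<in> lim X" by (simp add: limit_set_def)
    then show ?thesis by blast
  qed
qed (rule lim_Int)

end

section \<open>Labels and consistent triangles\<close>

text \<open>
  In this locale \<open>N\<close> is the number of colours, \<open>K\<close> the number of atoms of a given colour
  in a block and \<open>L\<close> the size of a block. Two points of the base below prescribe at most
  \<open>2 * (n - 1)\<close> labels, so a colour avoiding all of them exists. There are \<open>n * n\<close> entries in a
  matrix, and \<open>n\<close> more indices are needed to choose a row that avoids them.
\<close>

locale dimension =
  fixes n :: nat
  assumes n_gt_2: "2 < n"
begin

definition N :: nat where "N = 2 * n"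
definition K :: nat where "K = n * n + n"
definition L :: nat where "L = N * K"

text \<open>
  The label number \<open>q\<close> of colour \<open>j\<close> in block \<open>p\<close>, for \<open>q < K\<close> and
  \<open>j < N\<close>. In general a label \<open>m\<close> has colour \<open>m mod N\<close> and lies in block
  \<open>m div L\<close>.
\<close>

definition slot :: "nat \<Rightarrow> nat \<Rightarrow> nat \<Rightarrow> nat" where
  "slot p q j = p * L + q * N + j"

text \<open>
  The label \<open>0\<close> is the identity. The standard labels, which code the atoms of the relation
  algebra, are \<open>0\<close> and all numbers in blocks other than block \<open>0\<close>.
\<close>

definition std :: "nat set" where "std = {m. m = 0 \<or> L \<le> m}"

text \<open>
  Besides the standard labels, labels include the ideal label \<open>N + j\<close> of every colour
  \<open>j < N\<close>. Ideal labels lie in block \<open>0\<close>; the other positive numbers of that block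
  are not used.
\<close>

definition lab :: "nat set" where "lab = {m. m = 0 \<or> N \<le> m \<and> m < 2 * N \<or> L \<le> m}"

text \<open>
  The disjunct \<open>a < L\<close> makes each ideal label adjacent to itself.
\<close>

definition adj :: "nat \<Rightarrow> nat \<Rightarrow> bool" where
  "adj a b \<longleftrightarrow> a div L = b div L \<and> (a \<noteq> b \<or> a < L)"

text \<open>
  Consistency of a triangle with sides \<open>a\<close>, \<open>b\<close>, \<open>c\<close>. All labels are self-converse,
  so the order of the sides does not matter.
\<close>

definition tri :: "nat \<Rightarrow> nat \<Rightarrow> nat \<Rightarrow> bool" where
  "tri a b c \<longleftrightarrow> a = 0 \<and> b = c \<or> b = 0 \<and> a = c \<or> c = 0 \<and> a = b
    \<or> a \<noteq> 0 \<and> b \<noteq> 0 \<and> c \<noteq> 0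
      \<and> (a mod N = b mod N \<and> b mod N = c mod N \<longrightarrow> adj a b \<or> adj b c \<or> adj a c)"

lemma N_pos: "0 < N" and K_ge: "n * n + n \<le> K" "2 < K" and L_ge: "2 * N \<le> L" and L_pos: "0 < L"
proof -
  show "0 < N" using n_gt_2 by (simp add: N_def)
  show "n * n + n \<le> K" "2 < K" using n_gt_2 by (simp_all add: K_def)
  then have "N * 2 \<le> N * K" by (intro mult_left_mono) auto
  then show "2 * N \<le> L" by (simp add: L_def)
  with \<open>0 < N\<close> show "0 < L" by simp
qed

lemma mod_L_mod_N: "m mod L mod N = m mod N"
  by (simp add: L_def mod_mod_cancel)

lemma slot_less: "q < K \<Longrightarrow> j < N \<Longrightarrow> q * N + j < L"
proof -
  assume "q < K" "j < N"
  then have "q * N + j < (q + 1) * N" by simp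
  also have "\<dots> \<le> K * N" using \<open>q < K\<close> by (intro mult_right_mono) auto
  finally show ?thesis by (simp add: L_def mult.commute)
qed

lemma slot_div: "q < K \<Longrightarrow> j < N \<Longrightarrow> slot p q j div L = p"
  using slot_less[of q j] L_pos by (simp add: slot_def add.assoc div_mult_self3)

lemma slot_mod: "j < N \<Longrightarrow> slot p q j mod N = j"
proof -
  assume "j < N"
  have "slot p q j = j + (p * K + q) * N" by (simp add: slot_def L_def algebra_simps)
  then show ?thesis using \<open>j < N\<close> by (simp only: mod_mult_self1) simp
qed

lemma slot_div_N: "q < K \<Longrightarrow> j < N \<Longrightarrow> slot p q j div N mod K = q"
proof -
  assume "q < K" "j < N"
  have "slot p q j = j + (p * K + q) * N" by (simp add: slot_def L_def algebra_simps)
  then have "slot p q j div N = p * K + q" using \<open>j < N\<close> by (simp only: div_mult_self1) simp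
  then show ?thesis using \<open>q < K\<close> by simp
qed

lemma slot_ge: "k \<le> p \<Longrightarrow> k * L \<le> slot p q j"
  using mult_right_mono[of k p L] by (simp add: slot_def trans_le_add1)

lemma slot_std: "0 < p \<Longrightarrow> slot p q j \<in> std"
  using slot_ge[of 1 p] by (simp add: std_def)

lemma slot_neq_0: "0 < p \<Longrightarrow> slot p q j \<noteq> 0"
  using slot_ge[of 1 p q j] L_pos by auto

lemma div_L_ge: "k \<le> m div L \<longleftrightarrow> k * L \<le> m"
  using L_pos by (simp add: less_eq_div_iff_mult_less_eq)

lemma div_L_less: "m div L < k \<longleftrightarrow> m < k * L"
  using div_L_ge[of k m] by linarith

lemma std_lab: "m \<in> std \<Longrightarrow> m \<in> lab"
  by (auto simp: std_def lab_def)

lemma zero_std [simp]: "0 \<in> std" and zero_lab [simp]: "0 \<in> lab"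
  by (auto simp: std_def lab_def)

lemma adj_sym: "adj a b \<longleftrightarrow> adj b a"
  by (auto simp: adj_def)

lemma tri_swapI: "tri a b c \<Longrightarrow> tri b a c"
  unfolding tri_def by (auto simp: adj_sym)

lemma tri_rotI: "tri a b c \<Longrightarrow> tri b c a"
  unfolding tri_def by (auto simp: adj_sym)

lemma tri_flipI: "tri a b c \<Longrightarrow> tri a c b"
  by (rule tri_rotI[OF tri_rotI[OF tri_swapI[OF tri_rotI]]])

lemma tri_0 [simp]: "tri 0 b c \<longleftrightarrow> b = c" "tri a 0 c \<longleftrightarrow> a = c" "tri a b 0 \<longleftrightarrow> a = b"
  by (auto simp: tri_def)

lemma tri_colour:
  assumes "a \<noteq> 0" "b \<noteq> 0" "c \<noteq> 0" "\<not> (a mod N = b mod N \<and> b mod N = c mod N)"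
  shows "tri a b c"
  using assms by (auto simp: tri_def)

lemma tri_adj:
  assumes "a \<noteq> 0" "b \<noteq> 0" "c \<noteq> 0" "adj a b"
  shows "tri a b c"
  using assms by (simp add: tri_def)

lemma tri_cases:
  assumes "tri a b c"
  obtains "a = 0" "b = c" | "b = 0" "a = c" | "c = 0" "a = b"
    | "a \<noteq> 0" "b \<noteq> 0" "c \<noteq> 0" "\<not> (a mod N = b mod N \<and> b mod N = c mod N)"
    | "a \<noteq> 0" "b \<noteq> 0" "c \<noteq> 0" "a mod N = b mod N" "b mod N = c mod N" "adj a b \<or> adj b c \<or> adj a c"
  using assms unfolding tri_def by blast

lemma adj_slot: "q < K \<Longrightarrow> q' < K \<Longrightarrow> q \<noteq> q' \<Longrightarrow> j < N \<Longrightarrow> j' < N \<Longrightarrow> adj (slot p q j) (slot p q' j')"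
  unfolding adj_def by (metis slot_div slot_div_N)

text \<open>
  Labels in one of these finitely many classes agree in colour and in their place in the block, so
  that distinct ones lie in distinct blocks and none are adjacent.
\<close>

definition colour_class :: "nat \<Rightarrow> nat set" where
  "colour_class c = {m. L \<le> m \<and> m mod L = c}"

lemma no_triangle:
  assumes "a \<in> colour_class r" "b \<in> colour_class r" "c \<in> colour_class r"
  shows "\<not> tri a b c"
proof -
  have assms: "L \<le> a" "L \<le> b" "L \<le> c" "a mod L = b mod L" "b mod L = c mod L"
    using assms by (auto simp: colour_class_def)
  have *: "\<not> adj x y" if "L \<le> x" "x mod L = y mod L" for x y
    using that div_mult_mod_eq[of x L] div_mult_mod_eq[of y L] unfolding adj_def by auto
  have "a mod N = b mod N \<and> b mod N = c mod N"
    using assms mod_L_mod_N by metis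
  moreover have "\<not> adj a b" "\<not> adj b c" "\<not> adj a c" using * assms by auto
  ultimately show ?thesis using assms L_pos by (auto simp: tri_def)
qed

text \<open>
  An additive map \<open>h\<close> whose value at \<open>P\<close> contains \<open>x\<close> sends some colour class to
  a set containing \<open>x\<close>, unless \<open>x\<close> already lies in the image of the identity.
\<close>

lemma colour_class_cover:
  assumes P: "\<And>s. s \<in> P \<Longrightarrow> c s \<in> std"
    and h: "h {} = {}" "\<And>X Y. X \<subseteq> P \<Longrightarrow> Y \<subseteq> P \<Longrightarrow> h (X \<union> Y) = h X \<union> h Y"
    and x: "x \<in> h P" "x \<notin> h {s \<in> P. c s \<in> {0}}"
  shows "\<exists>r<L. x \<in> h {s \<in> P. c s \<in> colour_class r}"
proof -
  have UN: "h (\<Union>r<m. {s \<in> P. c s \<in> colour_class r}) = (\<Union>r<m. h {s \<in> P. c s \<in> colour_class r})" for m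
  proof (induction m)
    case (Suc m)
    have "(\<Union>r<m. {s \<in> P. c s \<in> colour_class r}) \<subseteq> P" by blast
    with Suc h(2)[of "{s \<in> P. c s \<in> colour_class m}" "\<Union>r<m. {s \<in> P. c s \<in> colour_class r}"] show ?case
      by (simp add: lessThan_Suc)
  qed (simp add: h(1))
  have "P = {s \<in> P. c s \<in> {0}} \<union> (\<Union>r<L. {s \<in> P. c s \<in> colour_class r})"
    using P L_pos by (fastforce simp: std_def colour_class_def)
  moreover have "h ({s \<in> P. c s \<in> {0}} \<union> (\<Union>r<L. {s \<in> P. c s \<in> colour_class r}))
      = h {s \<in> P. c s \<in> {0}} \<union> (\<Union>r<L. h {s \<in> P. c s \<in> colour_class r})"
    unfolding UN[symmetric] by (rule h(2)) blast+
  ultimately have "x \<in> h {s \<in> P. c s \<in> {0}} \<union> (\<Union>r<L. h {s \<in> P. c s \<in> colour_class r})"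
    using x(1) by metis
  then show ?thesis using x(2) by blast
qed

lemma ex_colour:
  assumes "finite C" "card C < N"
  obtains c where "c < N" "c \<notin> C"
proof -
  have "\<not> {..<N} \<subseteq> C" using assms card_mono[of C "{..<N}"] by auto
  then show ?thesis using that by auto
qed

text \<open>
  Amalgamation of two triangles along a side, which is associativity of composition. Unless one of
  the outer sides is the identity, any label of a colour different from those of \<open>a\<close> and
  \<open>b\<close> will do for the other diagonal.
\<close>

lemma tri_assoc:
  assumes "tri a b e" "tri e c d" and d: "a \<in> std" "b \<in> std" "c \<in> std" "d \<in> std"
  shows "\<exists>e'\<in>std. tri b c e' \<and> tri a e' d"
proof (cases "a = 0 \<or> b = 0 \<or> c = 0 \<or> d = 0")
  case True
  then show ?thesis
  proof (elim disjE)
    assume "a = 0" then show ?thesis using assms by (intro bexI[of _ d]) auto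
  next
    assume "b = 0" then show ?thesis using assms by (intro bexI[of _ c]) auto
  next
    assume "c = 0" then show ?thesis using assms by (intro bexI[of _ b]) auto
  next
    assume "d = 0" then show ?thesis using assms tri_rotI[of a b c] by (intro bexI[of _ a]) auto
  qed
next
  case False
  have "card {a mod N, b mod N} < N" using n_gt_2 card_insert_le_m1[of 2 "{b mod N}" "a mod N"]
    by (simp add: N_def card_insert_if)
  then obtain j where "j < N" "j \<notin> {a mod N, b mod N}" using ex_colour[of "{a mod N, b mod N}"] by blast
  then show ?thesis using False slot_mod[of j 1 0] slot_std[of 1 0 j] slot_neq_0[of 1 0 j]
    by (intro bexI[of _ "slot 1 0 j"] conjI tri_colour) auto
qed


section \<open>Consistent matrices\<close>

text \<open>
  A matrix of labels is a function that vanishes outside \<open>n \<times> n\<close>. The condition \<open>net\<close>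
  is consistency; symmetry follows from the triangle condition. The set \<open>mats\<close> contains the
  consistent matrices of standard labels, which are the basic matrices of the relation algebra.
\<close>

definition net :: "(nat \<Rightarrow> nat \<Rightarrow> nat) \<Rightarrow> bool" where
  "net f \<longleftrightarrow> (\<forall>x y. f x y \<in> lab) \<and> (\<forall>x y. \<not> (x < n \<and> y < n) \<longrightarrow> f x y = 0) \<and> (\<forall>x<n. f x x = 0)
    \<and> (\<forall>x<n. \<forall>y<n. \<forall>z<n. tri (f x y) (f y z) (f x z))"

definition mats :: "(nat \<Rightarrow> nat \<Rightarrow> nat) set" where
  "mats = {f. net f \<and> (\<forall>x y. f x y \<in> std)}"

text \<open>
  Agreement outside the indices in \<open>D\<close>.
\<close>

definition agree :: "nat set \<Rightarrow> (nat \<Rightarrow> nat \<Rightarrow> nat) \<Rightarrow> (nat \<Rightarrow> nat \<Rightarrow> nat) \<Rightarrow> bool" where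
  "agree D f g \<longleftrightarrow> (\<forall>x<n. \<forall>y<n. x \<notin> D \<and> y \<notin> D \<longrightarrow> f x y = g x y)"

text \<open>
  The matrix \<open>f \<circ> \<tau>\<close>.
\<close>

definition reind :: "(nat \<Rightarrow> nat \<Rightarrow> nat) \<Rightarrow> (nat \<Rightarrow> nat) \<Rightarrow> nat \<Rightarrow> nat \<Rightarrow> nat" where
  "reind f \<tau> = (\<lambda>x y. if x < n \<and> y < n then f (\<tau> x) (\<tau> y) else 0)"

text \<open>
  The matrix \<open>f\<close> with row and column \<open>z\<close> replaced by \<open>r\<close>.
\<close>

definition with_row :: "nat \<Rightarrow> (nat \<Rightarrow> nat) \<Rightarrow> (nat \<Rightarrow> nat \<Rightarrow> nat) \<Rightarrow> nat \<Rightarrow> nat \<Rightarrow> nat" where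
  "with_row z r f = (\<lambda>x y. if x < n \<and> y < n then
     if x = z then (if y = z then 0 else r y) else if y = z then r x else f x y else 0)"

lemma netD:
  assumes "net f"
  shows "f x y \<in> lab" "\<not> (x < n \<and> y < n) \<Longrightarrow> f x y = 0" "x < n \<Longrightarrow> f x x = 0"
    "x < n \<Longrightarrow> y < n \<Longrightarrow> z < n \<Longrightarrow> tri (f x y) (f y z) (f x z)"
    "f x y = f y x"
proof -
  show "f x y = f y x"
  proof (cases "x < n \<and> y < n")
    case True
    then have "tri (f x y) (f y x) (f x x)" "f x x = 0" using assms unfolding net_def by blast+
    then show ?thesis by simp
  next
    case False
    then have "f x y = 0" "f y x = 0" using assms unfolding net_def by blast+
    then show ?thesis by simp
  qed
qed (use assms in \<open>auto simp: net_def\<close>)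

lemma mats_net: "f \<in> mats \<Longrightarrow> net f" and mats_std: "f \<in> mats \<Longrightarrow> f x y \<in> std"
  by (auto simp: mats_def)

lemma net_zero:
  assumes "net f" "x < n" "y < n" "z < n" "f x y = 0"
  shows "f x z = f y z"
  using netD(4)[OF assms(1), of x y z] assms by simp

lemma net_eqI:
  assumes "net f" "net g" "\<And>x y. x < n \<Longrightarrow> y < n \<Longrightarrow> f x y = g x y"
  shows "f = g"
  using assms netD(2) by (intro ext) metis

lemma net_reind:
  assumes "net f" "\<tau> ` {..<n} \<subseteq> {..<n}"
  shows "net (reind f \<tau>)"
proof -
  have "\<tau> x < n" if "x < n" for x using assms(2) that by auto
  then show ?thesis using assms(1) unfolding net_def reind_def by auto
qed

lemma mats_reind: "f \<in> mats \<Longrightarrow> \<tau> ` {..<n} \<subseteq> {..<n} \<Longrightarrow> reind f \<tau> \<in> mats"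
  using net_reind by (auto simp: mats_def reind_def)

lemma net_with_row:
  assumes f: "net f" and z: "z < n"
    and r: "\<And>x. x < n \<Longrightarrow> x \<noteq> z \<Longrightarrow> r x \<in> lab"
      "\<And>x y. x < n \<Longrightarrow> y < n \<Longrightarrow> x \<noteq> z \<Longrightarrow> y \<noteq> z \<Longrightarrow> tri (r x) (r y) (f x y)"
  shows "net (with_row z r f)"
proof -
  have "tri (with_row z r f x y) (with_row z r f y w) (with_row z r f x w)"
    if xyw: "x < n" "y < n" "w < n" for x y w
  proof -
    have s: "f u v = f v u" for u v by (rule netD(5)[OF f])
    have R: "tri (r u) (r v) (f u v)" "tri (r u) (f u v) (r v)" "tri (f u v) (r v) (r u)"
      if "u < n" "v < n" "u \<noteq> z" "v \<noteq> z" for u v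
    proof -
      show *: "tri (r u) (r v) (f u v)" by (rule r(2)[OF that])
      show "tri (r u) (f u v) (r v)" by (rule tri_swapI[OF tri_rotI[OF tri_rotI[OF *]]])
      show "tri (f u v) (r v) (r u)" by (rule tri_swapI[OF tri_rotI[OF *]])
    qed
    show ?thesis using xyw
      by (cases "x = z"; cases "y = z"; cases "w = z")
        (simp_all add: with_row_def R netD(3,4)[OF f] s[of w])
  qed
  then show ?thesis unfolding net_def using netD(1-3)[OF f] r(1) by (auto simp: with_row_def)
qed

lemma mats_with_row:
  assumes f: "f \<in> mats" and z: "z < n"
    and r: "\<And>x. x < n \<Longrightarrow> x \<noteq> z \<Longrightarrow> r x \<in> std"
      "\<And>x y. x < n \<Longrightarrow> y < n \<Longrightarrow> x \<noteq> z \<Longrightarrow> y \<noteq> z \<Longrightarrow> tri (r x) (r y) (f x y)"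
  shows "with_row z r f \<in> mats"
proof -
  have "net (with_row z r f)" using assms std_lab by (intro net_with_row mats_net) auto
  then show ?thesis using f r(1) by (auto simp: mats_def with_row_def)
qed

lemma agree_with_row: "agree {z} f (with_row z r f)"
  by (simp add: agree_def with_row_def)

text \<open>
  The least index identified with \<open>x\<close> by \<open>f\<close>. Choosing new labels by representatives
  makes identified indices get equal rows.
\<close>

definition rep :: "(nat \<Rightarrow> nat \<Rightarrow> nat) \<Rightarrow> nat \<Rightarrow> nat" where
  "rep f x = (LEAST v. f x v = 0)"

lemma rep:
  assumes "net f" "x < n"
  shows "f x (rep f x) = 0" "rep f x < n"
proof -
  have "f x x = 0" using assms netD(3) by blast
  then show "f x (rep f x) = 0" "rep f x < n"
    using LeastI[of "\<lambda>v. f x v = 0" x] Least_le[of "\<lambda>v. f x v = 0" x] assms(2)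
    unfolding rep_def by auto
qed

lemma rep_eq_iff:
  assumes "net f" "x < n" "y < n"
  shows "rep f x = rep f y \<longleftrightarrow> f x y = 0"
proof
  assume e: "rep f x = rep f y"
  have "f x y = f (rep f x) y"
    by (rule net_zero[OF assms(1,2) rep(2)[OF assms(1,2)] assms(3) rep(1)[OF assms(1,2)]])
  also have "\<dots> = f y (rep f y)" unfolding e by (rule netD(5)[OF assms(1)])
  also have "\<dots> = 0" by (rule rep(1)[OF assms(1,3)])
  finally show "f x y = 0" .
next
  assume "f x y = 0"
  then have "f x v = f y v" for v
    using net_zero[OF assms, of v] netD(2)[OF assms(1), of x v] netD(2)[OF assms(1), of y v]
    by (cases "v < n") auto
  then show "rep f x = rep f y" by (simp add: rep_def)
qed

text \<open>
  The one-point extension property: a consistent choice \<open>e\<close> of the labels between \<open>z\<close>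
  and the indices in \<open>D\<close> can be completed to a matrix that agrees with \<open>f\<close> off \<open>z\<close>.
\<close>

lemma mats_extend:
  assumes f: "f \<in> mats" and z: "z < n" and D: "D \<subseteq> {..<n} - {z}"
    and e: "\<And>d. d \<in> D \<Longrightarrow> e d \<in> std" "\<And>d d'. d \<in> D \<Longrightarrow> d' \<in> D \<Longrightarrow> tri (e d) (e d') (f d d')"
  obtains g where "g \<in> mats" "agree {z} f g" "\<And>d. d \<in> D \<Longrightarrow> g z d = e d" "\<And>d. d \<in> D \<Longrightarrow> g d z = e d"
proof -
  have nf: "net f" using f by (rule mats_net)
  have "\<exists>g\<in>mats. agree {z} f g \<and> (\<forall>d\<in>D. g z d = e d)"
  proof (cases "\<exists>d\<in>D. e d = 0")
    case True
    then obtain d where d: "d \<in> D" "e d = 0" by blast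
    have "reind f (id(z := d)) \<in> mats" using d D z by (intro mats_reind[OF f]) auto
    moreover have "agree {z} f (reind f (id(z := d)))" by (simp add: agree_def reind_def)
    moreover have "reind f (id(z := d)) z y = e y" if "y \<in> D" for y
      using e(2)[OF d(1) that] d that D z by (auto simp: reind_def)
    ultimately show ?thesis by blast
  next
    case False
    have fD: "finite D" using D finite_subset by blast
    have "card ((\<lambda>d. e d mod N) ` D) \<le> card {..<n}"
      using card_image_le[OF fD] card_mono[of "{..<n}" D] D by (meson Diff_subset finite_lessThan le_trans subset_trans)
    also have "\<dots> < N" using n_gt_2 by (simp add: N_def)
    finally obtain c where c: "c < N" "c \<notin> (\<lambda>d. e d mod N) ` D"
      using ex_colour[of "(\<lambda>d. e d mod N) ` D"] fD by blast
    \<comment> \<open>The remaining labels get a colour not used by \<open>e\<close>. They lie in one block,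
      so that two of them that are distinct are adjacent.\<close>
    define r where "r w = (if \<exists>d\<in>D. f w d = 0 then e (SOME d. d \<in> D \<and> f w d = 0) else slot 1 (rep f w) c)" for w
    have r1: "r w = e d" if "d \<in> D" "f w d = 0" "w < n" for w d
    proof -
      define d' where "d' = (SOME d. d \<in> D \<and> f w d = 0)"
      have d': "d' \<in> D" "f w d' = 0" using someI[of "\<lambda>d. d \<in> D \<and> f w d = 0" d] that by (auto simp: d'_def)
      then have "f d d' = 0" using net_zero[OF nf, of w d d'] that D by auto
      then have "e d = e d'" using e(2)[OF that(1) d'(1)] by simp
      then show ?thesis using that by (auto simp: r_def d'_def)
    qed
    have r0: "r d = e d" if "d \<in> D" for d
      using r1[OF that, of d] netD(3)[OF nf] that D by auto
    have cases: "(\<exists>d\<in>D. f w d = 0 \<and> r w = e d) \<or> (\<forall>d\<in>D. f w d \<noteq> 0) \<and> r w = slot 1 (rep f w) c" if "w < n" for w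
    proof (cases "\<exists>d\<in>D. f w d = 0")
      case True
      then show ?thesis using r1[OF _ _ that] by blast
    next
      case False
      then have "r w = slot 1 (rep f w) c" by (auto simp: r_def)
      moreover have "\<forall>d\<in>D. f w d \<noteq> 0" using False by metis
      ultimately show ?thesis by simp
    qed
    have repK: "rep f w < K" if "w < n" for w using rep(2)[OF nf that] K_ge by linarith
    have T1: "tri (r x) (r y) (f x y)"
      if xy: "x < n" "y < n" and d: "d \<in> D" "f x d = 0" "r x = e d" for x y d
      using cases[OF xy(2)]
    proof (elim disjE conjE bexE)
      fix d' assume d': "d' \<in> D" "f y d' = 0" "r y = e d'"
      have "d < n" "d' < n" using d d' D by auto
      then have "f x y = f d d'"
        using net_zero[OF nf, of x d y] net_zero[OF nf, of y d' d] d d' xy netD(5)[OF nf] by metis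
      then show ?thesis using e(2)[OF d(1) d'(1)] d d' by simp
    next
      assume y: "\<forall>d\<in>D. f y d \<noteq> 0" "r y = slot 1 (rep f y) c"
      have "d < n" using d D by auto
      have "f x y = 0 \<Longrightarrow> f y d = 0"
        using net_zero[OF nf xy, of d] \<open>d < n\<close> d by simp
      then have "f x y \<noteq> 0" using y d by blast
      moreover have "e d \<noteq> 0" "e d mod N \<noteq> c" using False d c by auto
      ultimately show ?thesis using d y slot_neq_0[of 1 "rep f y" c] slot_mod[OF c(1), of 1 "rep f y"]
        by (intro tri_colour) auto
    qed
    have "tri (r x) (r y) (f x y)" if xy: "x < n" "y < n" for x y
    proof -
      consider d where "d \<in> D" "f x d = 0" "r x = e d" | d where "d \<in> D" "f y d = 0" "r y = e d"
        | "r x = slot 1 (rep f x) c" "r y = slot 1 (rep f y) c"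
        using cases[OF xy(1)] cases[OF xy(2)] by blast
      then show ?thesis
      proof cases
        case 1
        then show ?thesis by (rule T1[OF xy])
      next
        case 2
        then have "tri (r y) (r x) (f y x)" by (rule T1[OF xy(2,1)])
        then show ?thesis unfolding netD(5)[OF nf, of y x] by (rule tri_swapI)
      next
        case r: 3
        show ?thesis
      proof (cases "f x y = 0")
        case True
        then show ?thesis using rep_eq_iff[OF nf xy] r by simp
      next
        case False
        then have "rep f x \<noteq> rep f y" using rep_eq_iff[OF nf xy] by simp
        then show ?thesis unfolding r using False repK xy c slot_neq_0
          by (intro tri_adj adj_slot) auto
      qed
      qed
    qed
    moreover have "r x \<in> std" if "x < n" for x
      using cases[OF that] e(1) slot_std[of 1] by auto
    ultimately have "with_row z r f \<in> mats" using f z by (intro mats_with_row) auto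
    moreover have "with_row z r f z d = e d" if "d \<in> D" for d
      using that D z r0 by (auto simp: with_row_def)
    ultimately show ?thesis using agree_with_row by blast
  qed
  then obtain g where "g \<in> mats" "agree {z} f g" "\<forall>d\<in>D. g z d = e d" by blast
  then show ?thesis using that netD(5)[OF mats_net] by metis
qed

text \<open>
  Only the label between \<open>x\<close> and \<open>y\<close> is missing in the union of \<open>f\<close> off \<open>x\<close>
  and \<open>g\<close> off \<open>y\<close>.
\<close>

lemma mats_amalgamate:
  assumes f: "f \<in> mats" and g: "g \<in> mats" and xy: "x < n" "y < n" "agree {x, y} f g"
  obtains h where "h \<in> mats" "agree {x} f h" "agree {y} g h"
proof (cases "x = y")
  case True
  then show ?thesis using that[of f] f xy(3) by (auto simp: agree_def)
next
  case False
  have "tri (g x d) (g x d') (f d d')" if "d \<in> {..<n} - {x, y}" "d' \<in> {..<n} - {x, y}" for d d'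
  proof -
    have "f d d' = g d d'" using that xy by (auto simp: agree_def)
    moreover have "tri (g d x) (g x d') (g d d')" using that xy netD(4)[OF mats_net[OF g]] by simp
    ultimately show ?thesis using netD(5)[OF mats_net[OF g], of d x] by simp
  qed
  then obtain h where h: "h \<in> mats" "agree {x} f h" "\<And>d. d \<in> {..<n} - {x, y} \<Longrightarrow> h x d = g x d"
      "\<And>d. d \<in> {..<n} - {x, y} \<Longrightarrow> h d x = g x d"
    using mats_extend[OF f xy(1), of "{..<n} - {x, y}" "g x"] mats_std[OF g] by blast
  have "g u v = h u v" if "u < n" "v < n" "u \<noteq> y" "v \<noteq> y" for u v
  proof -
    consider "u = x" "v = x" | "u = x" "v \<noteq> x" | "u \<noteq> x" "v = x" | "u \<noteq> x" "v \<noteq> x" by blast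
    then show ?thesis
    proof cases
      case 1 then show ?thesis using netD(3)[OF mats_net[OF g] xy(1)] netD(3)[OF mats_net[OF h(1)] xy(1)] by simp
    next
      case 2 then show ?thesis using h(3) that by simp
    next
      case 3 then show ?thesis using h(4) that netD(5)[OF mats_net[OF g]] by simp
    next
      case 4 then show ?thesis using h(2) xy(3) that by (auto simp: agree_def)
    qed
  qed
  then have "agree {y} g h" by (auto simp: agree_def)
  then show ?thesis using that h by blast
qed

section \<open>Similarity of matrices\<close>

text \<open>
  Similarity at level \<open>k\<close>: the labels below block \<open>k\<close> are the same, all colours are the
  same, and the same pairs of entries lie in a common block.
\<close>

definition sim :: "nat \<Rightarrow> (nat \<Rightarrow> nat \<Rightarrow> nat) \<Rightarrow> (nat \<Rightarrow> nat \<Rightarrow> nat) \<Rightarrow> bool" where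
  "sim k f g \<longleftrightarrow> (\<forall>x<n. \<forall>y<n. (f x y < k * L \<or> g x y < k * L \<longrightarrow> f x y = g x y)
     \<and> f x y mod N = g x y mod N
     \<and> (\<forall>u<n. \<forall>v<n. f x y div L = f u v div L \<longleftrightarrow> g x y div L = g u v div L))"

lemma simD:
  assumes "sim k f g" "x < n" "y < n"
  shows "f x y < k * L \<Longrightarrow> f x y = g x y" "g x y < k * L \<Longrightarrow> f x y = g x y"
    "f x y mod N = g x y mod N"
    "u < n \<Longrightarrow> v < n \<Longrightarrow> f x y div L = f u v div L \<longleftrightarrow> g x y div L = g u v div L"
  using assms unfolding sim_def by blast+

lemma simI:
  assumes "inj_on \<sigma> {f x y div L | x y. x < n \<and> y < n}"
    and "\<And>x y. x < n \<Longrightarrow> y < n \<Longrightarrow> g x y div L = \<sigma> (f x y div L)"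
    and "\<And>x y. x < n \<Longrightarrow> y < n \<Longrightarrow> f x y mod N = g x y mod N"
    and "\<And>x y. x < n \<Longrightarrow> y < n \<Longrightarrow> f x y < k * L \<or> g x y < k * L \<Longrightarrow> f x y = g x y"
  shows "sim k f g"
proof -
  have "f x y div L = f u v div L \<longleftrightarrow> g x y div L = g u v div L"
    if "x < n" "y < n" "u < n" "v < n" for x y u v
    unfolding assms(2)[OF that(1,2)] assms(2)[OF that(3,4)]
    using that by (intro inj_on_eq_iff[OF assms(1), symmetric]) auto
  then show ?thesis unfolding sim_def using assms(3,4) by simp
qed

lemma sim_refl: "sim k f f"
  by (simp add: sim_def)

lemma sim_sym: "sim k f g \<Longrightarrow> sim k g f"
  unfolding sim_def by metis

lemma sim_trans: "sim k f g \<Longrightarrow> sim k g h \<Longrightarrow> sim k f h"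
  unfolding sim_def by metis

lemma sim_mono: "sim k f g \<Longrightarrow> k' \<le> k \<Longrightarrow> sim k' f g"
proof -
  assume "sim k f g" "k' \<le> k"
  moreover then have "m < k * L" if "m < k' * L" for m
    using that mult_right_mono[of k' k L] by linarith
  ultimately show ?thesis unfolding sim_def by blast
qed

lemma sim_zero:
  assumes "sim k f g" "0 < k" "x < n" "y < n"
  shows "f x y = 0 \<longleftrightarrow> g x y = 0"
proof -
  have "0 < k * L" using assms(2) L_pos by simp
  then show ?thesis using simD(1,2)[OF assms(1,3,4)] by auto
qed

lemma sim_reind:
  assumes "sim k f g" "\<tau> ` {..<n} \<subseteq> {..<n}"
  shows "sim k (reind f \<tau>) (reind g \<tau>)"
proof -
  have "\<tau> x < n" if "x < n" for x using assms(2) that by auto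
  note D = simD[OF assms(1) this this]
  show ?thesis unfolding sim_def
  proof (intro allI impI)
    fix x y assume "x < n" "y < n"
    then have e: "reind f \<tau> x y = f (\<tau> x) (\<tau> y)" "reind g \<tau> x y = g (\<tau> x) (\<tau> y)"
      by (simp_all add: reind_def)
    have "reind f \<tau> x y div L = reind f \<tau> u v div L \<longleftrightarrow> reind g \<tau> x y div L = reind g \<tau> u v div L"
      if "u < n" "v < n" for u v
      using D(4)[of x y "\<tau> u" "\<tau> v"] \<open>x < n\<close> \<open>y < n\<close> that assms(2) unfolding e by (auto simp: reind_def)
    then show "(reind f \<tau> x y < k * L \<or> reind g \<tau> x y < k * L \<longrightarrow> reind f \<tau> x y = reind g \<tau> x y)
      \<and> reind f \<tau> x y mod N = reind g \<tau> x y mod N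
      \<and> (\<forall>u<n. \<forall>v<n. reind f \<tau> x y div L = reind f \<tau> u v div L
        \<longleftrightarrow> reind g \<tau> x y div L = reind g \<tau> u v div L)"
      using D(1-3)[of x y] \<open>x < n\<close> \<open>y < n\<close> unfolding e by blast
  qed
qed

lemma net_bounded:
  assumes "net f"
  obtains B where "\<And>x y. f x y < B * L" "0 < B"
proof -
  have "finite ((\<lambda>(x, y). f x y) ` ({..<n} \<times> {..<n}))" by simp
  then obtain b where b: "\<forall>m\<in>(\<lambda>(x, y). f x y) ` ({..<n} \<times> {..<n}). m \<le> b"
    using finite_nat_set_iff_bounded_le by blast
  have le: "f x y \<le> b" for x y
  proof (cases "x < n \<and> y < n")
    case True then show ?thesis using b by auto
  next
    case False then show ?thesis using netD(2)[OF assms] by simp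
  qed
  have "b * 1 \<le> b * L" using L_pos by (intro mult_le_mono2) simp
  then have "b < Suc b * L" using L_pos unfolding mult_Suc by linarith
  then have "f x y < Suc b * L" for x y using le[of x y] by linarith
  then show ?thesis by (intro that[of "Suc b"]) auto
qed

text \<open>
  The blocks of similar matrices correspond to each other under an injection of all blocks.
\<close>

lemma sim_block_map:
  assumes "sim k f f'" "net f'"
  obtains \<sigma> :: "nat \<Rightarrow> nat" where "inj \<sigma>" "\<And>b. b < k \<Longrightarrow> \<sigma> b = b"
    "\<And>y z. y < n \<Longrightarrow> z < n \<Longrightarrow> \<sigma> (f y z div L) = f' y z div L"
proof -
  obtain M where M: "\<And>y z. f' y z < M * L" using net_bounded[OF assms(2)] by metis
  define B where "B = {f y z div L | y z. y < n \<and> z < n}"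
  have "\<forall>b\<in>B. \<exists>y z. y < n \<and> z < n \<and> f y z div L = b" by (auto simp: B_def)
  then obtain Y Z where YZ: "\<And>b. b \<in> B \<Longrightarrow> Y b < n \<and> Z b < n \<and> f (Y b) (Z b) div L = b" by metis
  \<comment> \<open>Blocks that occur neither in \<open>f\<close> nor below \<open>k\<close> are moved beyond
    \<open>k\<close> and beyond all blocks of \<open>f'\<close>.\<close>
  define \<sigma> where "\<sigma> b = (if b \<in> B then f' (Y b) (Z b) div L else if b < k then b else b + (k + M))" for b
  have s1: "\<sigma> (f y z div L) = f' y z div L" if "y < n" "z < n" for y z
  proof -
    have b: "f y z div L \<in> B" using that by (auto simp: B_def)
    from YZ[OF b] simD(4)[OF assms(1) that] b show ?thesis by (simp add: \<sigma>_def) metis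
  qed
  have s2: "\<sigma> b = b" if "b < k" for b
  proof (cases "b \<in> B")
    case True
    then have y: "Y b < n" "Z b < n" "f (Y b) (Z b) div L = b" using YZ by auto
    then have "f (Y b) (Z b) < k * L" using that by (simp add: div_L_less flip: div_L_less)
    then show ?thesis using simD(1)[OF assms(1) y(1,2)] s1[OF y(1,2)] y(3) by simp
  qed (use that in \<open>simp add: \<sigma>_def\<close>)
  have s3: "\<sigma> b < k \<Longrightarrow> b < k" "\<sigma> b < M" if "b \<in> B" for b
  proof -
    have y: "Y b < n" "Z b < n" "f (Y b) (Z b) div L = b" using YZ that by auto
    have s: "\<sigma> b = f' (Y b) (Z b) div L" using that by (simp add: \<sigma>_def)
    then show "\<sigma> b < M" using M by (simp add: div_L_less)
    assume "\<sigma> b < k"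
    then have "f' (Y b) (Z b) < k * L" using s by (simp add: div_L_less)
    then show "b < k" using simD(2)[OF assms(1) y(1,2)] y(3) s \<open>\<sigma> b < k\<close> by simp
  qed
  have s4: "b = b'" if "b \<in> B" "b' \<in> B" "\<sigma> b = \<sigma> b'" for b b'
    using YZ[OF that(1)] YZ[OF that(2)] that simD(4)[OF assms(1), of "Y b" "Z b" "Y b'" "Z b'"]
    by (simp add: \<sigma>_def)
  have s5: "b = b'" if "b \<in> B" "b' \<notin> B" "\<sigma> b = \<sigma> b'" for b b'
    using s3[OF that(1)] s2[of b] s2[of b'] that(2,3) by (auto simp: \<sigma>_def split: if_splits)
  have "inj \<sigma>"
  proof (rule injI)
    fix b b' assume e: "\<sigma> b = \<sigma> b'"
    show "b = b'"
    proof (cases "b \<in> B"; cases "b' \<in> B")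
      assume "b \<notin> B" "b' \<notin> B"
      then show ?thesis using e by (auto simp: \<sigma>_def split: if_splits)
    qed (use s4 s5 e in \<open>metis+\<close>)
  qed
  with s1 s2 that show ?thesis by blast
qed

text \<open>
  Each of \<open>n\<close> indices gets its own place in the blocks, and none of these places is used by an
  entry of \<open>f\<close>.
\<close>

lemma fresh_indices:
  obtains q :: "nat \<Rightarrow> nat" where "inj_on q {..<n}" "\<And>x. x < n \<Longrightarrow> q x < K"
    "\<And>x y z. x < n \<Longrightarrow> y < n \<Longrightarrow> z < n \<Longrightarrow> q x \<noteq> f y z div N mod K"
proof -
  define Q where "Q = (\<lambda>(y, z). f y z div N mod K) ` ({..<n} \<times> {..<n})"
  have "card Q \<le> card ({..<n} \<times> {..<n})" unfolding Q_def by (intro card_image_le) simp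
  then have "card Q \<le> n * n" by simp
  then have "card {..<n} \<le> card ({..<K} - Q)"
    using K_ge diff_card_le_card_Diff[of Q "{..<K}"] by (simp add: Q_def)
  then obtain q where "q ` {..<n} \<subseteq> {..<K} - Q" "inj_on q {..<n}"
    using card_le_inj[of "{..<n}" "{..<K} - Q"] by auto
  then show ?thesis by (intro that[of q]) (force simp: Q_def)+
qed

text \<open>
  If \<open>i\<close> is identified with another index \<open>d\<close>, its row is a copy of row \<open>d\<close>.
\<close>

lemma agree_net_zero_row:
  assumes f: "net f" "net g" and i: "i < n" "agree {i} f g" and d: "d < n" "d \<noteq> i" "g i d = 0"
  shows "g = reind f (id(i := d))"
proof (rule net_eqI[OF assms(2) net_reind[OF assms(1)]])
  show "id(i := d) ` {..<n} \<subseteq> {..<n}" using d by auto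
  fix x y assume xy: "x < n" "y < n"
  have row: "g i z = g d z" if "z < n" for z
    by (rule net_zero[OF f(2) i(1) d(1) that d(3)])
  have "g x y = g ((id(i := d)) x) ((id(i := d)) y)"
    using row[of y] row[of x] row[of d] netD(3,5)[OF f(2)] xy d by (cases "x = i"; cases "y = i") auto
  also have "\<dots> = f ((id(i := d)) x) ((id(i := d)) y)"
    using i d xy by (auto simp: agree_def)
  finally show "g x y = reind f (id(i := d)) x y" using xy by (simp add: reind_def)
qed

text \<open>
  Similarity is a back-and-forth system: every change \<open>g\<close> of row \<open>i\<close> of \<open>f\<close> can be
  copied to a similar matrix. This is why invariant sets of matrices are closed under
  cylindrification.
\<close>

lemma sim_extend:
  assumes mats: "f \<in> mats" "f' \<in> mats" "g \<in> mats" and sim: "sim k f f'" and k: "0 < k"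
    and i: "i < n" and ag: "agree {i} f g"
  obtains g' where "g' \<in> mats" "agree {i} f' g'" "sim k g g'"
proof (cases "\<exists>d<n. d \<noteq> i \<and> g i d = 0")
  case True
  then obtain d where d: "d < n" "d \<noteq> i" "g i d = 0" by blast
  have t: "id(i := d) ` {..<n} \<subseteq> {..<n}" using d by auto
  have "g = reind f (id(i := d))" using mats ag i d by (intro agree_net_zero_row mats_net) auto
  then have "sim k g (reind f' (id(i := d)))" using sim_reind[OF sim t] by simp
  moreover have "agree {i} f' (reind f' (id(i := d)))" by (simp add: agree_def reind_def)
  ultimately show ?thesis using mats_reind[OF mats(2) t] that by blast
next
  case False
  note nf = mats_net[OF mats(1)] and nf' = mats_net[OF mats(2)] and ng = mats_net[OF mats(3)]
  obtain \<sigma> where \<sigma>: "inj \<sigma>" "\<And>b. b < k \<Longrightarrow> \<sigma> b = b"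
    "\<And>y z. y < n \<Longrightarrow> z < n \<Longrightarrow> \<sigma> (f y z div L) = f' y z div L"
    using sim_block_map[OF sim nf'] by blast
  obtain q where q: "inj_on q {..<n}" "\<And>x. x < n \<Longrightarrow> q x < K"
    "\<And>x y z. x < n \<Longrightarrow> y < n \<Longrightarrow> z < n \<Longrightarrow> q x \<noteq> f' y z div N mod K"
    using fresh_indices[of f'] by blast
  have ge: "k \<le> \<sigma> b" if "k \<le> b" for b
  proof (rule ccontr)
    assume "\<not> k \<le> \<sigma> b"
    then have "\<sigma> (\<sigma> b) = \<sigma> b" using \<sigma>(2) by simp
    then have "\<sigma> b = b" using \<sigma>(1) by (simp add: inj_eq)
    then show False using that \<open>\<not> k \<le> \<sigma> b\<close> by simp
  qed
  \<comment> \<open>The blocks of the new row are dictated by similarity. From block \<open>k\<close> on,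
    fresh places inside the blocks make new labels adjacent to all labels of the same block, except between
    identified indices.\<close>
  define r where "r x = (if g i x < k * L then g i x
    else slot (\<sigma> (g i x div L)) (q (rep f' x)) (g i x mod N))" for x
  have qr: "q (rep f' x) < K" if "x < n" for x using q(2) rep(2)[OF nf' that] by blast
  have mN: "m mod N < N" for m using N_pos by simp
  have r_mod: "r x mod N = g i x mod N" for x by (simp add: r_def slot_mod mN)
  have r_div: "r x div L = \<sigma> (g i x div L)" if "x < n" for x
    using \<sigma>(2)[of "g i x div L"] qr[OF that] by (auto simp: r_def slot_div mN div_L_less)
  have r_small: "r x = g i x" if "r x < k * L \<or> g i x < k * L" "x < n" for x
  proof (rule ccontr)
    assume "r x \<noteq> g i x"
    then have b: "\<not> g i x < k * L" by (auto simp: r_def)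
    then have "k \<le> g i x div L" by (simp add: div_L_ge)
    then have "k \<le> r x div L" using ge r_div[OF that(2)] by simp
    then show False using that b by (simp add: div_L_ge)
  qed
  have r_big: "r x = slot (\<sigma> (g i x div L)) (q (rep f' x)) (g i x mod N)" if "\<not> g i x < k * L" for x
    using that by (simp add: r_def)
  have gi: "g i x \<noteq> 0" if "x < n" "x \<noteq> i" for x using False that by auto
  have kL: "0 < k * L" using k L_pos by simp
  have r0: "r x \<noteq> 0" if "x < n" "x \<noteq> i" for x
    using r_small[of x] gi[OF that] that kL by fastforce
  have gf: "g x y = f x y" if "x < n" "y < n" "x \<noteq> i" "y \<noteq> i" for x y
    using ag that by (auto simp: agree_def)
  have std0: "\<not> m < L" if "m \<in> std" "m \<noteq> 0" for m using that by (auto simp: std_def)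
  have tri_r: "tri (r x) (r y) (f' x y)" if xy: "x < n" "y < n" "x \<noteq> i" "y \<noteq> i" for x y
  proof -
    have "tri (g x i) (g i y) (g x y)" using netD(4)[OF ng] xy i by blast
    then have t: "tri (g i x) (g i y) (f x y)" using netD(5)[OF ng, of x i] gf xy by simp
    show ?thesis
    proof (cases "f x y = 0")
      case True
      then have "f' x y = 0" using sim_zero[OF sim k xy(1,2)] by simp
      moreover from True t have "g i x = g i y" by simp
      moreover from \<open>f' x y = 0\<close> have "rep f' x = rep f' y" using rep_eq_iff[OF nf' xy(1,2)] by simp
      ultimately show ?thesis by (simp add: r_def)
    next
      case f0: False
      then have f'0: "f' x y \<noteq> 0" using sim_zero[OF sim k xy(1,2)] by simp
      have nz: "r x \<noteq> 0" "r y \<noteq> 0" "f' x y \<noteq> 0" using r0 xy f'0 by auto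
      have A1: "adj (r x) (f' x y)" if x: "x < n" "y < n" "u < n" "x \<noteq> i" "f u v = f x y" "f' u v = f' x y"
         "u < n" "v < n" "adj (g i x) (f x y)" for x y u v
      proof (cases "g i x < k * L")
        case True
        then have "f x y div L < k" using that(9) div_L_less[of "g i x" k] by (simp add: adj_def)
        then have "f' x y = f x y" using simD(1)[OF sim x(1,2)] by (simp add: div_L_less)
        then show ?thesis using that(9) True by (simp add: r_def)
      next
        case F: False
        have "r x div L = f' x y div L"
          using r_div[OF x(1)] \<sigma>(3)[OF x(1,2)] that(9) by (simp add: adj_def)
        moreover have "r x \<noteq> f' x y"
        proof
          assume "r x = f' x y"
          then have "f' x y div N mod K = q (rep f' x)"
            using r_big[OF F] slot_div_N qr[OF x(1)] mN by metis
          then show False using q(3)[of "rep f' x" x y] rep(2)[OF nf' x(1)] x by simp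
        qed
        ultimately show ?thesis by (simp add: adj_def)
      qed
      have A2: "adj (r x) (r y)" if "adj (g i x) (g i y)"
      proof (cases "g i x < k * L")
        case True
        then have "g i y div L < k" using that div_L_less[of "g i x" k] by (simp add: adj_def)
        then have "g i y < k * L" by (simp add: div_L_less)
        then show ?thesis using that True by (simp add: r_def)
      next
        case F: False
        then have "k \<le> g i y div L" using that div_L_ge[of k "g i x"] by (simp add: adj_def)
        then have Fy: "\<not> g i y < k * L" by (simp add: div_L_ge)
        have "rep f' x \<noteq> rep f' y" using rep_eq_iff[OF nf' xy(1,2)] f'0 by simp
        then have "q (rep f' x) \<noteq> q (rep f' y)"
          using inj_onD[OF q(1)] rep(2)[OF nf' xy(1)] rep(2)[OF nf' xy(2)] by auto
        moreover have "g i x div L = g i y div L" using that by (simp add: adj_def)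
        ultimately show ?thesis
          unfolding r_big[OF F] r_big[OF Fy] using qr xy mN by (simp add: adj_slot)
      qed
      have c: "f x y mod N = f' x y mod N" by (rule simD(3)[OF sim xy(1,2)])
      from t show ?thesis
      proof (cases rule: tri_cases)
        case 4
        then show ?thesis using nz c r_mod by (intro tri_colour) auto
      next
        case 5
        then consider "adj (g i x) (g i y)" | "adj (g i x) (f x y)" | "adj (g i y) (f y x)"
          using netD(5)[OF nf, of x y] by auto
        then show ?thesis
        proof cases
          case 1 then show ?thesis using A2 nz by (intro tri_adj) auto
        next
          case 2
          then have "adj (r x) (f' x y)" using A1[of x y x y] xy by simp
          then show ?thesis using nz by (intro tri_swapI[OF tri_rotI[OF tri_rotI[OF tri_adj]]] tri_adj) (auto simp: tri_def)
        next
          case 3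
          then have "adj (r y) (f' x y)" using A1[of y x y x] xy netD(5)[OF nf', of x y] by simp
          then show ?thesis using nz by (auto simp: tri_def)
        qed
      qed (use gi xy f0 in auto)
    qed
  qed
  have r_std: "r x \<in> std" if "x < n" for x
  proof (cases "g i x < k * L")
    case True then show ?thesis using mats_std[OF mats(3)] by (simp add: r_def)
  next
    case F: False
    then have "k \<le> g i x div L" by (simp add: div_L_ge)
    then have "0 < \<sigma> (g i x div L)" using ge k by fastforce
    then show ?thesis unfolding r_big[OF F] by (rule slot_std)
  qed
  define g' where "g' = with_row i r f'"
  have "g' \<in> mats" unfolding g'_def using r_std tri_r i mats(2) by (intro mats_with_row) auto
  moreover have "agree {i} f' g'" unfolding g'_def by (rule agree_with_row)
  moreover have "sim k g g'"
  proof (rule simI)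
    show "inj_on \<sigma> {g x y div L | x y. x < n \<and> y < n}" using \<sigma>(1) inj_on_subset by blast
    fix x y assume xy: "x < n" "y < n"
    have e: "(x = i \<and> y = i \<and> g x y = 0 \<and> g' x y = 0) \<or> (g x y = g i y \<and> g' x y = r y) \<or>
      (g x y = g i x \<and> g' x y = r x) \<or> (g x y = f x y \<and> g' x y = f' x y)"
      using xy gf[OF xy] netD(3)[OF ng i] netD(5)[OF ng, of x i] by (auto simp: g'_def with_row_def)
    show "g' x y div L = \<sigma> (g x y div L)"
      using e \<sigma>(2)[OF k] r_div xy \<sigma>(3)[OF xy] by auto
    show "g x y mod N = g' x y mod N"
      using e r_mod simD(3)[OF sim xy] by auto
    show "g x y = g' x y" if "g x y < k * L \<or> g' x y < k * L"
      using e
    proof (elim disjE conjE)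
      assume "g x y = g i y" "g' x y = r y"
      then show ?thesis using that r_small[OF _ xy(2)] by metis
    next
      assume "g x y = g i x" "g' x y = r x"
      then show ?thesis using that r_small[OF _ xy(1)] by metis
    next
      assume "g x y = f x y" "g' x y = f' x y"
      then show ?thesis using that simD(1,2)[OF sim xy] by metis
    qed simp
  qed
  ultimately show ?thesis using that by blast
qed


section \<open>Generic matrices\<close>

text \<open>
  Labels in block \<open>p\<close> are replaced by the ideal label of their colour. This preserves
  consistency, because ideal labels of one colour are always adjacent.
\<close>

definition blur :: "nat \<Rightarrow> nat \<Rightarrow> nat" where
  "blur p m = (if m div L = p then N + m mod N else m)"

text \<open>
  An index below \<open>K\<close> for the unordered pair of \<open>u\<close> and \<open>v\<close>.
\<close>

definition pair_index :: "nat \<Rightarrow> nat \<Rightarrow> nat" where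
  "pair_index u v = min u v * n + max u v"

text \<open>
  An ideal label becomes the label number \<open>q\<close> of its colour in block \<open>p\<close>; other labels
  are not changed.
\<close>

definition glab :: "nat \<Rightarrow> nat \<Rightarrow> nat \<Rightarrow> nat" where
  "glab q p l = (if 0 < l \<and> l < L then slot p q (l mod N) else l)"

text \<open>
  The generic matrix at \<open>p\<close>: all ideal labels of \<open>f\<close> go to block \<open>p\<close>, with
  different places for different pairs of representatives. Two sides of a triangle that are ideal and
  of the same colour thus become adjacent, and so the matrix is consistent. Up to similarity it does
  not depend on \<open>p\<close>, if \<open>p\<close> is large (\<open>gen_sim\<close>), nor on the numbering of pairs, which is not compatible
  with reindexing (\<open>gen_reind_sim\<close>).
\<close>

definition gen :: "nat \<Rightarrow> (nat \<Rightarrow> nat \<Rightarrow> nat) \<Rightarrow> nat \<Rightarrow> nat \<Rightarrow> nat" where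
  "gen p f = (\<lambda>x y. glab (pair_index (rep f x) (rep f y)) p (f x y))"

lemma blur_mod [simp]: "blur p m mod N = m mod N"
  by (simp add: blur_def)

lemma N_add_less_L: "N + m mod N < L"
  using L_ge mod_less_divisor[OF N_pos, of m] by linarith

lemma blur_lab: "m \<in> lab \<Longrightarrow> blur p m \<in> lab"
  using mod_less_divisor[OF N_pos, of m] by (auto simp: blur_def lab_def)

lemma blur_0: "0 < p \<Longrightarrow> blur p m = 0 \<longleftrightarrow> m = 0"
  using N_pos by (auto simp: blur_def intro!: gr0I)

lemma blur_div: "blur p m div L = (if m div L = p then 0 else m div L)"
  using N_add_less_L[of m] by (simp add: blur_def)

lemma adj_blur: "0 < p \<Longrightarrow> adj a b \<Longrightarrow> adj (blur p a) (blur p b)"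
  using N_add_less_L[of a] by (auto simp: adj_def blur_div) (auto simp: blur_def)

lemma tri_blur:
  assumes p: "0 < p" and t: "tri a b c"
  shows "tri (blur p a) (blur p b) (blur p c)"
  using t
proof (cases rule: tri_cases)
  case 4
  then show ?thesis using blur_0[OF p] by (intro tri_colour) auto
next
  case 5
  then show ?thesis using blur_0[OF p] adj_blur[OF p] by (auto simp: tri_def)
qed (use blur_0[OF p, of 0] in auto)

lemma net_blur: "net f \<Longrightarrow> 0 < p \<Longrightarrow> net (\<lambda>x y. blur p (f x y))"
  using tri_blur blur_lab blur_0[of p 0] unfolding net_def by auto

lemma pair_index:
  assumes "u < n" "v < n"
  shows "pair_index u v < K" "w < n \<Longrightarrow> pair_index u v = pair_index v w \<Longrightarrow> u = w"
    "pair_index u v = pair_index v u"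
proof -
  have "min u v * n + max u v < n * n + n"
    using assms mult_right_mono[of "min u v" n n] by (simp add: add_le_less_mono)
  then show "pair_index u v < K" using K_ge unfolding pair_index_def by linarith
  show "pair_index u v = pair_index v u" by (simp add: pair_index_def min.commute max.commute)
  assume w: "w < n" and e: "pair_index u v = pair_index v w"
  have "pair_index u v div n = min u v" "pair_index u v mod n = max u v"
    "pair_index v w div n = min v w" "pair_index v w mod n = max v w"
    using assms w by (simp_all add: pair_index_def)
  then have "min u v = min v w" "max u v = max v w" using e by metis+
  then show "u = w" by (simp add: min_def max_def split: if_splits)
qed

lemma glab_std: "0 < p \<Longrightarrow> glab q p l \<in> std"
  using slot_std[of p] by (auto simp: glab_def std_def)

lemma glab_0: "0 < p \<Longrightarrow> glab q p l = 0 \<longleftrightarrow> l = 0"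
  using slot_neq_0 by (auto simp: glab_def)

lemma glab_zero [simp]: "glab q p 0 = 0"
  by (simp add: glab_def)

lemma glab_mod: "glab q p l mod N = l mod N"
  using N_pos by (simp add: glab_def slot_mod)

lemma blur_glab:
  assumes "l \<in> lab" "0 < p" "l < p * L" "q < K"
  shows "blur p (glab q p l) = l"
proof (cases "0 < l \<and> l < L")
  case True
  then have "N \<le> l" "l < 2 * N" using assms(1) by (auto simp: lab_def)
  then have "N + l mod N = l" by (simp add: mod_if[of l] not_less)
  then show ?thesis using True assms(4) N_pos by (simp add: blur_def glab_def slot_div slot_mod)
next
  case False
  then show ?thesis using assms(3) div_L_less[of l p] by (auto simp: blur_def glab_def)
qed

lemma adj_glab:
  assumes "adj a b" "a \<noteq> 0" "b \<noteq> 0" "q < K" "q' < K" "q \<noteq> q'"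
  shows "adj (glab q p a) (glab q' p b)"
proof (cases "a < L")
  case True
  then have "b < L" using assms(1) L_pos by (simp add: adj_def div_eq_0_iff)
  then show ?thesis using True assms N_pos by (simp add: glab_def adj_slot)
next
  case False
  then have "\<not> b < L" using assms(1) L_pos by (auto simp: adj_def div_eq_0_iff)
  then show ?thesis using False assms(1) by (simp add: glab_def)
qed

lemma glab_div: "q < K \<Longrightarrow> 0 < l \<Longrightarrow> l < L \<Longrightarrow> glab q p l div L = p"
  using N_pos by (simp add: glab_def slot_div)

lemma gen_index: "net f \<Longrightarrow> x < n \<Longrightarrow> y < n \<Longrightarrow> pair_index (rep f x) (rep f y) < K"
  using pair_index(1) rep(2) by simp

lemma gen_mod: "gen p f x y mod N = f x y mod N"
  by (simp add: gen_def glab_mod)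

lemma gen_0: "0 < p \<Longrightarrow> gen p f x y = 0 \<longleftrightarrow> f x y = 0"
  by (simp add: gen_def glab_0)

lemma gen_div:
  assumes "net f" "x < n" "y < n"
  shows "gen p f x y div L = (if 0 < f x y \<and> f x y < L then p else f x y div L)"
  using glab_div[OF gen_index[OF assms]] by (simp add: gen_def) (simp add: glab_def)

lemma gen_mats:
  assumes f: "net f" and p: "0 < p"
  shows "gen p f \<in> mats"
proof -
  have "gen p f x y \<in> std" for x y
    using glab_std[OF p] by (simp add: gen_def)
  moreover have "tri (gen p f x y) (gen p f y z) (gen p f x z)" if xyz: "x < n" "y < n" "z < n" for x y z
  proof -
    have rows: "gen p f u v = gen p f w v" if "u < n" "v < n" "w < n" "f u w = 0" for u v w
      using net_zero[OF f that(1,3,2,4)] rep_eq_iff[OF f that(1,3)] that(4) by (simp add: gen_def)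
    have sym: "gen p f u v = gen p f v u" if "u < n" "v < n" for u v
      using netD(5)[OF f, of u v] pair_index(3)[OF rep(2)[OF f that(1)] rep(2)[OF f that(2)]]
      by (simp add: gen_def)
    have adj: "adj (gen p f u v) (gen p f v w)"
      if uvw: "u < n" "v < n" "w < n" "f u w \<noteq> 0" and a: "adj (f u v) (f v w)" "f u v \<noteq> 0" "f v w \<noteq> 0" for u v w
    proof -
      note rp = rep(2)[OF f uvw(1)] rep(2)[OF f uvw(2)] rep(2)[OF f uvw(3)]
      have "pair_index (rep f u) (rep f v) \<noteq> pair_index (rep f v) (rep f w)"
        using pair_index(2)[OF rp] rep_eq_iff[OF f uvw(1,3)] uvw(4) by blast
      then show ?thesis
        unfolding gen_def using a pair_index(1) rp by (intro adj_glab) auto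
    qed
    have t: "tri (f x y) (f y z) (f x z)" by (rule netD(4)[OF f xyz])
    show ?thesis
    proof (cases "f x y = 0 \<or> f y z = 0 \<or> f x z = 0")
      case True
      then show ?thesis
      proof (elim disjE)
        assume "f x y = 0"
        then show ?thesis using rows[of x z y] xyz gen_0[OF p, of f x y] by simp
      next
        assume "f y z = 0"
        then show ?thesis using rows[of y x z] sym[of x y] sym[of x z] xyz gen_0[OF p, of f y z] by simp
      next
        assume "f x z = 0"
        then show ?thesis using rows[of x y z] sym[of z y] xyz gen_0[OF p, of f x z] by simp
      qed
    next
      case False
      from t show ?thesis
      proof (cases rule: tri_cases)
        case 4
        then show ?thesis using gen_0[OF p] gen_mod by (intro tri_colour) auto
      next
        case 5
        have "adj (gen p f x y) (gen p f y z) \<or> adj (gen p f y z) (gen p f x z) \<or> adj (gen p f x y) (gen p f x z)"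
          using 5(6)
        proof (elim disjE)
          assume "adj (f x y) (f y z)" then show ?thesis using adj[of x y z] xyz 5 by simp
        next
          assume "adj (f y z) (f x z)"
          then show ?thesis using adj[of y z x] xyz 5 netD(5)[OF f, of z x] netD(5)[OF f, of y x] sym[of z x] by simp
        next
          assume "adj (f x y) (f x z)"
          then show ?thesis using adj[of y x z] xyz 5 netD(5)[OF f, of y x] sym[of y x] by simp
        qed
        then show ?thesis using 5(1-3) gen_0[OF p] by (simp add: tri_def)
      qed (use False in auto)
    qed
  qed
  moreover have "gen p f x y = 0" if "\<not> (x < n \<and> y < n)" for x y
    using netD(2)[OF f that] by (simp add: gen_def)
  moreover have "gen p f x x = 0" if "x < n" for x
    using netD(3)[OF f that] by (simp add: gen_def)
  ultimately show ?thesis unfolding mats_def net_def using std_lab by auto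
qed

lemma gen_std: "f \<in> mats \<Longrightarrow> gen p f = f"
proof (intro ext)
  fix x y assume "f \<in> mats"
  then show "gen p f x y = f x y" using mats_std[of f x y] by (auto simp: gen_def glab_def std_def)
qed

text \<open>
  Blurring a block and then moving it away gives a similar matrix, provided the new block is beyond
  all blocks that occur. Thus the ideal labels lose nothing that an invariant set could express.
\<close>

lemma gen_blur_sim:
  assumes g: "g \<in> mats" and k: "0 < k" "k \<le> p" "k \<le> p'" and p': "\<And>x y. g x y < p' * L"
  shows "sim k g (gen p' (\<lambda>x y. blur p (g x y)))"
proof (rule simI)
  have p0: "0 < p" using k by simp
  let ?f = "\<lambda>x y. blur p (g x y)"
  define \<tau> where "\<tau> b = (if b = p then p' else b)" for b :: nat
  have b: "g x y div L < p'" for x y using p' by (simp add: div_L_less)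
  then show "inj_on \<tau> {g x y div L | x y. x < n \<and> y < n}"
    by (auto simp: inj_on_def \<tau>_def)
  fix x y assume xy: "x < n" "y < n"
  have nf: "net ?f" using g p0 by (intro net_blur mats_net)
  have gL: "g x y div L \<noteq> p \<Longrightarrow> \<not> (0 < ?f x y \<and> ?f x y < L)"
    using mats_std[OF g, of x y] by (auto simp: blur_def std_def)
  have gp: "g x y div L = p \<Longrightarrow> 0 < ?f x y \<and> ?f x y < L"
    using N_add_less_L[of "g x y"] N_pos by (simp add: blur_def)
  show "g x y mod N = gen p' ?f x y mod N" by (simp add: gen_mod)
  show d: "gen p' ?f x y div L = \<tau> (g x y div L)"
  proof (cases "g x y div L = p")
    case True
    then show ?thesis using gp gen_div[OF nf xy, of p'] by (simp add: \<tau>_def)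
  next
    case False
    then show ?thesis using gL gen_div[OF nf xy, of p'] by (auto simp: \<tau>_def blur_def)
  qed
  show "g x y = gen p' ?f x y" if "g x y < k * L \<or> gen p' ?f x y < k * L"
  proof (cases "g x y div L = p")
    case True
    then have "k \<le> gen p' ?f x y div L" "k \<le> g x y div L" using d k by (auto simp: \<tau>_def)
    then show ?thesis using that by (auto simp: div_L_ge)
  next
    case False
    then show ?thesis using gL by (auto simp: gen_def glab_def blur_def)
  qed
qed

lemma blur_gen:
  assumes f: "net f" and p: "0 < p" "\<And>x y. f x y < p * L"
  shows "(\<lambda>x y. blur p (gen p f x y)) = f"
proof (rule net_eqI[OF net_blur[OF mats_net[OF gen_mats]] f])
  fix x y assume xy: "x < n" "y < n"
  show "blur p (gen p f x y) = f x y"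
    unfolding gen_def using netD(1)[OF f] p gen_index[OF f xy] by (intro blur_glab) auto
qed (use f p in auto)

lemma gen_sim:
  assumes f: "net f" and k: "0 < k" "k \<le> p" "k \<le> p'" and b: "\<And>x y. f x y < p * L" "\<And>x y. f x y < p' * L"
  shows "sim k (gen p f) (gen p' f)"
proof -
  have *: "sim k (gen p f) (gen p' f)" if "p < p'" "k \<le> p" "\<And>x y. f x y < p * L" for p p'
  proof -
    have p: "0 < p" using that k by simp
    have "gen p f x y < p' * L" for x y
    proof (cases "x < n \<and> y < n")
      case True
      then have "gen p f x y div L \<le> p"
        using that(3)[of x y] div_L_less[of "f x y" p] gen_div[OF f, of x y p] by auto
      then show ?thesis using \<open>p < p'\<close> by (simp flip: div_L_less)
    next
      case False
      then show ?thesis using \<open>p < p'\<close> L_pos netD(2)[OF f False] by (simp add: gen_def)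
    qed
    then have "sim k (gen p f) (gen p' (\<lambda>x y. blur p (gen p f x y)))"
      using that k p by (intro gen_blur_sim gen_mats f) auto
    then show ?thesis using blur_gen[OF f p that(3)] by simp
  qed
  consider "p < p'" | "p = p'" | "p' < p" by linarith
  then show ?thesis
    using *[of p p'] *[of p' p] k b sim_refl sim_sym by cases auto
qed

lemma gen_reind_sim:
  assumes f: "net f" and \<tau>: "\<tau> ` {..<n} \<subseteq> {..<n}" and k: "k \<le> p"
  shows "sim k (gen p (reind f \<tau>)) (reind (gen p f) \<tau>)"
proof (rule simI)
  show "inj_on id {gen p (reind f \<tau>) x y div L | x y. x < n \<and> y < n}" by simp
  fix x y assume xy: "x < n" "y < n"
  have nr: "net (reind f \<tau>)" using net_reind f \<tau> by blast
  have txy: "\<tau> x < n" "\<tau> y < n" using \<tau> xy by auto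
  have e: "reind f \<tau> x y = f (\<tau> x) (\<tau> y)" "reind (gen p f) \<tau> x y = gen p f (\<tau> x) (\<tau> y)"
    using xy by (simp_all add: reind_def)
  show m: "gen p (reind f \<tau>) x y mod N = reind (gen p f) \<tau> x y mod N"
    by (simp add: gen_mod e)
  show d: "reind (gen p f) \<tau> x y div L = id (gen p (reind f \<tau>) x y div L)"
    using gen_div[OF nr xy, of p] gen_div[OF f txy, of p] by (simp add: e)
  show "gen p (reind f \<tau>) x y = reind (gen p f) \<tau> x y"
    if "gen p (reind f \<tau>) x y < k * L \<or> reind (gen p f) \<tau> x y < k * L"
  proof (cases "0 < f (\<tau> x) (\<tau> y) \<and> f (\<tau> x) (\<tau> y) < L")
    case True
    then have "p * L \<le> gen p (reind f \<tau>) x y" "p * L \<le> reind (gen p f) \<tau> x y"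
      using slot_ge[of p p] unfolding e(2) by (auto simp: gen_def glab_def e(1))
    moreover have "k * L \<le> p * L" using k by simp
    ultimately show ?thesis using that by linarith
  next
    case False
    then show ?thesis unfolding e(2) by (auto simp: gen_def glab_def e(1))
  qed
qed

end

section \<open>The base of the representation\<close>

text \<open>
  A point is given by the list of the labels that it prescribes to older points, its parents.
\<close>

datatype node = Node "(node \<times> nat) list"

fun parents :: "node \<Rightarrow> (node \<times> nat) set" where
  "parents (Node ps) = set ps"

text \<open>
  \<open>par z w\<close>: the point \<open>w\<close> is a parent of \<open>z\<close>.
\<close>

definition par :: "node \<Rightarrow> node \<Rightarrow> bool" where
  "par z w \<longleftrightarrow> (\<exists>l. (w, l) \<in> parents z)"

lemma par_size: "par z w \<Longrightarrow> size w < size z"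
proof (cases z)
  case (Node ps)
  have "size w < size (Node ps)" if "(w, l) \<in> set ps" for l
    using that by (induction ps) (auto simp: less_Suc_eq_le)
  then show "par z w \<Longrightarrow> size w < size z" using Node by (auto simp: par_def)
qed

context dimension
begin

text \<open>
  The colours of the labels prescribed by \<open>z\<close>.
\<close>

definition cols :: "node \<Rightarrow> nat set" where
  "cols z = (\<lambda>(v, l). l mod N) ` parents z"

text \<open>
  The label between two points: the identity on the diagonal, the prescribed label between child and
  parent, and otherwise the ideal label of the least colour that neither point prescribes. For a
  point of the base the prescribed label is unique (\<open>lam_parent\<close>), so the choice operator is
  harmless.
\<close>

definition lam :: "node \<Rightarrow> node \<Rightarrow> nat" where
  "lam z w = (if z = w then 0 else if par z w then SOME l. (w, l) \<in> parents z
     else if par w z then SOME l. (z, l) \<in> parents w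
     else N + (LEAST j. j \<notin> cols z \<union> cols w))"

text \<open>
  The base consists of the points with fewer than \<open>n\<close> parents, in the base, whose prescribed
  labels form consistent triangles with the labels between the parents.
\<close>

inductive_set base :: "node set" where
  base_Node: "length ps < n \<Longrightarrow> (\<And>v l. (v, l) \<in> set ps \<Longrightarrow> v \<in> base) \<Longrightarrow> (\<And>v l. (v, l) \<in> set ps \<Longrightarrow> 0 < l \<and> l \<in> lab)
    \<Longrightarrow> (\<And>v l v' l'. (v, l) \<in> set ps \<Longrightarrow> (v', l') \<in> set ps \<Longrightarrow> tri l l' (lam v v'))
    \<Longrightarrow> Node ps \<in> base"

lemma baseD:
  assumes "z \<in> base"
  shows "(v, l) \<in> parents z \<Longrightarrow> v \<in> base" "(v, l) \<in> parents z \<Longrightarrow> 0 < l" "(v, l) \<in> parents z \<Longrightarrow> l \<in> lab"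
    "(v, l) \<in> parents z \<Longrightarrow> (v', l') \<in> parents z \<Longrightarrow> tri l l' (lam v v')"
    "finite (cols z)" "card (cols z) < n"
proof -
  from assms obtain ps where z: "z = Node ps" "length ps < n" "\<And>v l. (v, l) \<in> set ps \<Longrightarrow> v \<in> base"
    "\<And>v l. (v, l) \<in> set ps \<Longrightarrow> 0 < l \<and> l \<in> lab"
    "\<And>v l v' l'. (v, l) \<in> set ps \<Longrightarrow> (v', l') \<in> set ps \<Longrightarrow> tri l l' (lam v v')"
    by (cases rule: base.cases) blast
  have "card (cols z) \<le> card (set ps)" unfolding cols_def z(1) by (simp add: card_image_le)
  also have "\<dots> < n" using card_length[of ps] z(2) by linarith
  finally show "card (cols z) < n" .
  show "finite (cols z)" by (simp add: cols_def z(1))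
  show "(v, l) \<in> parents z \<Longrightarrow> v \<in> base" "(v, l) \<in> parents z \<Longrightarrow> 0 < l"
    "(v, l) \<in> parents z \<Longrightarrow> l \<in> lab"
    "(v, l) \<in> parents z \<Longrightarrow> (v', l') \<in> parents z \<Longrightarrow> tri l l' (lam v v')"
    using z(3-5) by (simp_all add: z(1))
qed

lemma lam_parent:
  assumes "z \<in> base" "(v, l) \<in> parents z"
  shows "lam z v = l"
proof -
  have "par z v" using assms(2) by (auto simp: par_def)
  then have "z \<noteq> v" using par_size by blast
  have "(v, SOME l. (v, l) \<in> parents z) \<in> parents z" using assms(2) by (rule someI)
  then have "tri (SOME l. (v, l) \<in> parents z) l (lam v v)" using baseD(4)[OF assms(1)] assms(2) by blast
  then show ?thesis using \<open>par z v\<close> \<open>z \<noteq> v\<close> by (simp add: lam_def)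
qed

lemma lam_refl [simp]: "lam z z = 0"
  by (simp add: lam_def)

lemma lam_sym: "lam z w = lam w z"
proof (cases "par z w \<or> par w z")
  case True
  then show ?thesis using par_size[of z w] par_size[of w z] by (auto simp: lam_def)
next
  case False
  then show ?thesis by (simp add: lam_def Un_commute)
qed

lemma lam_free:
  assumes "z \<in> base" "w \<in> base" "z \<noteq> w" "\<not> par z w" "\<not> par w z"
  obtains j where "lam z w = N + j" "j < N" "j \<notin> cols z" "j \<notin> cols w"
proof -
  let ?C = "cols z \<union> cols w"
  have "card ?C \<le> card (cols z) + card (cols w)" by (rule card_Un_le)
  also have "\<dots> < N" using baseD(6)[OF assms(1)] baseD(6)[OF assms(2)] by (simp add: N_def)
  finally obtain c where c: "c < N" "c \<notin> ?C"
    using ex_colour[of ?C] baseD(5)[OF assms(1)] baseD(5)[OF assms(2)] by blast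
  have "(LEAST j. j \<notin> ?C) \<notin> ?C" by (rule LeastI[of "\<lambda>j. j \<notin> ?C", OF c(2)])
  moreover have "(LEAST j. j \<notin> ?C) \<le> c" by (rule Least_le[of "\<lambda>j. j \<notin> ?C", OF c(2)])
  ultimately show ?thesis using that[of "LEAST j. j \<notin> ?C"] c assms(3-5) by (simp add: lam_def)
qed

lemma lam_par:
  assumes "z \<in> base" "par z w"
  shows "0 < lam z w" "lam z w \<in> lab" "lam z w mod N \<in> cols z"
proof -
  obtain l where l: "(w, l) \<in> parents z" using assms(2) by (auto simp: par_def)
  then have "lam z w = l" by (rule lam_parent[OF assms(1)])
  moreover have "l mod N \<in> cols z" using l by (auto simp: cols_def)
  ultimately show "0 < lam z w" "lam z w \<in> lab" "lam z w mod N \<in> cols z"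
    using baseD(2,3)[OF assms(1) l] by auto
qed

lemma lam_props:
  assumes "z \<in> base" "w \<in> base"
  shows "lam z w = 0 \<longleftrightarrow> z = w" "lam z w \<in> lab"
proof -
  have "(z \<noteq> w \<longrightarrow> lam z w \<noteq> 0) \<and> lam z w \<in> lab"
  proof (cases "z = w")
    case ne: False
    consider "par z w" | "par w z" | "\<not> par z w" "\<not> par w z" by blast
    then show ?thesis
    proof cases
      case 1 then show ?thesis using lam_par[OF assms(1)] by fastforce
    next
      case 2 then show ?thesis using lam_par[OF assms(2)] lam_sym[of z w] by fastforce
    next
      case 3
      then obtain j where "lam z w = N + j" "j < N" using lam_free[OF assms ne] by blast
      then show ?thesis using N_pos by (simp add: lab_def)
    qed
  qed simp
  then show "lam z w = 0 \<longleftrightarrow> z = w" "lam z w \<in> lab" by auto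
qed

lemma tri_parents:
  assumes "z \<in> base" "par z w" "par z v"
  shows "tri (lam z w) (lam z v) (lam w v)"
  using assms(2,3) baseD(4)[OF assms(1)] lam_parent[OF assms(1)] unfolding par_def by blast

text \<open>
  If a monochromatic triangle has a side prescribed by \<open>u\<close>, then \<open>u\<close> prescribes its
  colour, and hence its other side at \<open>u\<close> is not an ideal label chosen for want of a prescription.
  It follows that one of the points is a child of the two others.
\<close>

lemma tri_monochromatic:
  assumes b: "u \<in> base" "x \<in> base" "y \<in> base" and ne: "u \<noteq> y" "x \<noteq> y"
    and c: "lam u x mod N = c" "lam u y mod N = c" "lam x y mod N = c" and p: "par u x"
  shows "tri (lam u x) (lam u y) (lam x y)"
proof -
  have *: "par a d \<or> par d a"
    if h: "a \<in> base" "d \<in> base" "a \<noteq> d" "par a b" "lam a b mod N = lam a d mod N" for a b d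
  proof (rule ccontr)
    assume "\<not> (par a d \<or> par d a)"
    then obtain j where "lam a d = N + j" "j < N" "j \<notin> cols a"
      using lam_free[OF h(1-3)] by blast
    then show False using lam_par(3)[OF h(1,4)] h(5) by simp
  qed
  have "par u y \<or> par y u" using * b ne p c by metis
  then show ?thesis
  proof
    assume "par u y" then show ?thesis using tri_parents b p by blast
  next
    assume yu: "par y u"
    have "par y x \<or> par x y"
      using *[OF b(3,2) _ yu] ne c lam_sym[of y u] lam_sym[of y x] by simp
    moreover have "\<not> par x y" using par_size[OF yu] par_size[OF p] par_size[of x y] by linarith
    ultimately have t: "tri (lam y x) (lam y u) (lam x u)" using tri_parents[OF b(3) _ yu] by blast
    show ?thesis
      unfolding lam_sym[of u x] lam_sym[of u y] lam_sym[of x y] by (rule tri_swapI[OF tri_rotI[OF t]])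
  qed
qed

text \<open>
  All triangles of the base are consistent. In a monochromatic triangle either some side is
  prescribed, or all sides are the same ideal label, which is adjacent to itself.
\<close>

lemma tri_lam:
  assumes b: "x \<in> base" "y \<in> base" "z \<in> base"
  shows "tri (lam x y) (lam y z) (lam x z)"
proof (cases "x = y \<or> y = z \<or> x = z")
  case True
  then show ?thesis using lam_sym by auto
next
  case ne: False
  have nz: "lam x y \<noteq> 0" "lam y z \<noteq> 0" "lam x z \<noteq> 0" using lam_props(1) b ne by auto
  show ?thesis
  proof (cases "lam x y mod N = lam y z mod N \<and> lam y z mod N = lam x z mod N")
    case False
    then show ?thesis by (rule tri_colour[OF nz])
  next
    case c: True
    show ?thesis
    proof (cases "par x y \<or> par y x \<or> par x z \<or> par z x \<or> par y z \<or> par z y")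
      case True
      have sy: "lam y x = lam x y" "lam z x = lam x z" "lam z y = lam y z" by (rule lam_sym)+
      have cs: "lam y x mod N = lam x y mod N" "lam z x mod N = lam x y mod N" "lam z y mod N = lam x y mod N"
        "lam x z mod N = lam x y mod N" "lam y z mod N = lam x y mod N" using c by (simp_all add: sy)
      from True show ?thesis
      proof (elim disjE)
        assume "par x y"
        then have *: "tri (lam x y) (lam x z) (lam y z)"
          using tri_monochromatic[of x y z "lam x y mod N"] b ne cs by auto
        show ?thesis using tri_flipI[OF *] by (simp only: sy)
      next
        assume "par y x"
        then have *: "tri (lam y x) (lam y z) (lam x z)"
          using tri_monochromatic[of y x z "lam x y mod N"] b ne cs by auto
        show ?thesis using * by (simp only: sy)
      next
        assume "par x z"
        then have *: "tri (lam x z) (lam x y) (lam z y)"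
          using tri_monochromatic[of x z y "lam x y mod N"] b ne cs by auto
        show ?thesis using tri_rotI[OF *] by (simp only: sy)
      next
        assume "par z x"
        then have *: "tri (lam z x) (lam z y) (lam x y)"
          using tri_monochromatic[of z x y "lam x y mod N"] b ne cs by auto
        show ?thesis using tri_flipI[OF tri_rotI[OF tri_rotI[OF *]]] by (simp only: sy)
      next
        assume "par y z"
        then have *: "tri (lam y z) (lam y x) (lam z x)"
          using tri_monochromatic[of y z x "lam x y mod N"] b ne cs by auto
        show ?thesis using tri_swapI[OF *] by (simp only: sy)
      next
        assume "par z y"
        then have *: "tri (lam z y) (lam z x) (lam y x)"
          using tri_monochromatic[of z y x "lam x y mod N"] b ne cs by auto
        show ?thesis using tri_rotI[OF tri_rotI[OF *]] by (simp only: sy)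
      qed
    next
      case False
      obtain j where j: "lam x y = N + j" "j < N" using lam_free[OF b(1,2)] ne False by blast
      obtain j' where j': "lam y z = N + j'" "j' < N" using lam_free[OF b(2,3)] ne False by blast
      have "lam x y < L" "lam y z < L" using j j' L_ge by linarith+
      then have "adj (lam x y) (lam y z)" by (simp add: adj_def)
      then show ?thesis by (rule tri_adj[OF nz])
    qed
  qed
qed

text \<open>
  Every consistent choice of labels to fewer than \<open>n\<close> points is realized by a point; if one of the
  labels is the identity, by one of the given points.
\<close>

lemma base_extend:
  assumes len: "length ps < n" and ps: "\<And>v l. (v, l) \<in> set ps \<Longrightarrow> v \<in> base \<and> l \<in> lab"
    and tri: "\<And>v l v' l'. (v, l) \<in> set ps \<Longrightarrow> (v', l') \<in> set ps \<Longrightarrow> tri l l' (lam v v')"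
  obtains u where "u \<in> base" "\<And>v l. (v, l) \<in> set ps \<Longrightarrow> lam u v = l"
proof (cases "\<exists>v. (v, 0) \<in> set ps")
  case True
  then obtain v where v: "(v, 0) \<in> set ps" by blast
  have "lam v v' = l'" if "(v', l') \<in> set ps" for v' l' using tri[OF v that] by simp
  then show ?thesis using that[of v] ps v by blast
next
  case False
  then have "0 < l" if "(v, l) \<in> set ps" for v l using that by (cases l) auto
  then have "Node ps \<in> base" using len ps tri by (intro base_Node) blast+
  then show ?thesis using lam_parent[of "Node ps"] by (intro that[of "Node ps"]) auto
qed

text \<open>
  The matrix of labels of a sequence of points.
\<close>

definition net_of :: "(nat \<Rightarrow> node) \<Rightarrow> nat \<Rightarrow> nat \<Rightarrow> nat" where
  "net_of s = (\<lambda>x y. if x < n \<and> y < n then lam (s x) (s y) else 0)"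

lemma seqsD: "s \<in> seqs n V \<Longrightarrow> x < n \<Longrightarrow> s x \<in> V"
  by (auto simp: seqs_def)

lemma seqs_upd: "s \<in> seqs n V \<Longrightarrow> i < n \<Longrightarrow> u \<in> V \<Longrightarrow> s(i := u) \<in> seqs n V"
  by (auto simp: seqs_def PiE_iff extensional_def)

lemma seqs_eqI: "s \<in> seqs n V \<Longrightarrow> t \<in> seqs n V \<Longrightarrow> (\<And>x. x < n \<Longrightarrow> s x = t x) \<Longrightarrow> s = t"
  unfolding seqs_def by (rule PiE_ext) auto

lemma bound_mono: "m < B * L \<Longrightarrow> B \<le> p \<Longrightarrow> m < p * L"
  by (meson less_le_trans mult_le_mono1)

lemma net_net_of: "s \<in> seqs n base \<Longrightarrow> net (net_of s)"
  using seqsD[of s base] tri_lam lam_props(2) by (simp add: net_def net_of_def)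

lemma seq_extend:
  assumes s: "s \<in> seqs n base" and g: "net g" and i: "i < n" and ag: "agree {i} (net_of s) g"
  obtains u where "u \<in> base" "net_of (s(i := u)) = g"
proof -
  define ps where "ps = map (\<lambda>x. (s x, g i x)) (filter (\<lambda>x. x \<noteq> i) [0..<n])"
  have "length (filter (\<lambda>x. x \<noteq> i) [0..<n]) < length [0..<n]"
    using i by (intro length_filter_less[of i]) auto
  then have len: "length ps < n" by (simp add: ps_def)
  have ps: "(v, l) \<in> set ps \<longleftrightarrow> (\<exists>x<n. x \<noteq> i \<and> v = s x \<and> l = g i x)" for v l
    by (auto simp: ps_def)
  have gs: "g x y = lam (s x) (s y)" if "x < n" "y < n" "x \<noteq> i" "y \<noteq> i" for x y
    using ag that by (auto simp: agree_def net_of_def)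
  have tri: "tri (g i x) (g i y) (lam (s x) (s y))" if "x < n" "y < n" "x \<noteq> i" "y \<noteq> i" for x y
    using netD(4)[OF g that(1) i that(2)] gs[OF that] netD(5)[OF g, of x i] by simp
  obtain u where u: "u \<in> base" "\<And>v l. (v, l) \<in> set ps \<Longrightarrow> lam u v = l"
  proof (rule base_extend[OF len])
    show "v \<in> base \<and> l \<in> lab" if "(v, l) \<in> set ps" for v l
      using that netD(1)[OF g] seqsD[OF s] by (auto simp: ps)
    show "tri l l' (lam v v')" if "(v, l) \<in> set ps" "(v', l') \<in> set ps" for v l v' l'
      using that tri by (auto simp: ps)
  qed blast
  then have lu: "lam u (s x) = g i x" if "x < n" "x \<noteq> i" for x using ps that by blast
  have "net_of (s(i := u)) = g"
  proof (rule net_eqI[OF net_net_of[OF seqs_upd[OF s i u(1)]] g])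
    fix x y assume xy: "x < n" "y < n"
    show "net_of (s(i := u)) x y = g x y"
    proof (cases "x = i"; cases "y = i")
      assume "x = i" "y = i"
      then show ?thesis using netD(3)[OF g] xy by (simp add: net_of_def)
    next
      assume "x = i" "y \<noteq> i"
      then show ?thesis using lu xy by (simp add: net_of_def)
    next
      assume "x \<noteq> i" "y = i"
      then show ?thesis using lu[OF xy(1)] xy lam_sym[of "s x" u] netD(5)[OF g, of x i] by (simp add: net_of_def)
    next
      assume "x \<noteq> i" "y \<noteq> i"
      then show ?thesis using gs xy by (simp add: net_of_def)
    qed
  qed
  then show ?thesis using that u by blast
qed

lemma root_base: "Node [] \<in> base"
  using n_gt_2 by (intro base_Node) auto

text \<open>
  Every consistent matrix, even with ideal labels, is the matrix of a sequence. The entries of a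
  constant sequence are corrected one after the other.
\<close>

lemma realize:
  assumes g: "net g"
  obtains s where "s \<in> seqs n base" "net_of s = g"
proof -
  define \<tau> where "\<tau> k x = (if x < k then x else 0)" for k x :: nat
  have "\<exists>s\<in>seqs n base. net_of s = reind g (\<tau> k)" if "k \<le> n" for k
    using that
  proof (induction k)
    case 0
    have "g 0 0 = 0" using netD(3)[OF g] n_gt_2 by simp
    then have "net_of (\<lambda>x\<in>{..<n}. Node []) = reind g (\<tau> 0)"
      by (intro ext) (simp add: net_of_def reind_def \<tau>_def)
    moreover have "(\<lambda>x\<in>{..<n}. Node []) \<in> seqs n base" using root_base by (auto simp: seqs_def)
    ultimately show ?case by blast
  next
    case (Suc k)
    then obtain s where s: "s \<in> seqs n base" "net_of s = reind g (\<tau> k)" by auto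
    have "net (reind g (\<tau> (Suc k)))" using g n_gt_2 by (intro net_reind) (auto simp: \<tau>_def)
    moreover have "agree {k} (net_of s) (reind g (\<tau> (Suc k)))"
      unfolding s(2) by (auto simp: agree_def reind_def \<tau>_def less_Suc_eq)
    ultimately obtain u where u: "u \<in> base" "net_of (s(k := u)) = reind g (\<tau> (Suc k))"
      using seq_extend[OF s(1), of _ k] Suc.prems by (metis Suc_le_lessD)
    have "s(k := u) \<in> seqs n base" using Suc.prems by (intro seqs_upd[OF s(1) _ u(1)]) simp
    then show ?case using u(2) by blast
  qed
  from this[of n] obtain s where "s \<in> seqs n base" "net_of s = reind g (\<tau> n)" by auto
  moreover have "reind g (\<tau> n) = g"
    using netD(2)[OF g] by (intro ext) (auto simp: reind_def \<tau>_def)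
  ultimately show ?thesis using that by simp
qed

end

section \<open>Polyadic atom structures of matrices\<close>

lemma pea_argsE:
  assumes "pea_sig n F f = Some k" "length Xs = k"
  obtains (Cyl) i X where "f = Cyl i" "i < n" "Xs = [X]"
    | (Diag) i j where "f = Diag i j" "i < n" "j < n" "Xs = []"
    | (Repl) i j X where "f = Repl i j" "i < n" "j < n" "Xs = [X]"
    | (Swap) i j X where "f = Swap i j" "i < n" "j < n" "Xs = [X]"
  using assms by (cases f) (auto simp: Suc_length_conv split: if_splits)

text \<open>
  An atom structure of type \<open>PEA\<^sub>n\<close> isomorphic, by \<open>mt\<close>, to that of the matrices in
  \<open>mats\<close>.
\<close>

locale matrix_structure = dimension n for n :: nat +
  fixes S :: "(pea_op, 's) atom_structure" and mt :: "'s \<Rightarrow> nat \<Rightarrow> nat \<Rightarrow> nat"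
  assumes mt_bij: "bij_betw mt (points S) mats"
    and rel_Cyl: "\<And>i s t. i < n \<Longrightarrow> s \<in> points S \<Longrightarrow> t \<in> points S
      \<Longrightarrow> rel S (Cyl i) s [t] \<longleftrightarrow> agree {i} (mt s) (mt t)"
    and rel_Diag: "\<And>i j s. i < n \<Longrightarrow> j < n \<Longrightarrow> s \<in> points S \<Longrightarrow> rel S (Diag i j) s [] \<longleftrightarrow> mt s i j = 0"
    and rel_Repl: "\<And>i j s t. i < n \<Longrightarrow> j < n \<Longrightarrow> s \<in> points S \<Longrightarrow> t \<in> points S
      \<Longrightarrow> rel S (Repl i j) s [t] \<longleftrightarrow> mt t = reind (mt s) (id(i := j))"
    and rel_Swap: "\<And>i j s t. i < n \<Longrightarrow> j < n \<Longrightarrow> s \<in> points S \<Longrightarrow> t \<in> points S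
      \<Longrightarrow> rel S (Swap i j) s [t] \<longleftrightarrow> mt t = reind (mt s) (transpose i j)"
begin

definition pt :: "(nat \<Rightarrow> nat \<Rightarrow> nat) \<Rightarrow> 's" where
  "pt = inv_into (points S) mt"

lemma mt_mats: "s \<in> points S \<Longrightarrow> mt s \<in> mats"
  using mt_bij by (auto simp: bij_betw_def)

lemma pt_points: "f \<in> mats \<Longrightarrow> pt f \<in> points S"
  and mt_pt: "f \<in> mats \<Longrightarrow> mt (pt f) = f"
  and pt_mt: "s \<in> points S \<Longrightarrow> pt (mt s) = s"
  using mt_bij by (auto simp: bij_betw_def pt_def inv_into_into f_inv_into_f)

text \<open>
  The action of maps of the indices on points.
\<close>

definition act :: "(nat \<Rightarrow> nat) \<Rightarrow> 's \<Rightarrow> 's" where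
  "act \<tau> s = pt (reind (mt s) \<tau>)"

lemma index_maps:
  assumes "i < n" "j < n"
  shows "id(i := j) ` {..<n} \<subseteq> {..<n}" "transpose i j ` {..<n} \<subseteq> {..<n}"
  using assms by (auto simp: transpose_def)

lemma act_closed:
  assumes "\<tau> ` {..<n} \<subseteq> {..<n}" "s \<in> points S"
  shows "act \<tau> s \<in> points S" "mt (act \<tau> s) = reind (mt s) \<tau>"
  using mats_reind[OF mt_mats[OF assms(2)] assms(1)] by (auto simp: act_def pt_points mt_pt)

lemma act_act:
  assumes "\<tau> ` {..<n} \<subseteq> {..<n}" "\<rho> ` {..<n} \<subseteq> {..<n}" "s \<in> points S"
  shows "act \<rho> (act \<tau> s) = act (\<tau> \<circ> \<rho>) s"
proof -
  have "\<rho> x < n" if "x < n" for x using assms(2) that by auto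
  then have "reind (reind (mt s) \<tau>) \<rho> = reind (mt s) (\<tau> \<circ> \<rho>)"
    by (intro ext) (auto simp: reind_def)
  then show ?thesis using act_closed(2)[OF assms(1,3)] by (simp add: act_def)
qed

lemma act_id: "s \<in> points S \<Longrightarrow> act id s = s"
proof -
  assume s: "s \<in> points S"
  have "reind (mt s) id = mt s"
    using netD(2)[OF mats_net[OF mt_mats[OF s]]] by (intro ext) (auto simp: reind_def)
  then show ?thesis using s by (simp add: act_def pt_mt)
qed

lemma Cm_ops:
  assumes "i < n" "j < n" "X \<subseteq> points S"
  shows "oper (Cm S) (Cyl i) [X] = {s \<in> points S. \<exists>t\<in>X. agree {i} (mt s) (mt t)}"
    "oper (Cm S) (Diag i j) [] = {s \<in> points S. mt s i j = 0}"
    "oper (Cm S) (Repl i j) [X] = {s \<in> points S. act (id(i := j)) s \<in> X}"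
    "oper (Cm S) (Swap i j) [X] = {s \<in> points S. act (transpose i j) s \<in> X}"
proof -
  have a: "t = act \<tau> s \<longleftrightarrow> mt t = reind (mt s) \<tau>"
    if "s \<in> points S" "t \<in> points S" "\<tau> ` {..<n} \<subseteq> {..<n}" for s t \<tau>
    using act_closed(2)[OF that(3,1)] pt_mt[OF that(2)] by (auto simp: act_def)
  show "oper (Cm S) (Cyl i) [X] = {s \<in> points S. \<exists>t\<in>X. agree {i} (mt s) (mt t)}"
    unfolding Cm_oper using rel_Cyl assms by blast
  show "oper (Cm S) (Diag i j) [] = {s \<in> points S. mt s i j = 0}"
    unfolding Cm_oper using rel_Diag assms by blast
  show "oper (Cm S) (Repl i j) [X] = {s \<in> points S. act (id(i := j)) s \<in> X}"
    unfolding Cm_oper using rel_Repl[OF assms(1,2)] a[OF _ _ index_maps(1)[OF assms(1,2)]] assms(3) by blast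
  show "oper (Cm S) (Swap i j) [X] = {s \<in> points S. act (transpose i j) s \<in> X}"
    unfolding Cm_oper using rel_Swap[OF assms(1,2)] a[OF _ _ index_maps(2)[OF assms(1,2)]] assms(3) by blast
qed

lemma Cm_op_Diag: "i < n \<Longrightarrow> j < n \<Longrightarrow> oper (Cm S) (Diag i j) [] = {s \<in> points S. mt s i j = 0}"
  using Cm_ops(2)[of i j "{}"] by simp

lemma agree_refl: "agree D f f"
  and agree_sym: "agree D f g \<Longrightarrow> agree D g f"
  and agree_trans: "agree D f g \<Longrightarrow> agree D g h \<Longrightarrow> agree D f h"
  by (simp_all add: agree_def)

lemma agree_reind: "agree {i} f (reind f (id(i := j)))"
  by (simp add: agree_def reind_def)

lemma reind_agree: "i \<noteq> j \<Longrightarrow> j < n \<Longrightarrow> agree {i} f g \<Longrightarrow> reind f (id(i := j)) = reind g (id(i := j))"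
  by (intro ext) (simp add: agree_def reind_def)

text \<open>
  The only axiom that needs amalgamation: for the direction from left to right, a change of index
  \<open>k\<close> of \<open>f \<circ> [i|j]\<close> has to be combined with the row \<open>i\<close> of \<open>f\<close>.
\<close>

lemma Cm_commute:
  assumes ijk: "i < n" "j < n" "k < n" "k \<noteq> i" "k \<noteq> j" and X: "X \<subseteq> points S" and s: "s \<in> points S"
  shows "(\<exists>t\<in>X. agree {k} (mt (act (id(i := j)) s)) (mt t))
    \<longleftrightarrow> (\<exists>u\<in>points S. act (id(i := j)) u \<in> X \<and> agree {k} (mt s) (mt u))"
proof
  note m = index_maps(1)[OF ijk(1,2)]
  assume "\<exists>u\<in>points S. act (id(i := j)) u \<in> X \<and> agree {k} (mt s) (mt u)"
  then obtain u where u: "u \<in> points S" "act (id(i := j)) u \<in> X" "agree {k} (mt s) (mt u)" by blast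
  then have "agree {k} (mt (act (id(i := j)) s)) (mt (act (id(i := j)) u))"
    using act_closed(2)[OF m s] act_closed(2)[OF m u(1)] ijk by (auto simp: agree_def reind_def)
  then show "\<exists>t\<in>X. agree {k} (mt (act (id(i := j)) s)) (mt t)" using u by blast
next
  note m = index_maps(1)[OF ijk(1,2)]
  assume "\<exists>t\<in>X. agree {k} (mt (act (id(i := j)) s)) (mt t)"
  then obtain t where t: "t \<in> X" "agree {k} (reind (mt s) (id(i := j))) (mt t)"
    unfolding act_closed(2)[OF m s] by blast
  have tS: "t \<in> points S" using t X by blast
  note nt = mats_net[OF mt_mats[OF tS]]
  show "\<exists>u\<in>points S. act (id(i := j)) u \<in> X \<and> agree {k} (mt s) (mt u)"
  proof (cases "i = j")
    case True
    have "id(i := j) = id" using True by auto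
    moreover from this have "agree {k} (mt s) (mt t)" using t(2) act_closed(2)[OF m s] act_id[OF s] by simp
    ultimately show ?thesis using t(1) tS act_id[OF tS] by (intro bexI[of _ t]) auto
  next
    case False
    have "mt s x y = mt t x y" if "x < n" "y < n" "x \<notin> {k, i}" "y \<notin> {k, i}" for x y
    proof -
      have "reind (mt s) (id(i := j)) x y = mt t x y" using t(2) that by (simp add: agree_def)
      then show ?thesis using that by (simp add: reind_def)
    qed
    then have "agree {k, i} (mt s) (mt t)" by (simp add: agree_def)
    then obtain h where h: "h \<in> mats" "agree {k} (mt s) h" "agree {i} (mt t) h"
      using mats_amalgamate[OF mt_mats[OF s] mt_mats[OF tS] ijk(3,1)] by blast
    have "reind (mt s) (id(i := j)) i j = mt t i j" using t(2) ijk unfolding agree_def by auto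
    then have ij: "mt t i j = 0" using netD(3)[OF mats_net[OF mt_mats[OF s]] ijk(2)] ijk(1,2) False
      by (simp add: reind_def)
    have "mt t = reind h (id(i := j))"
      by (rule agree_net_zero_row[OF mats_net[OF h(1)] nt ijk(1) agree_sym[OF h(3)] ijk(2) _ ij])
        (use False in auto)
    then have "act (id(i := j)) (pt h) = t"
      using h(1) tS by (simp add: act_def mt_pt pt_mt flip: \<open>mt t = _\<close>)
    then show ?thesis using h t(1) pt_points mt_pt by (intro bexI[of _ "pt h"]) auto
  qed
qed

lemma act_swap:
  assumes "i < n" "j < n" "s \<in> points S"
  shows "act (id(i := j)) (act (transpose i j) s) = act (id(j := i)) s"
    "act (transpose i j) (act (transpose i j) s) = s"
proof -
  have "transpose i j \<circ> id(i := j) = id(j := i)" by (auto simp: fun_eq_iff transpose_def)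
  then show "act (id(i := j)) (act (transpose i j) s) = act (id(j := i)) s"
    using assms by (simp add: act_act index_maps)
  show "act (transpose i j) (act (transpose i j) s) = s"
    using assms by (simp add: act_act index_maps act_id transpose_comp_involutory)
qed

lemma act_swap_swap:
  assumes "i < n" "j < n" "k < n" "i \<noteq> j" "i \<noteq> k" "j \<noteq> k" "s \<in> points S"
  shows "act (transpose i k) (act (transpose i j) s) = act (transpose i j) (act (transpose j k) s)"
proof -
  have "transpose i j \<circ> transpose i k = transpose j k \<circ> transpose i j"
    using assms by (auto simp: fun_eq_iff transpose_def)
  then show ?thesis using assms by (simp add: act_act index_maps)
qed

lemma act_diag:
  assumes "i < n" "j < n" "s \<in> points S"
  shows "mt s i j = 0 \<Longrightarrow> act (id(i := j)) s = s" "mt (act (id(i := j)) s) i j = 0"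
proof -
  show "act (id(i := j)) s = s" if "mt s i j = 0"
  proof (cases "i = j")
    case True
    then have "id(i := j) = id" by auto
    then show ?thesis using act_id[OF assms(3)] by simp
  next
    case False
    have nt: "net (mt s)" by (rule mats_net[OF mt_mats[OF assms(3)]])
    have "mt s = reind (mt s) (id(i := j))"
      by (rule agree_net_zero_row[OF nt nt assms(1) agree_refl assms(2) _ that]) (use False in simp)
    then show ?thesis using pt_mt[OF assms(3)] by (simp add: act_def)
  qed
  show "mt (act (id(i := j)) s) i j = 0"
    using act_closed(2)[OF index_maps(1)[OF assms(1,2)] assms(3)]
      netD(3)[OF mats_net[OF mt_mats[OF assms(3)]] assms(2)] assms by (auto simp: reind_def)
qed

lemma agree_act:
  assumes "i < n" "j < n" "s \<in> points S"
  shows "agree {i} (mt (act (id(i := j)) s)) g \<longleftrightarrow> agree {i} (mt s) g"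
  using act_closed(2)[OF index_maps(1)[OF assms(1,2)] assms(3)] agree_reind[of i "mt s" j] agree_sym agree_trans by metis

lemma act_agree:
  assumes "j < n" "i \<noteq> j" "agree {i} (mt s) (mt t)"
  shows "act (id(i := j)) s = act (id(i := j)) t"
  using reind_agree[OF assms(2,1,3)] by (simp add: act_def)

lemma PEA_Cm: "PEA n (Cm S)"
proof -
  have sub: "{s \<in> points S. P s} \<subseteq> points S" "points S - X \<subseteq> points S"
    "X \<subseteq> points S \<Longrightarrow> X \<inter> Y \<subseteq> points S" for P X Y by auto
  have idi: "id(i := i) = id" for i :: nat by auto
  have A: "act (id(i := j)) s \<in> points S" "act (transpose i j) s \<in> points S"
    if "i < n" "j < n" "s \<in> points S" for i j s
    using act_closed(1) index_maps that by auto
  have cyl_repl: "oper (Cm S) (Cyl i) [oper (Cm S) (Repl i j) [x]] = oper (Cm S) (Repl i j) [x]"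
    if "i < n" "j < n" "x \<subseteq> points S" "i \<noteq> j" for i j x
    using that by (auto simp: Cm_ops sub act_agree intro: agree_refl)
  have comm: "oper (Cm S) (Repl i j) [oper (Cm S) (Cyl k) [x]] = oper (Cm S) (Cyl k) [oper (Cm S) (Repl i j) [x]]"
    if "i < n" "j < n" "k < n" "k \<noteq> i" "k \<noteq> j" "x \<subseteq> points S" for i j k x
    using that A[OF that(1,2)] by (auto simp: Cm_ops sub) (use Cm_commute[OF that] in blast)+
  have swap_swap: "oper (Cm S) (Swap i j) [oper (Cm S) (Swap i k) [x]] = oper (Cm S) (Swap j k) [oper (Cm S) (Swap i j) [x]]"
    if "i < n" "j < n" "k < n" "i \<noteq> j" "i \<noteq> k" "j \<noteq> k" "x \<subseteq> points S" for i j k x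
    using act_swap_swap[OF that(1-6)] A that by (auto simp: Cm_ops sub)
  have "boolean (Cm S)" using boolean_subuniverse_Cm[of "Pow (points S)" S] by (simp add: Cm_univ)
  then show ?thesis
    unfolding PEA_def Let_def
  proof (intro conjI allI impI ballI algebra_Cm, goal_cases)
    case (12 i j x) then show ?case using cyl_repl[of i j x] by simp
  next
    case (13 i j x k) then show ?case using comm[of i j k x] by simp
  next
    case (17 i j x k) then show ?case using swap_swap[of i j k x] by simp
  qed (auto simp: Cm_ops Cm_op_Diag sub A act_id idi act_swap transpose_commute act_diag agree_act cyl_repl intro: agree_refl)
qed



section \<open>The term algebra is representable\<close>

text \<open>
  The approximations of a sequence of points are its generic matrices.
\<close>

definition gpt :: "nat \<Rightarrow> (nat \<Rightarrow> node) \<Rightarrow> 's" where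
  "gpt p s = pt (gen p (net_of s))"

lemma gpt:
  assumes "s \<in> seqs n base" "0 < p"
  shows "gpt p s \<in> points S" "mt (gpt p s) = gen p (net_of s)"
  using gen_mats[OF net_net_of[OF assms(1)] assms(2)] by (simp_all add: gpt_def pt_points mt_pt)

sublocale limit_points "points S" "\<lambda>k s t. sim k (mt s) (mt t)" "seqs n base" gpt
proof unfold_locales
  fix k :: nat and s :: "nat \<Rightarrow> node" assume s: "s \<in> seqs n base" and k: "0 < k"
  obtain B where B: "\<And>x y. net_of s x y < B * L" using net_bounded[OF net_net_of[OF s]] by metis
  have "sim k (mt (gpt p s)) (mt (gpt p' s))" if p: "max k B \<le> p" "max k B \<le> p'" for p p'
  proof -
    have pp: "0 < p" "0 < p'" "k \<le> p" "k \<le> p'" "B \<le> p" "B \<le> p'" using p k by auto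
    show ?thesis
      unfolding gpt(2)[OF s pp(1)] gpt(2)[OF s pp(2)]
      by (rule gen_sim[OF net_net_of[OF s] k pp(3,4) bound_mono[OF B pp(5)] bound_mono[OF B pp(6)]])
  qed
  then show "\<exists>B. \<forall>p\<ge>B. \<forall>p'\<ge>B. sim k (mt (gpt p s)) (mt (gpt p' s))" by blast
qed (auto intro: sim_sym sim_mono gpt(1))

lemma invs_act:
  assumes "X \<in> invs" "\<tau> ` {..<n} \<subseteq> {..<n}"
  shows "{s \<in> points S. act \<tau> s \<in> X} \<in> invs"
proof -
  from assms(1) obtain k where k: "0 < k"
    "\<And>s t. s \<in> points S \<Longrightarrow> t \<in> points S \<Longrightarrow> sim k (mt s) (mt t) \<Longrightarrow> s \<in> X \<longleftrightarrow> t \<in> X"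
    by (rule invsE) blast
  show ?thesis
  proof (rule invsI[OF k(1)])
    fix s t assume st: "s \<in> points S" "t \<in> points S" "sim k (mt s) (mt t)" "s \<in> {s \<in> points S. act \<tau> s \<in> X}"
    have "sim k (mt (act \<tau> s)) (mt (act \<tau> t))"
      unfolding act_closed(2)[OF assms(2) st(1)] act_closed(2)[OF assms(2) st(2)] by (rule sim_reind[OF st(3) assms(2)])
    then have "act \<tau> t \<in> X" using k(2)[OF act_closed(1)[OF assms(2) st(1)] act_closed(1)[OF assms(2) st(2)]] st(4) by blast
    then show "t \<in> {s \<in> points S. act \<tau> s \<in> X}" using st by blast
  qed auto
qed

lemma invs_Cyl:
  assumes "X \<in> invs" "i < n"
  shows "{s \<in> points S. \<exists>t\<in>X. agree {i} (mt s) (mt t)} \<in> invs"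
proof -
  from assms(1) obtain k where k: "0 < k" "X \<subseteq> points S"
    "\<And>s t. s \<in> points S \<Longrightarrow> t \<in> points S \<Longrightarrow> sim k (mt s) (mt t) \<Longrightarrow> s \<in> X \<longleftrightarrow> t \<in> X"
    by (rule invsE) blast
  show ?thesis
  proof (rule invsI[OF k(1)])
    fix s t assume st: "s \<in> points S" "t \<in> points S" "sim k (mt s) (mt t)"
      "s \<in> {s \<in> points S. \<exists>t\<in>X. agree {i} (mt s) (mt t)}"
    then obtain u where u: "u \<in> X" "agree {i} (mt s) (mt u)" by blast
    have uS: "u \<in> points S" using u k by blast
    obtain g where g: "g \<in> mats" "agree {i} (mt t) g" "sim k (mt u) g"
      using sim_extend[OF mt_mats[OF st(1)] mt_mats[OF st(2)] mt_mats[OF uS] st(3) k(1) assms(2) u(2)] by blast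
    then have "pt g \<in> X" using k(3)[OF uS pt_points[OF g(1)]] u(1) by (simp add: mt_pt)
    then show "t \<in> {s \<in> points S. \<exists>t\<in>X. agree {i} (mt s) (mt t)}"
      using g st mt_pt by (auto intro!: bexI[of _ "pt g"])
  qed auto
qed

lemma invs_Diag:
  assumes "i < n" "j < n"
  shows "{s \<in> points S. mt s i j = 0} \<in> invs"
proof (rule invsI[of 1])
  fix s t assume "s \<in> points S" "t \<in> points S" "sim 1 (mt s) (mt t)" "s \<in> {s \<in> points S. mt s i j = 0}"
  then show "t \<in> {s \<in> points S. mt s i j = 0}" using sim_zero[of 1 "mt s" "mt t" i j] assms by simp
qed auto

lemma invs_singleton:
  assumes "s \<in> points S"
  shows "{s} \<in> invs"
proof -
  obtain B where B: "\<And>x y. mt s x y < B * L" "0 < B"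
    using net_bounded[OF mats_net[OF mt_mats[OF assms]]] by blast
  show ?thesis
  proof (rule invsI[OF B(2)])
    fix s' t assume t: "t \<in> points S" "sim B (mt s') (mt t)" "s' \<in> {s}"
    then have "mt s = mt t"
      using simD(1)[of B "mt s" "mt t"] B(1) assms
      by (intro net_eqI mats_net mt_mats) auto
    then have "s = t" using pt_mt[OF assms] pt_mt[OF t(1)] by metis
    then show "t \<in> {s}" by simp
  qed (use assms in auto)
qed

lemma subuniverse_invs: "subuniverse (pea_sig n UNIV) (Cm S) invs"
proof -
  have "oper (Cm S) f Xs \<in> invs"
    if f: "pea_sig n UNIV f = Some k" "length Xs = k" "set Xs \<subseteq> invs" for f k Xs
  proof -
    note sub = invs_subset
    show ?thesis
      using f sub invs_Cyl invs_Diag invs_act index_maps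
      by (cases rule: pea_argsE[OF f(1,2)]) (simp_all add: Cm_ops Cm_op_Diag)
  qed
  moreover have "invs \<subseteq> Pow (points S)" using invs_subset by blast
  ultimately show ?thesis
    unfolding subuniverse_def using invs_bounds invs_compl invs_Int invs_Un by simp
qed

lemma lim_Diag:
  assumes "i < n" "j < n"
  shows "lim {s \<in> points S. mt s i j = 0} = {s \<in> seqs n base. s i = s j}"
proof -
  have "s \<in> lim {s \<in> points S. mt s i j = 0} \<longleftrightarrow> s i = s j" if s: "s \<in> seqs n base" for s
  proof -
    obtain p where p: "0 < p" "gpt p s \<in> {s \<in> points S. mt s i j = 0} \<longleftrightarrow> s \<in> lim {s \<in> points S. mt s i j = 0}"
      using lim_iff[OF invs_Diag[OF assms] s] by blast
    have "mt (gpt p s) i j = 0 \<longleftrightarrow> net_of s i j = 0" using gpt(2)[OF s p(1)] gen_0[OF p(1)] by simp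
    also have "\<dots> \<longleftrightarrow> s i = s j"
      using lam_props(1)[OF seqsD[OF s assms(1)] seqsD[OF s assms(2)]] assms by (simp add: net_of_def)
    finally show ?thesis using p gpt(1)[OF s p(1)] by simp
  qed
  then show ?thesis using lim_subset by blast
qed

lemma seqs_comp:
  assumes "s \<in> seqs n V" "\<tau> ` {..<n} \<subseteq> {..<n}" "\<And>x. \<not> x < n \<Longrightarrow> \<tau> x = x"
  shows "s \<circ> \<tau> \<in> seqs n V"
  using assms by (auto simp: seqs_def PiE_iff extensional_def)

lemma lim_act:
  assumes X: "X \<in> invs" and \<tau>: "\<tau> ` {..<n} \<subseteq> {..<n}" "\<And>x. \<not> x < n \<Longrightarrow> \<tau> x = x"
  shows "lim {s \<in> points S. act \<tau> s \<in> X} = {s \<in> seqs n base. s \<circ> \<tau> \<in> lim X}"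
proof -
  let ?Y = "{s \<in> points S. act \<tau> s \<in> X}"
  have Y: "?Y \<in> invs" by (rule invs_act[OF X \<tau>(1)])
  from X obtain k where k: "0 < k"
    "\<And>s t. s \<in> points S \<Longrightarrow> t \<in> points S \<Longrightarrow> sim k (mt s) (mt t) \<Longrightarrow> s \<in> X \<longleftrightarrow> t \<in> X"
    by (rule invsE) blast
  have "s \<in> lim ?Y \<longleftrightarrow> s \<circ> \<tau> \<in> lim X" if s: "s \<in> seqs n base" for s
  proof -
    have st: "s \<circ> \<tau> \<in> seqs n base" by (rule seqs_comp[OF s \<tau>])
    have "\<tau> x < n" if "x < n" for x using \<tau> that by auto
    then have nt: "net_of (s \<circ> \<tau>) = reind (net_of s) \<tau>"
      by (intro ext) (auto simp: net_of_def reind_def)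
    obtain B where B: "\<And>p. B \<le> p \<Longrightarrow> gpt p s \<in> ?Y \<longleftrightarrow> s \<in> lim ?Y" using lim_iff[OF Y s] by blast
    obtain C where C: "\<And>p. C \<le> p \<Longrightarrow> gpt p (s \<circ> \<tau>) \<in> X \<longleftrightarrow> s \<circ> \<tau> \<in> lim X" using lim_iff[OF X st] by blast
    define p where "p = max k (max B C)"
    have p: "0 < p" "k \<le> p" "B \<le> p" "C \<le> p" using k by (auto simp: p_def)
    have "sim k (mt (gpt p (s \<circ> \<tau>))) (mt (act \<tau> (gpt p s)))"
      unfolding act_closed(2)[OF \<tau>(1) gpt(1)[OF s p(1)]] gpt(2)[OF s p(1)] gpt(2)[OF st p(1)] nt
      using net_net_of[OF s] \<tau>(1) p(2) by (rule gen_reind_sim)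
    then have "gpt p (s \<circ> \<tau>) \<in> X \<longleftrightarrow> act \<tau> (gpt p s) \<in> X"
      by (intro k(2) gpt(1) act_closed(1) st s p(1) \<tau>(1))
    then show ?thesis using B[OF p(3)] C[OF p(4)] gpt(1)[OF s p(1)] by blast
  qed
  then show ?thesis using lim_subset by blast
qed

text \<open>
  A change of row \<open>i\<close> that leads from a matrix approximating \<open>s\<close> into \<open>X\<close>
  is turned into a change of one point of \<open>s\<close> by blurring the generic block and extending the base.
\<close>

lemma lim_Cyl:
  assumes X: "X \<in> invs" and i: "i < n"
  shows "lim {s \<in> points S. \<exists>t\<in>X. agree {i} (mt s) (mt t)}
    = {s \<in> seqs n base. \<exists>t\<in>lim X. \<forall>j<n. j \<noteq> i \<longrightarrow> t j = s j}" (is "lim ?Y = _")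
proof -
  have Y: "?Y \<in> invs" by (rule invs_Cyl[OF X i])
  from X obtain k where k: "0 < k" "X \<subseteq> points S"
    "\<And>s t. s \<in> points S \<Longrightarrow> t \<in> points S \<Longrightarrow> sim k (mt s) (mt t) \<Longrightarrow> s \<in> X \<longleftrightarrow> t \<in> X"
    by (rule invsE) blast
  have "s \<in> lim ?Y \<longleftrightarrow> (\<exists>t\<in>lim X. \<forall>j<n. j \<noteq> i \<longrightarrow> t j = s j)" if s: "s \<in> seqs n base" for s
  proof
    have ns: "net (net_of s)" by (rule net_net_of[OF s])
    obtain B where B: "\<And>p. B \<le> p \<Longrightarrow> gpt p s \<in> ?Y \<longleftrightarrow> s \<in> lim ?Y" using lim_iff[OF Y s] by blast
    obtain C where C: "\<And>x y. net_of s x y < C * L" using net_bounded[OF ns] by metis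
    {
      assume "s \<in> lim ?Y"
      define p where "p = max k (max B C)"
      have p: "0 < p" "k \<le> p" "B \<le> p" "C \<le> p" using k by (auto simp: p_def)
      have b: "net_of s x y < p * L" for x y by (rule bound_mono[OF C p(4)])
      have "gpt p s \<in> ?Y" using B[OF p(3)] \<open>s \<in> lim ?Y\<close> by simp
      then obtain t where t: "t \<in> X" "agree {i} (gen p (net_of s)) (mt t)" using gpt(2)[OF s p(1)] by auto
      have tS: "t \<in> points S" using t k by blast
      let ?g = "\<lambda>x y. blur p (mt t x y)"
      have ng: "net ?g" by (rule net_blur[OF mats_net[OF mt_mats[OF tS]] p(1)])
      have "agree {i} (\<lambda>x y. blur p (gen p (net_of s) x y)) ?g" using t(2) by (simp add: agree_def)
      then have "agree {i} (net_of s) ?g" using blur_gen[OF ns p(1) b] by simp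
      then obtain u where u: "u \<in> base" "net_of (s(i := u)) = ?g" using seq_extend[OF s ng i] by blast
      have su: "s(i := u) \<in> seqs n base" by (rule seqs_upd[OF s i u(1)])
      obtain D where D: "\<And>x y. mt t x y < D * L" using net_bounded[OF mats_net[OF mt_mats[OF tS]]] by metis
      obtain E where E: "0 < E" "\<And>p. E \<le> p \<Longrightarrow> gpt p (s(i := u)) \<in> X \<longleftrightarrow> s(i := u) \<in> lim X"
        using lim_iff[OF X su] by blast
      define p' where "p' = max k (max D E)"
      have p': "0 < p'" "k \<le> p'" "D \<le> p'" "E \<le> p'" using k by (auto simp: p'_def)
      have b': "mt t x y < p' * L" for x y by (rule bound_mono[OF D p'(3)])
      have "sim k (mt t) (mt (gpt p' (s(i := u))))"
        unfolding gpt(2)[OF su p'(1)] u(2) by (rule gen_blur_sim[OF mt_mats[OF tS] k(1) p(2) p'(2) b'])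
      then have "gpt p' (s(i := u)) \<in> X" using k(3)[OF tS gpt(1)[OF su p'(1)]] t(1) by blast
      then have "s(i := u) \<in> lim X" using E(2)[OF p'(4)] by blast
      then show "\<exists>t\<in>lim X. \<forall>j<n. j \<noteq> i \<longrightarrow> t j = s j" by (intro bexI[of _ "s(i := u)"]) auto
    }
    assume "\<exists>t\<in>lim X. \<forall>j<n. j \<noteq> i \<longrightarrow> t j = s j"
    then obtain t where t: "t \<in> lim X" "\<And>j. j < n \<Longrightarrow> j \<noteq> i \<Longrightarrow> t j = s j" by blast
    have tb: "t \<in> seqs n base" using t lim_subset by blast
    have nt: "net (net_of t)" by (rule net_net_of[OF tb])
    obtain E where E: "\<And>p. E \<le> p \<Longrightarrow> gpt p t \<in> X \<longleftrightarrow> t \<in> lim X" using lim_iff[OF X tb] by blast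
    define p where "p = max k (max B E)"
    have p: "0 < p" "k \<le> p" "B \<le> p" "E \<le> p" using k by (auto simp: p_def)
    have tX: "gpt p t \<in> X" using E[OF p(4)] t(1) by blast
    \<comment> \<open>The generic matrices of \<open>s\<close> and \<open>t\<close> need not agree off
      \<open>i\<close>, because representatives may be different. They are similar off \<open>i\<close>, which
      becomes similarity when row \<open>i\<close> is made a copy of row \<open>d\<close>.\<close>
    obtain d where d: "d < n" "d \<noteq> i" using n_gt_2 that[of 0] that[of 1] by (cases "i = 0") auto
    let ?\<tau> = "id(i := d)"
    have \<tau>: "?\<tau> ` {..<n} \<subseteq> {..<n}" using d by auto
    have "reind (net_of s) ?\<tau> = reind (net_of t) ?\<tau>"
      using t(2) d by (intro ext) (auto simp: reind_def net_of_def)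
    then have "sim k (reind (gen p (net_of t)) ?\<tau>) (reind (gen p (net_of s)) ?\<tau>)"
      using gen_reind_sim[OF ns \<tau> p(2)] gen_reind_sim[OF nt \<tau> p(2)] sim_sym sim_trans by metis
    moreover have "agree {i} (reind (gen p (net_of t)) ?\<tau>) (gen p (net_of t))"
      by (rule agree_sym[OF agree_reind])
    ultimately obtain g where g: "g \<in> mats" "agree {i} (reind (gen p (net_of s)) ?\<tau>) g" "sim k (gen p (net_of t)) g"
      using sim_extend[of "reind (gen p (net_of t)) ?\<tau>" "reind (gen p (net_of s)) ?\<tau>" "gen p (net_of t)" k i]
        mats_reind[OF gen_mats[OF ns p(1)] \<tau>] mats_reind[OF gen_mats[OF nt p(1)] \<tau>] gen_mats[OF nt p(1)] k(1) i
      by blast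
    have "pt g \<in> X"
      using k(3)[OF gpt(1)[OF tb p(1)] pt_points[OF g(1)]] tX g(3) gpt(2)[OF tb p(1)] mt_pt[OF g(1)] by simp
    moreover have "agree {i} (mt (gpt p s)) (mt (pt g))"
      using agree_trans[OF agree_reind g(2)] gpt(2)[OF s p(1)] mt_pt[OF g(1)] by simp
    ultimately have "gpt p s \<in> ?Y" using gpt(1)[OF s p(1)] by blast
    then show "s \<in> lim ?Y" using B[OF p(3)] by blast
  qed
  then show ?thesis using lim_subset by blast
qed

lemma is_hom_lim:
  assumes "T \<subseteq> invs"
  shows "is_hom (pea_sig n UNIV) lim ((Cm S)\<lparr>univ := T\<rparr>) (set_alg n base)"
proof -
  have sub: "X \<subseteq> points S" if "X \<in> T" for X using that assms invs_subset by blast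
  have "lim (oper (Cm S) f Xs) = set_op n base f (map lim Xs)"
    if f: "pea_sig n UNIV f = Some k" "length Xs = k" "set Xs \<subseteq> T" for f k Xs
    using f(1,2)
  proof (cases rule: pea_argsE)
    case (Cyl i X)
    then have "lim {s \<in> points S. \<exists>t\<in>X. agree {i} (mt s) (mt t)}
      = {s \<in> seqs n base. \<exists>t\<in>lim X. \<forall>j<n. j \<noteq> i \<longrightarrow> t j = s j}"
      using f(3) assms by (intro lim_Cyl) auto
    then show ?thesis using Cyl f(3) sub by (simp add: Cm_ops)
  next
    case (Diag i j)
    then show ?thesis using lim_Diag by (simp add: Cm_op_Diag)
  next
    case (Repl i j X)
    then have "lim {s \<in> points S. act (id(i := j)) s \<in> X} = {s \<in> seqs n base. s \<circ> id(i := j) \<in> lim X}"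
      using f(3) assms index_maps by (intro lim_act) auto
    then show ?thesis using Repl f(3) sub by (simp add: Cm_ops)
  next
    case (Swap i j X)
    then have "lim {s \<in> points S. act (transpose i j) s \<in> X} = {s \<in> seqs n base. s \<circ> transpose i j \<in> lim X}"
      using f(3) assms index_maps by (intro lim_act) (auto simp: transpose_def)
    then show ?thesis using Swap f(3) sub by (simp add: Cm_ops)
  qed
  then show ?thesis
    unfolding is_hom_def using assms lim_subset lim_empty lim_all lim_compl lim_Int lim_Un
    by (auto simp: set_alg_def subset_iff)
qed

lemma representable_Tm: "representable n (pea_sig n UNIV) (Tm (pea_sig n UNIV) S)"
proof (rule representable_of_hom)
  let ?T = "univ (Tm (pea_sig n UNIV) S)"
  have T: "?T \<subseteq> invs"
    by (rule univ_Tm_subset[OF subuniverse_invs invs_singleton])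
  have Tm: "Tm (pea_sig n UNIV) S = (Cm S)\<lparr>univ := ?T\<rparr>" by (simp add: Tm_def)
  have sT: "subuniverse (pea_sig n UNIV) (Cm S) ?T" by (rule subuniverse_Tm)
  show "0 < n" using n_gt_2 by simp
  show "algebra (pea_sig n UNIV) (Tm (pea_sig n UNIV) S)"
    by (subst Tm) (rule algebra_subuniverse[OF sT])
  show "is_hom (pea_sig n UNIV) lim (Tm (pea_sig n UNIV) S) (set_alg n base)"
    by (subst Tm) (rule is_hom_lim[OF T])
  show "inj_on lim ?T"
  proof (rule inj_on_lim[OF T sT refl])
    fix t assume t: "t \<in> points S"
    obtain s where s: "s \<in> seqs n base" "net_of s = mt t"
      using realize[OF mats_net[OF mt_mats[OF t]]] by blast
    have "gpt p s = t" for p using s(2) gen_std[OF mt_mats[OF t]] pt_mt[OF t] by (simp add: gpt_def)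
    then show "\<exists>w\<in>seqs n base. \<forall>p. gpt p w = t" using s(1) by blast
  qed
qed


section \<open>The complex algebra is not representable\<close>

text \<open>
  The matrices whose label between \<open>i\<close> and \<open>j\<close> is in \<open>A\<close>. The image of such a set
  under a representation depends on the coordinates \<open>i\<close> and \<open>j\<close> only, as the set
  is fixed by the other cylindrifications.
\<close>

definition entry :: "nat \<Rightarrow> nat \<Rightarrow> nat set \<Rightarrow> 's set" where
  "entry i j A = {s \<in> points S. mt s i j \<in> A}"

text \<open>
  The proof uses no operations but the Boolean ones and the cylindrifications. For each atom
  \<open>L + a\<close> a triple \<open>z a\<close>, \<open>v a\<close>, \<open>w a\<close> is chosen such that \<open>v a\<close> on
  coordinate \<open>1\<close> is related by this atom to a fixed point \<open>u\<close> on coordinate \<open>0\<close>,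
  while \<open>z a\<close> and \<open>w a\<close> are copies of \<open>v a\<close> on coordinates \<open>0\<close> and
  \<open>2\<close>, in the sense of the diagonal sets \<open>entry i j {0}\<close>. For \<open>a < b\<close> the pair
  of \<open>v a\<close> and \<open>w b\<close> has a label in some colour class; the copies turn a monochromatic
  \<open>a < b < c\<close> into a single sequence with \<open>z b\<close>, \<open>v a\<close>, \<open>w c\<close>, all of whose
  three labels are in the class.
\<close>

lemma not_representable_Cm: "\<not> representable n (pea_sig n F) (Cm S)"
proof
  assume rep: "representable n (pea_sig n F) (Cm S)"
  have n3: "0 < n" "1 < n" "2 < n" using n_gt_2 by auto
  have "(\<lambda>x y. 0) \<in> mats" by (simp add: mats_def net_def)
  then have ne: "points S \<noteq> {}" using pt_points by blast
  then obtain h and U :: "'s set list set"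
    where h: "is_hom (pea_sig n F) h (Cm S) (set_alg n U)" and U: "seqs n U \<noteq> {}"
    using representable_homE[OF rep algebra_Cm] by auto
  have h0: "h {} = {}" and h1: "h (points S) = seqs n U"
    and hU: "\<And>X Y. X \<subseteq> points S \<Longrightarrow> Y \<subseteq> points S \<Longrightarrow> h (X \<union> Y) = h X \<union> h Y"
    and hI: "\<And>X Y. X \<subseteq> points S \<Longrightarrow> Y \<subseteq> points S \<Longrightarrow> h (X \<inter> Y) = h X \<inter> h Y"
    and hsub: "\<And>X. X \<subseteq> points S \<Longrightarrow> h X \<subseteq> seqs n U"
    using h by (auto simp: is_hom_def set_alg_def)
  have hmono: "h X \<subseteq> h Y" if "X \<subseteq> Y" "Y \<subseteq> points S" for X Y
    using hU[of X Y] that by (metis Un_upper1 subset_Un_eq subset_trans)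
  have hc: "h {s \<in> points S. \<exists>t\<in>X. agree {i} (mt s) (mt t)} = {s \<in> seqs n U. \<exists>t\<in>h X. \<forall>j<n. j \<noteq> i \<longrightarrow> t j = s j}"
    if "i < n" "X \<subseteq> points S" for i X
  proof -
    have "pea_sig n F (Cyl i) = Some 1 \<and> length [X] = 1 \<and> set [X] \<subseteq> univ (Cm S)" using that by simp
    then have "h (oper (Cm S) (Cyl i) [X]) = oper (set_alg n U) (Cyl i) (map h [X])"
      using h unfolding is_hom_def by blast
    then show ?thesis using that by (simp add: Cm_ops set_alg_def)
  qed
  have esub: "entry i j A \<subseteq> points S" for i j A by (auto simp: entry_def)
  have upd: "s(k := v) \<in> h (entry i j A)"
    if "s \<in> h (entry i j A)" "k < n" "i < n" "j < n" "k \<noteq> i" "k \<noteq> j" "v \<in> U" for s k v i j A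
  proof -
    have "{s \<in> points S. \<exists>t\<in>entry i j A. agree {k} (mt s) (mt t)} = entry i j A"
      using that(2-6) agree_refl by (auto simp: entry_def agree_def)
    then have "h (entry i j A) = {s \<in> seqs n U. \<exists>t\<in>h (entry i j A). \<forall>j<n. j \<noteq> k \<longrightarrow> t j = s j}"
      using hc[OF that(2) esub[of i j A]] by simp
    moreover have "s(k := v) \<in> seqs n U" using seqs_upd[OF _ that(2,7)] hsub[OF esub] that(1) by blast
    then have "s(k := v) \<in> {s \<in> seqs n U. \<exists>t\<in>h (entry i j A). \<forall>j<n. j \<noteq> k \<longrightarrow> t j = s j}"
      using that(1) by auto
    ultimately show ?thesis by blast
  qed
  have wit: "\<exists>v\<in>U. s(i := v) \<in> h X"
    if "s \<in> h Y" "i < n" "X \<subseteq> points S" "Y \<subseteq> {s \<in> points S. \<exists>t\<in>X. agree {i} (mt s) (mt t)}" for s i X Y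
  proof -
    have "s \<in> h {s \<in> points S. \<exists>t\<in>X. agree {i} (mt s) (mt t)}" using hmono[OF that(4)] that(1) by blast
    then have "s \<in> seqs n U \<and> (\<exists>t\<in>h X. \<forall>j<n. j \<noteq> i \<longrightarrow> t j = s j)"
      unfolding hc[OF that(2,3)] by blast
    then obtain t where t: "s \<in> seqs n U" "t \<in> h X" "\<And>j. j < n \<Longrightarrow> j \<noteq> i \<Longrightarrow> t j = s j"
      by blast
    have tU: "t \<in> seqs n U" using hsub[OF that(3)] t(2) by blast
    have "s(i := t i) = t"
      using t tU that(2) by (intro seqs_eqI[of _ U] seqs_upd[OF t(1) that(2)] seqsD[OF tU]) auto
    then show ?thesis using t(2) seqsD[OF tU that(2)] by metis
  qed
  have net: "net (mt s)" if "s \<in> points S" for s using that by (intro mats_net mt_mats)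
  have sym: "mt s x y = mt s y x" if "s \<in> points S" for s x y using netD(5)[OF net[OF that]] .
  obtain s0 where s0: "s0 \<in> seqs n U" using U by blast
  define Q where "Q z v w = s0(0 := z, 1 := v, 2 := w)" for z v w
  have Q0: "Q z v w \<in> h (entry 1 2 A) \<Longrightarrow> z' \<in> U \<Longrightarrow> Q z' v w \<in> h (entry 1 2 A)" for z z' v w A
    using upd[of "Q z v w" 1 2 A 0 z'] n3 by (simp add: Q_def fun_upd_twist)
  have Q1: "Q z v w \<in> h (entry 0 2 A) \<Longrightarrow> v' \<in> U \<Longrightarrow> Q z v' w \<in> h (entry 0 2 A)" for z v v' w A
    using upd[of "Q z v w" 0 2 A 1 v'] n3 by (simp add: Q_def fun_upd_twist)
  have Q2: "Q z v w \<in> h (entry 0 1 A) \<Longrightarrow> w' \<in> U \<Longrightarrow> Q z v w' \<in> h (entry 0 1 A)" for z v w w' A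
    using upd[of "Q z v w" 0 1 A 2 w'] n3 by (simp add: Q_def)
  define u where "u = s0 0"
  have u: "u \<in> U" using seqsD[OF s0 n3(1)] by (simp add: u_def)
  have "\<exists>v w z. v \<in> U \<and> w \<in> U \<and> z \<in> U \<and> Q u v w \<in> h (entry 0 1 {L + a}) \<and> Q u v w \<in> h (entry 1 2 {0})
      \<and> Q z v w \<in> h (entry 0 1 {0}) \<and> Q z v w \<in> h (entry 0 2 {0})" for a
  proof -
    have "points S \<subseteq> {s \<in> points S. \<exists>t\<in>entry 0 1 {L + a}. agree {1} (mt s) (mt t)}"
    proof
      fix s assume s: "s \<in> points S"
      obtain g where g: "g \<in> mats" "agree {1} (mt s) g" "g 0 1 = L + a"
      proof (rule mats_extend[OF mt_mats[OF s] n3(2), of "{0}" "\<lambda>_. L + a"])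
        show "tri (L + a) (L + a) (mt s d d')" if "d \<in> {0}" "d' \<in> {0}" for d d'
          using netD(3)[OF net[OF s] n3(1)] that by simp
      qed (use n3 in \<open>auto simp: std_def\<close>)
      then have "pt g \<in> entry 0 1 {L + a}" "agree {1} (mt s) (mt (pt g))"
        by (simp_all add: entry_def mt_pt pt_points)
      then show "s \<in> {s \<in> points S. \<exists>t\<in>entry 0 1 {L + a}. agree {1} (mt s) (mt t)}" using s by blast
    qed
    then obtain v where v: "v \<in> U" "s0(1 := v) \<in> h (entry 0 1 {L + a})"
      using wit[of s0 "points S" 1 "entry 0 1 {L + a}"] s0 h1 n3 esub by blast
    have v': "s0(1 := v) \<in> h (points S)" using seqs_upd[OF s0 n3(2) v(1)] h1 by simp
    have diag: "points S \<subseteq> {s \<in> points S. \<exists>t\<in>entry 1 2 {0}. agree {2} (mt s) (mt t)}"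
    proof
      fix s assume s: "s \<in> points S"
      have m: "id(2 := 1) ` {..<n} \<subseteq> {..<n}" using n3 by auto
      have "act (id(2 := 1)) s \<in> entry 1 2 {0}"
        using act_closed[OF m s] netD(3)[OF net[OF s] n3(2)] n3 by (simp add: entry_def reind_def)
      moreover have "agree {2} (mt s) (mt (act (id(2 := 1)) s))" using act_closed(2)[OF m s] agree_reind by simp
      ultimately show "s \<in> {s \<in> points S. \<exists>t\<in>entry 1 2 {0}. agree {2} (mt s) (mt t)}" using s by blast
    qed
    obtain w where w: "w \<in> U" "s0(1 := v, 2 := w) \<in> h (entry 1 2 {0})"
      using wit[OF v' n3(3) esub diag] by blast
    have diag2: "entry 1 2 {0} \<subseteq> {s \<in> points S. \<exists>t\<in>entry 0 1 {0} \<inter> entry 0 2 {0}. agree {0} (mt s) (mt t)}"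
    proof
      fix s assume "s \<in> entry 1 2 {0}"
      then have s: "s \<in> points S" "mt s 1 2 = 0" by (auto simp: entry_def)
      have m: "id(0 := 1) ` {..<n} \<subseteq> {..<n}" using n3 by auto
      have "act (id(0 := 1)) s \<in> entry 0 1 {0} \<inter> entry 0 2 {0}"
        using act_closed[OF m s(1)] netD(3)[OF net[OF s(1)] n3(2)] s n3 by (simp add: entry_def reind_def)
      moreover have "agree {0} (mt s) (mt (act (id(0 := 1)) s))" using act_closed(2)[OF m s(1)] agree_reind by simp
      ultimately show "s \<in> {s \<in> points S. \<exists>t\<in>entry 0 1 {0} \<inter> entry 0 2 {0}. agree {0} (mt s) (mt t)}" using s by blast
    qed
    have "entry 0 1 {0} \<inter> entry 0 2 {0} \<subseteq> points S" by (rule le_infI1[OF esub])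
    from wit[OF w(2) n3(1) this diag2]
    obtain z where z: "z \<in> U" "s0(1 := v, 2 := w, 0 := z) \<in> h (entry 0 1 {0} \<inter> entry 0 2 {0})"
      by blast
    have "s0(1 := v, 2 := w) \<in> h (entry 0 1 {L + a})"
      using upd[OF v(2) n3(3,1,2) _ _ w(1)] by simp
    moreover have "s0(1 := v, 2 := w) = Q u v w" by (simp add: Q_def u_def)
    moreover have "s0(1 := v, 2 := w, 0 := z) = Q z v w" by (simp add: Q_def fun_upd_twist)
    moreover have "h (entry 0 1 {0} \<inter> entry 0 2 {0}) = h (entry 0 1 {0}) \<inter> h (entry 0 2 {0})"
      by (rule hI[OF esub esub])
    ultimately have "v \<in> U \<and> w \<in> U \<and> z \<in> U \<and> Q u v w \<in> h (entry 0 1 {L + a}) \<and> Q u v w \<in> h (entry 1 2 {0})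
      \<and> Q z v w \<in> h (entry 0 1 {0}) \<and> Q z v w \<in> h (entry 0 2 {0})"
      using v(1) w z by simp
    then show ?thesis by blast
  qed
  then obtain v w z where vU: "\<And>a. v a \<in> U" and wU: "\<And>a. w a \<in> U" and zU: "\<And>a. z a \<in> U"
    and vw: "\<And>a. Q u (v a) (w a) \<in> h (entry 0 1 {L + a})" "\<And>a. Q u (v a) (w a) \<in> h (entry 1 2 {0})"
    and zvw: "\<And>a. Q (z a) (v a) (w a) \<in> h (entry 0 1 {0})" "\<And>a. Q (z a) (v a) (w a) \<in> h (entry 0 2 {0})"
    by metis
  have combine: "s \<in> h (entry i' j' C)"
    if "s \<in> h (entry i j A)" "s \<in> h (entry k l B)" "entry i j A \<inter> entry k l B \<subseteq> entry i' j' C"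
    for s i j k l i' j' A B C
  proof -
    have "s \<in> h (entry i j A \<inter> entry k l B)" using hI[OF esub esub] that(1,2) by blast
    then show ?thesis using hmono[OF that(3) esub] by blast
  qed
  have d12: "entry 0 1 A \<inter> entry 1 2 {0} \<subseteq> entry 0 2 A" for A
  proof
    fix s assume "s \<in> entry 0 1 A \<inter> entry 1 2 {0}"
    then have s: "s \<in> points S" "mt s 0 1 \<in> A" "mt s 1 2 = 0" by (auto simp: entry_def)
    have "mt s 1 0 = mt s 2 0" by (rule net_zero[OF net[OF s(1)] n3(2,3,1) s(3)])
    then show "s \<in> entry 0 2 A" using s sym[OF s(1), of 1 0] sym[OF s(1), of 2 0] by (simp add: entry_def)
  qed
  have d02: "entry 1 2 A \<inter> entry 0 2 {0} \<subseteq> entry 0 1 A" for A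
  proof
    fix s assume "s \<in> entry 1 2 A \<inter> entry 0 2 {0}"
    then have s: "s \<in> points S" "mt s 1 2 \<in> A" "mt s 0 2 = 0" by (auto simp: entry_def)
    have "mt s 0 1 = mt s 2 1" by (rule net_zero[OF net[OF s(1)] n3(1,3,2) s(3)])
    then show "s \<in> entry 0 1 A" using s sym[OF s(1), of 2 1] by (simp add: entry_def)
  qed
  have d01: "entry 1 2 A \<inter> entry 0 1 {0} \<subseteq> entry 0 2 A" for A
  proof
    fix s assume "s \<in> entry 1 2 A \<inter> entry 0 1 {0}"
    then have s: "s \<in> points S" "mt s 1 2 \<in> A" "mt s 0 1 = 0" by (auto simp: entry_def)
    have "mt s 0 2 = mt s 1 2" by (rule net_zero[OF net[OF s(1)] n3(1,2,3) s(3)])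
    then show "s \<in> entry 0 2 A" using s by (simp add: entry_def)
  qed
  have QU: "Q z v w \<in> seqs n U" if "z \<in> U" "v \<in> U" "w \<in> U" for z v w
    unfolding Q_def using that s0 n3 by (intro seqs_upd) auto
  have distinct: "Q u (v a) (w b) \<notin> h (entry 1 2 {0})" if "a \<noteq> b" for a b
  proof
    assume "Q u (v a) (w b) \<in> h (entry 1 2 {0})"
    then have 1: "Q u (v a) (w b) \<in> h (entry 0 2 {L + a})"
      using combine[OF Q2[OF vw(1) wU] _ d12] by blast
    have "Q u (v b) (w b) \<in> h (entry 0 2 {L + b})" using combine[OF vw(1) vw(2) d12] by blast
    then have "Q u (v a) (w b) \<in> h (entry 0 2 {L + b})" using Q1 vU by blast
    with 1 have "Q u (v a) (w b) \<in> h (entry 0 2 {L + a} \<inter> entry 0 2 {L + b})"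
      using hI[OF esub esub] by blast
    moreover have "entry 0 2 {L + a} \<inter> entry 0 2 {L + b} = {}" using that by (auto simp: entry_def)
    ultimately show False using h0 by simp
  qed
  have "\<exists>c<L. Q u (v a) (w b) \<in> h (entry 1 2 (colour_class c))" if "a < b" for a b
    unfolding entry_def
  proof (rule colour_class_cover[where h = h])
    show "Q u (v a) (w b) \<in> h (points S)" using QU[OF u vU wU] h1 by simp
    show "Q u (v a) (w b) \<notin> h {s \<in> points S. mt s 1 2 \<in> {0}}"
      using distinct[of a b] that by (simp add: entry_def)
  qed (use mats_std[OF mt_mats] h0 hU in auto)
  then obtain col where col: "\<And>a b. a < b \<Longrightarrow> col a b < L" "\<And>a b. a < b \<Longrightarrow> Q u (v a) (w b) \<in> h (entry 1 2 (colour_class (col a b)))"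
    by metis
  obtain a b c where abc: "a < b" "b < c" "col a b = col b c" "col a b = col a c"
    using infinite_triangle[of col L] col(1) by blast
  define A where "A = colour_class (col a b)"
  have ab: "Q u (v a) (w b) \<in> h (entry 1 2 A)" and bc: "Q u (v b) (w c) \<in> h (entry 1 2 A)"
    and ac: "Q u (v a) (w c) \<in> h (entry 1 2 A)"
    using col(2)[of a b] col(2)[of b c] col(2)[of a c] abc by (simp_all add: A_def)
  have "Q (z b) (v a) (w b) \<in> h (entry 0 1 A)"
    using combine[OF Q0[OF ab zU] Q1[OF zvw(2) vU] d02] by blast
  then have 1: "Q (z b) (v a) (w c) \<in> h (entry 0 1 A)" using Q2 wU by blast
  have "Q (z b) (v b) (w c) \<in> h (entry 0 2 A)"
    using combine[OF Q0[OF bc zU] Q2[OF zvw(1) wU] d01] by blast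
  then have 2: "Q (z b) (v a) (w c) \<in> h (entry 0 2 A)" using Q1 vU by blast
  have 3: "Q (z b) (v a) (w c) \<in> h (entry 1 2 A)" using Q0[OF ac zU] .
  have "entry 0 1 A \<inter> entry 0 2 A \<inter> entry 1 2 A = {}"
  proof -
    have False if s: "s \<in> points S" "mt s 0 1 \<in> A" "mt s 0 2 \<in> A" "mt s 1 2 \<in> A" for s
      using netD(4)[OF net[OF s(1)] n3(1,2,3)] no_triangle s(2-4) unfolding A_def by blast
    then show ?thesis by (auto simp: entry_def)
  qed
  moreover have "Q (z b) (v a) (w c) \<in> h (entry 0 1 A \<inter> entry 0 2 A \<inter> entry 1 2 A)"
    using 1 2 3 hI[OF esub esub] hI[of "entry 0 1 A \<inter> entry 0 2 A" "entry 1 2 A"] esub by blast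
  ultimately show False using h0 by simp
qed

end

section \<open>Relation algebra atom structures\<close>

lemma RA_subuniverse:
  assumes "RA A" "subuniverse ra_sig A T"
  shows "RA (A\<lparr>univ := T\<rparr>)"
proof -
  have sub: "x \<in> univ A" if "x \<in> T" for x using assms(2) that by (auto simp: subuniverse_def)
  have "boolean (A\<lparr>univ := T\<rparr>)"
    using assms(1) sub unfolding RA_def boolean_def by simp
  moreover have "below (A\<lparr>univ := T\<rparr>) = below A" by (simp add: fun_eq_iff below_def)
  ultimately show ?thesis
    using assms(1) sub algebra_subuniverse[OF assms(2)] unfolding RA_def by simp
qed

lemma ra_argsE:
  assumes "ra_sig f = Some k" "length Xs = k"
  obtains (Ident) "f = Ident" "Xs = []"
    | (Conv) X where "f = Conv" "Xs = [X]"
    | (Comp) X Y where "f = Comp" "Xs = [X, Y]"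
  using assms by (cases f) (auto simp: ra_sig_def length_Suc_conv numeral_2_eq_2)

text \<open>
  A relation algebra atom structure isomorphic, by \<open>ct\<close>, to that of the standard labels with
  the consistent triangles.
\<close>

locale triangle_structure = dimension n for n :: nat +
  fixes S :: "(ra_op, 's) atom_structure" and ct :: "'s \<Rightarrow> nat"
  assumes ct_bij: "bij_betw ct (points S) std"
    and rel_Ident: "\<And>s. s \<in> points S \<Longrightarrow> rel S Ident s [] \<longleftrightarrow> ct s = 0"
    and rel_Conv: "\<And>s t. s \<in> points S \<Longrightarrow> t \<in> points S \<Longrightarrow> rel S Conv s [t] \<longleftrightarrow> ct s = ct t"
    and rel_Comp: "\<And>s t u. s \<in> points S \<Longrightarrow> t \<in> points S \<Longrightarrow> u \<in> points S
      \<Longrightarrow> rel S Comp s [t, u] \<longleftrightarrow> tri (ct t) (ct u) (ct s)"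
begin

definition cpt :: "nat \<Rightarrow> 's" where
  "cpt = inv_into (points S) ct"

lemma ct_std: "s \<in> points S \<Longrightarrow> ct s \<in> std"
  using ct_bij by (auto simp: bij_betw_def)

lemma cpt_points: "m \<in> std \<Longrightarrow> cpt m \<in> points S"
  and ct_cpt: "m \<in> std \<Longrightarrow> ct (cpt m) = m"
  and cpt_ct: "s \<in> points S \<Longrightarrow> cpt (ct s) = s"
  using ct_bij by (auto simp: bij_betw_def cpt_def inv_into_into f_inv_into_f)

lemma ct_eq_iff: "s \<in> points S \<Longrightarrow> t \<in> points S \<Longrightarrow> ct s = ct t \<longleftrightarrow> s = t"
  using cpt_ct by metis

lemma ra_ops:
  "ident (Cm S) = {s \<in> points S. ct s = 0}"
  "X \<subseteq> points S \<Longrightarrow> conv (Cm S) X = X"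
  "X \<subseteq> points S \<Longrightarrow> Y \<subseteq> points S
    \<Longrightarrow> comp (Cm S) X Y = {s \<in> points S. \<exists>t\<in>X. \<exists>u\<in>Y. tri (ct t) (ct u) (ct s)}"
proof -
  show "ident (Cm S) = {s \<in> points S. ct s = 0}" unfolding Cm_oper using rel_Ident by blast
  show "conv (Cm S) X = X" if "X \<subseteq> points S"
  proof -
    have "rel S Conv s [t] \<longleftrightarrow> s = t" if "s \<in> points S" "t \<in> X" for s t
      using rel_Conv[of s t] ct_eq_iff[of s t] that \<open>X \<subseteq> points S\<close> by blast
    then show ?thesis unfolding Cm_oper using that by blast
  qed
  show "comp (Cm S) X Y = {s \<in> points S. \<exists>t\<in>X. \<exists>u\<in>Y. tri (ct t) (ct u) (ct s)}"
    if "X \<subseteq> points S" "Y \<subseteq> points S"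
  proof -
    have "rel S Comp s [t, u] \<longleftrightarrow> tri (ct t) (ct u) (ct s)" if "s \<in> points S" "t \<in> X" "u \<in> Y" for s t u
      using rel_Comp that \<open>X \<subseteq> points S\<close> \<open>Y \<subseteq> points S\<close> by blast
    then show ?thesis unfolding Cm_oper by blast
  qed
qed

lemma comp_sub: "X \<subseteq> points S \<Longrightarrow> Y \<subseteq> points S \<Longrightarrow> comp (Cm S) X Y \<subseteq> points S"
  by (auto simp: ra_ops)

lemma comp_iff:
  assumes "X \<subseteq> points S" "Y \<subseteq> points S"
  shows "s \<in> comp (Cm S) X Y \<longleftrightarrow> s \<in> points S \<and> (\<exists>t\<in>X. \<exists>u\<in>Y. tri (ct t) (ct u) (ct s))"
  unfolding ra_ops(3)[OF assms] by blast

lemma comp_commute_sub: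
  assumes "X \<subseteq> points S" "Y \<subseteq> points S"
  shows "comp (Cm S) X Y \<subseteq> comp (Cm S) Y X"
  unfolding subset_iff comp_iff[OF assms] comp_iff[OF assms(2,1)] using tri_swapI by blast

lemma comp_commute:
  assumes "X \<subseteq> points S" "Y \<subseteq> points S"
  shows "comp (Cm S) X Y = comp (Cm S) Y X"
  using comp_commute_sub[OF assms] comp_commute_sub[OF assms(2,1)] by (rule subset_antisym)

lemma comp_assoc_sub:
  assumes "X \<subseteq> points S" "Y \<subseteq> points S" "Z \<subseteq> points S"
  shows "comp (Cm S) (comp (Cm S) X Y) Z \<subseteq> comp (Cm S) X (comp (Cm S) Y Z)"
proof
  fix s assume "s \<in> comp (Cm S) (comp (Cm S) X Y) Z"
  then obtain e c where ec: "s \<in> points S" "c \<in> Z" "tri (ct e) (ct c) (ct s)" "e \<in> comp (Cm S) X Y"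
    unfolding comp_iff[OF comp_sub[OF assms(1,2)] assms(3)] by blast
  then obtain a b where ab: "a \<in> X" "b \<in> Y" "tri (ct a) (ct b) (ct e)"
    unfolding comp_iff[OF assms(1,2)] by blast
  have p: "a \<in> points S" "b \<in> points S" "c \<in> points S" using ab ec assms by auto
  obtain e' where e': "e' \<in> std" "tri (ct b) (ct c) e'" "tri (ct a) e' (ct s)"
    using tri_assoc[OF ab(3) ec(3)] ct_std p ec(1) by blast
  have "cpt e' \<in> comp (Cm S) Y Z" "tri (ct a) (ct (cpt e')) (ct s)"
    unfolding comp_iff[OF assms(2,3)] ct_cpt[OF e'(1)] using e' ec ab cpt_points by auto
  then show "s \<in> comp (Cm S) X (comp (Cm S) Y Z)"
    unfolding comp_iff[OF assms(1) comp_sub[OF assms(2,3)]] using ec(1) ab(1) by blast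
qed

lemma comp_assoc:
  assumes "X \<subseteq> points S" "Y \<subseteq> points S" "Z \<subseteq> points S"
  shows "comp (Cm S) (comp (Cm S) X Y) Z = comp (Cm S) X (comp (Cm S) Y Z)"
proof
  have "comp (Cm S) X (comp (Cm S) Y Z) = comp (Cm S) (comp (Cm S) Z Y) X"
    using comp_commute[OF assms(1) comp_sub[OF assms(2,3)]] comp_commute[OF assms(2,3)] by simp
  also have "\<dots> \<subseteq> comp (Cm S) Z (comp (Cm S) Y X)" by (rule comp_assoc_sub[OF assms(3,2,1)])
  also have "\<dots> = comp (Cm S) (comp (Cm S) X Y) Z"
    using comp_commute[OF assms(3) comp_sub[OF assms(2,1)]] comp_commute[OF assms(1,2)] by simp
  finally show "comp (Cm S) X (comp (Cm S) Y Z) \<subseteq> comp (Cm S) (comp (Cm S) X Y) Z" .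
qed (rule comp_assoc_sub[OF assms])

lemma RA_Cm: "RA (Cm S)"
proof -
  have "comp (Cm S) X (ident (Cm S)) = X" if "X \<subseteq> points S" for X
  proof -
    have i: "{s \<in> points S. ct s = 0} \<subseteq> points S" by blast
    have "cpt 0 \<in> points S" "ct (cpt 0) = 0" by (simp_all add: cpt_points ct_cpt)
    then show ?thesis
      unfolding ra_ops(1) ra_ops(3)[OF that i] using that ct_eq_iff by (auto 0 4 simp: subset_iff)
  qed
  moreover have "comp (Cm S) X (points S - comp (Cm S) X Y) \<subseteq> points S - Y"
    if "X \<subseteq> points S" "Y \<subseteq> points S" for X Y
  proof
    have sub: "points S - comp (Cm S) X Y \<subseteq> points S" by blast
    fix s assume "s \<in> comp (Cm S) X (points S - comp (Cm S) X Y)"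
    with that(1) sub obtain t u where "s \<in> points S" "t \<in> X" "u \<in> points S" "u \<notin> comp (Cm S) X Y" "tri (ct t) (ct u) (ct s)"
      by (auto simp: comp_iff)
    then show "s \<in> points S - Y" using that by (auto simp: comp_iff dest: tri_flipI)
  qed
  moreover have "comp (Cm S) (X \<union> Y) Z = comp (Cm S) X Z \<union> comp (Cm S) Y Z"
    if "X \<subseteq> points S" "Y \<subseteq> points S" "Z \<subseteq> points S" for X Y Z
    using that by (auto simp: ra_ops)
  moreover have "boolean (Cm S)" using boolean_subuniverse_Cm[of "Pow (points S)" S] by (simp add: Cm_univ)
  moreover have "X \<inter> Y \<subseteq> points S" if "X \<subseteq> points S" for X Y using that by blast
  ultimately show ?thesis
    unfolding RA_def using comp_assoc comp_commute comp_sub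
    by (auto simp: algebra_Cm ra_ops(2))
qed


section \<open>The finite-cofinite algebra is representable\<close>

text \<open>
  The sets of atoms invariant under this relation at some level are those that contain finitely many
  or all but finitely many atoms of each colour.
\<close>

definition nsim :: "nat \<Rightarrow> nat \<Rightarrow> nat \<Rightarrow> bool" where
  "nsim k a b \<longleftrightarrow> a = b \<or> k * L \<le> a \<and> k * L \<le> b \<and> a mod N = b mod N"

lemma nsim_sym: "nsim k a b \<Longrightarrow> nsim k b a"
  by (auto simp: nsim_def)

lemma nsim_mono: "nsim k a b \<Longrightarrow> k' \<le> k \<Longrightarrow> nsim k' a b"
  using mult_right_mono[of k' k L] le_trans[of "k' * L" "k * L"] by (auto simp: nsim_def)

text \<open>
  The approximations of a pair of points; the place in block \<open>p\<close> does not matter for a single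
  label.
\<close>

definition gedge :: "nat \<Rightarrow> node \<Rightarrow> node \<Rightarrow> 's" where
  "gedge p u v = cpt (glab 0 p (lam u v))"

lemma gedge:
  assumes "0 < p"
  shows "gedge p u v \<in> points S" "ct (gedge p u v) = glab 0 p (lam u v)"
  using cpt_points ct_cpt glab_std[OF assms] by (simp_all add: gedge_def)

lemma glab_nsim: "k \<le> p \<Longrightarrow> k \<le> p' \<Longrightarrow> nsim k (glab q p l) (glab q' p' l)"
  using N_pos by (auto simp: nsim_def glab_def slot_ge slot_mod)

abbreviation edge :: "nat \<Rightarrow> node \<times> node \<Rightarrow> 's" where
  "edge p e \<equiv> gedge p (fst e) (snd e)"

sublocale limit_points "points S" "\<lambda>k s t. nsim k (ct s) (ct t)" "base \<times> base" edge
proof unfold_locales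
  fix k :: nat and e :: "node \<times> node" assume "0 < k"
  then have "\<forall>p\<ge>k. \<forall>p'\<ge>k. nsim k (ct (edge p e)) (ct (edge p' e))"
    using glab_nsim by (auto simp: gedge(2))
  then show "\<exists>B. \<forall>p\<ge>B. \<forall>p'\<ge>B. nsim k (ct (edge p e)) (ct (edge p' e))" by blast
qed (auto intro: nsim_sym nsim_mono gedge(1))

lemma invs_singleton:
  assumes "s \<in> points S"
  shows "{s} \<in> invs"
proof (rule invsI[of "Suc (ct s)"])
  fix s' t assume h: "s' \<in> points S" "t \<in> points S" "nsim (Suc (ct s)) (ct s') (ct t)" "s' \<in> {s}"
  have "\<not> Suc (ct s) * L \<le> ct s" using div_L_less[of "ct s" "Suc (ct s)"] div_le_dividend[of "ct s" L] by linarith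
  then have "ct s = ct t" using h by (auto simp: nsim_def)
  then show "t \<in> {s}" using ct_eq_iff h by simp
qed (use assms in auto)

lemma invs_ident: "{s \<in> points S. ct s = 0} \<in> invs"
  by (rule invsI[of 1]) (use L_pos in \<open>auto simp: nsim_def\<close>)

text \<open>
  The third side of a triangle can be replaced by a similar one if the other two may be replaced by
  similar ones. If one of these is beyond block \<open>k\<close>, it can be chosen adjacent to the new third
  side.
\<close>

lemma tri_move:
  assumes k: "0 < k" and t: "tri a b c" and std: "a \<in> std" "b \<in> std" "c \<in> std" "c' \<in> std" and c: "nsim k c c'"
  shows "\<exists>a'\<in>std. \<exists>b'\<in>std. tri a' b' c' \<and> nsim k a a' \<and> nsim k b b'"
proof (cases "c = c'")
  case True
  then show ?thesis using t std by (intro bexI[of _ a] bexI[of _ b]) (auto simp: nsim_def)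
next
  case ne: False
  then have cc: "k * L \<le> c" "k * L \<le> c'" "c mod N = c' mod N" using c by (auto simp: nsim_def)
  have kL: "0 < k * L" using k L_pos by simp
  have other: "\<exists>d\<in>std. d mod N = c' mod N \<and> k * L \<le> d \<and> d \<noteq> 0 \<and> adj d c'"
  proof -
    define q :: nat where "q = (if c' = slot (c' div L) 0 (c' mod N) then 1 else 0)"
    define d where "d = slot (c' div L) q (c' mod N)"
    have kp: "k \<le> c' div L" using cc by (simp add: div_L_ge)
    have q: "q < K" "c' mod N < N" using K_ge N_pos by (auto simp: q_def)
    have "d \<noteq> c'" using slot_div_N[OF q(1,2), of "c' div L"] slot_div_N[OF _ q(2), of 0 "c' div L"] K_ge
      by (auto simp: d_def q_def split: if_splits)
    then have "adj d c'" using slot_div[OF q] by (simp add: adj_def d_def)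
    moreover have "d mod N = c' mod N" using slot_mod[OF q(2)] by (simp add: d_def)
    moreover have "k * L \<le> d" unfolding d_def by (rule slot_ge[OF kp])
    moreover have "d \<in> std" unfolding d_def using kp k by (intro slot_std) simp
    moreover have "d \<noteq> 0" using \<open>k * L \<le> d\<close> kL by linarith
    ultimately show ?thesis by blast
  qed
  then obtain d where d: "d \<in> std" "d mod N = c' mod N" "k * L \<le> d" "d \<noteq> 0" "adj d c'" by blast
  have nc: "c' \<noteq> 0" "c \<noteq> 0" using cc kL by linarith+
  from t show ?thesis
  proof (cases rule: tri_cases)
    case 1
    then show ?thesis using std c by (intro bexI[of _ 0] bexI[of _ c']) (auto simp: nsim_def)
  next
    case 2
    then show ?thesis using std c by (intro bexI[of _ c'] bexI[of _ 0]) (auto simp: nsim_def)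
  next
    case 3
    then show ?thesis using nc by simp
  next
    case 4
    then have "tri a b c'" using nc cc(3) by (intro tri_colour) auto
    then show ?thesis using std by (intro bexI[of _ a] bexI[of _ b]) (auto simp: nsim_def)
  next
    case 5
    consider "adj a b" | "k * L \<le> a" | "k * L \<le> b"
    proof (cases "adj a b")
      case False
      then have "a div L = c div L \<or> b div L = c div L" using 5(6) False unfolding adj_def by blast
      moreover have "k \<le> c div L" using cc(1) by (simp add: div_L_ge)
      ultimately have "k \<le> a div L \<or> k \<le> b div L" by auto
      then have "k * L \<le> a \<or> k * L \<le> b" by (simp add: div_L_ge)
      then show ?thesis using that by blast
    qed
    then show ?thesis
    proof cases
      case 1
      then have "tri a b c'" using 5 nc by (intro tri_adj) auto
      then show ?thesis using std by (intro bexI[of _ a] bexI[of _ b]) (auto simp: nsim_def)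
    next
      case 2
      have "tri d b c'" using d nc 5 by (simp add: tri_def)
      then show ?thesis using d 2 std 5 cc by (intro bexI[of _ d] bexI[of _ b]) (auto simp: nsim_def)
    next
      case 3
      have "tri a d c'" using d nc 5 by (simp add: tri_def)
      then show ?thesis using d 3 std 5 cc by (intro bexI[of _ a] bexI[of _ d]) (auto simp: nsim_def)
    qed
  qed
qed

lemma invs_comp:
  assumes "X \<in> invs" "Y \<in> invs"
  shows "comp (Cm S) X Y \<in> invs"
proof -
  obtain k where k: "0 < k" "X \<subseteq> points S" "Y \<subseteq> points S"
    "\<And>s t. s \<in> points S \<Longrightarrow> t \<in> points S \<Longrightarrow> nsim k (ct s) (ct t) \<Longrightarrow> s \<in> X \<longleftrightarrow> t \<in> X"
    "\<And>s t. s \<in> points S \<Longrightarrow> t \<in> points S \<Longrightarrow> nsim k (ct s) (ct t) \<Longrightarrow> s \<in> Y \<longleftrightarrow> t \<in> Y"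
    by (rule invsE2[OF assms]) blast
  show ?thesis
  proof (rule invsI[OF k(1) comp_sub[OF k(2,3)]])
    fix s t assume st: "s \<in> points S" "t \<in> points S" "nsim k (ct s) (ct t)" "s \<in> comp (Cm S) X Y"
    then obtain a b where ab: "a \<in> X" "b \<in> Y" "tri (ct a) (ct b) (ct s)" by (auto simp: ra_ops(3)[OF k(2,3)])
    have p: "a \<in> points S" "b \<in> points S" using ab k by auto
    obtain a' b' where ab': "a' \<in> std" "b' \<in> std" "tri a' b' (ct t)" "nsim k (ct a) a'" "nsim k (ct b) b'"
      using tri_move[OF k(1) ab(3) _ _ _ _ st(3)] ct_std p st(1,2) by blast
    have "cpt a' \<in> X" "cpt b' \<in> Y" "tri (ct (cpt a')) (ct (cpt b')) (ct t)"
      using k(4)[OF p(1) cpt_points[OF ab'(1)]] k(5)[OF p(2) cpt_points[OF ab'(2)]] ab ab' ct_cpt by auto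
    then show "t \<in> comp (Cm S) X Y"
      unfolding comp_iff[OF k(2,3)] using st(2) by blast
  qed
qed

lemma subuniverse_invs: "subuniverse ra_sig (Cm S) invs"
proof -
  have "oper (Cm S) f Xs \<in> invs"
    if f: "ra_sig f = Some k" "length Xs = k" "set Xs \<subseteq> invs" for f k Xs
    using f(3) invs_subset invs_comp invs_ident
    by (cases rule: ra_argsE[OF f(1,2)]) (simp_all add: ra_ops(1,2))
  moreover have "invs \<subseteq> Pow (points S)" using invs_subset by blast
  ultimately show ?thesis
    unfolding subuniverse_def using invs_bounds invs_compl invs_Int invs_Un by simp
qed

lemma lim_ident: "lim {s \<in> points S. ct s = 0} = Id_on base"
proof -
  have "(u, v) \<in> lim {s \<in> points S. ct s = 0} \<longleftrightarrow> u = v" if uv: "u \<in> base" "v \<in> base" for u v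
  proof -
    obtain B where B: "0 < B" "gedge B u v \<in> {s \<in> points S. ct s = 0} \<longleftrightarrow> (u, v) \<in> lim {s \<in> points S. ct s = 0}"
      using lim_iff[OF invs_ident, of "(u, v)"] uv by auto
    have "ct (gedge B u v) = 0 \<longleftrightarrow> u = v"
      using gedge(2)[OF B(1)] glab_0[OF B(1)] lam_props(1)[OF uv] by simp
    then show ?thesis using B gedge(1)[OF B(1)] by simp
  qed
  then show ?thesis using lim_subset[of "{s \<in> points S. ct s = 0}"] by (auto simp: Id_on_iff subset_iff)
qed

lemma lim_conv: "(lim X)\<inverse> = lim X"
  unfolding limit_set_def gedge_def using lam_sym by (auto simp: converse_iff) metis+

lemma glab_blur_nsim:
  assumes "a \<in> std" "0 < k" "k \<le> p" "k \<le> p'"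
  shows "nsim k a (glab q p' (blur p a))"
proof (cases "a div L = p")
  case True
  then have "k * L \<le> a" using assms(3) div_L_ge[of k a] by simp
  then show ?thesis
    using True N_pos N_add_less_L[of a] slot_ge[OF assms(4)] by (auto simp: nsim_def glab_def blur_def slot_mod)
next
  case False
  then show ?thesis using assms(1) by (auto simp: nsim_def glab_def blur_def std_def)
qed

text \<open>
  The ideal sides of a triangle can be given different places in block \<open>p\<close> so that it remains
  consistent.
\<close>

lemma tri_glab:
  assumes "tri a b c" "0 < p"
  obtains q q' q'' where "tri (glab q p a) (glab q' p b) (glab q'' p c)"
  using assms(1)
proof (cases rule: tri_cases)
  case 1
  then show ?thesis using that[of 0 0 0] by simp
next
  case 2
  then show ?thesis using that[of 0 0 0] by simp
next
  case 3
  then show ?thesis using that[of 0 0 0] by simp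
next
  case 4
  then have "tri (glab 0 p a) (glab 0 p b) (glab 0 p c)"
    using glab_0[OF assms(2)] glab_mod by (intro tri_colour) auto
  then show ?thesis by (rule that)
next
  case 5
  have "adj (glab 0 p a) (glab 1 p b) \<or> adj (glab 1 p b) (glab 2 p c) \<or> adj (glab 0 p a) (glab 2 p c)"
    using 5 K_ge adj_glab[of a b 0 1 p] adj_glab[of b c 1 2 p] adj_glab[of a c 0 2 p] by auto
  then have "tri (glab 0 p a) (glab 1 p b) (glab 2 p c)"
    using 5(1-3) glab_0[OF assms(2)] by (simp add: tri_def)
  then show ?thesis by (rule that)
qed

text \<open>
  A triangle over the approximation of a pair is blurred and then realized by a point of the base.
  Here \<open>n > 2\<close> is used: the new point has two parents.
\<close>

lemma lim_comp:
  assumes "X \<in> invs" "Y \<in> invs"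
  shows "lim (comp (Cm S) X Y) = lim X O lim Y"
proof -
  note XY = invs_comp[OF assms]
  obtain k where k: "0 < k" "X \<subseteq> points S" "Y \<subseteq> points S"
    "\<And>s t. s \<in> points S \<Longrightarrow> t \<in> points S \<Longrightarrow> nsim k (ct s) (ct t) \<Longrightarrow> s \<in> X \<longleftrightarrow> t \<in> X"
    "\<And>s t. s \<in> points S \<Longrightarrow> t \<in> points S \<Longrightarrow> nsim k (ct s) (ct t) \<Longrightarrow> s \<in> Y \<longleftrightarrow> t \<in> Y"
    by (rule invsE2[OF assms]) blast
  note ops = ra_ops(3)[OF k(2,3)]
  have "(u, v) \<in> lim (comp (Cm S) X Y) \<longleftrightarrow> (\<exists>w. (u, w) \<in> lim X \<and> (w, v) \<in> lim Y)"
    if uv: "u \<in> base" "v \<in> base" for u v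
  proof
    obtain B where B: "\<And>p. B \<le> p \<Longrightarrow> gedge p u v \<in> comp (Cm S) X Y \<longleftrightarrow> (u, v) \<in> lim (comp (Cm S) X Y)"
      using lim_iff[OF XY, of "(u, v)"] uv by auto
    {
      assume "(u, v) \<in> lim (comp (Cm S) X Y)"
      define p where "p = max k (max B (Suc (lam u v)))"
      have p: "k \<le> p" "B \<le> p" "Suc (lam u v) \<le> p" "0 < p" using k by (auto simp: p_def)
      have "gedge p u v \<in> comp (Cm S) X Y" using B[OF p(2)] \<open>(u, v) \<in> _\<close> by blast
      then obtain a b where ab: "a \<in> X" "b \<in> Y" "tri (ct a) (ct b) (glab 0 p (lam u v))"
        unfolding ops using gedge(2)[OF p(4)] by auto
      have lp: "lam u v < p * L"
        using p(3) div_le_dividend[of "lam u v" L] div_L_less[of "lam u v" p] by linarith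
      have abp: "a \<in> points S" "b \<in> points S" using ab k by auto
      have "tri (blur p (ct a)) (blur p (ct b)) (lam u v)"
        using tri_blur[OF p(4) ab(3)] blur_glab[OF lam_props(2)[OF uv] p(4) lp] K_ge by simp
      note t = this tri_swapI[OF this]
      obtain w where w: "w \<in> base" "\<And>v' l. (v', l) \<in> set [(u, blur p (ct a)), (v, blur p (ct b))] \<Longrightarrow> lam w v' = l"
      proof (rule base_extend[of "[(u, blur p (ct a)), (v, blur p (ct b))]"])
        show "tri l l' (lam x x')"
          if "(x, l) \<in> set [(u, blur p (ct a)), (v, blur p (ct b))]" "(x', l') \<in> set [(u, blur p (ct a)), (v, blur p (ct b))]" for x l x' l'
          using that t lam_sym[of v u] by auto
      qed (use uv n_gt_2 blur_lab std_lab ct_std abp in auto)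
      have lw: "lam u w = blur p (ct a)" "lam w v = blur p (ct b)"
        using w(2)[of u] w(2)[of v] lam_sym[of u w] by auto
      have "gedge p' u w \<in> X" "gedge p' w v \<in> Y" if p': "k \<le> p'" for p'
      proof -
        have p0: "0 < p'" using k(1) p' by simp
        show "gedge p' u w \<in> X"
          using k(4)[OF abp(1) gedge(1)[OF p0]] gedge(2)[OF p0] lw(1) ab(1)
            glab_blur_nsim[OF ct_std[OF abp(1)] k(1) p(1) p'] by simp
        show "gedge p' w v \<in> Y"
          using k(5)[OF abp(2) gedge(1)[OF p0]] gedge(2)[OF p0] lw(2) ab(2)
            glab_blur_nsim[OF ct_std[OF abp(2)] k(1) p(1) p'] by simp
      qed
      then have "(u, w) \<in> lim X" "(w, v) \<in> lim Y" using uv w(1) unfolding limit_set_def by (auto intro!: exI[of _ k])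
      then show "\<exists>w. (u, w) \<in> lim X \<and> (w, v) \<in> lim Y" by blast
    }
    assume "\<exists>w. (u, w) \<in> lim X \<and> (w, v) \<in> lim Y"
    then obtain w where w: "(u, w) \<in> lim X" "(w, v) \<in> lim Y" by blast
    have wb: "w \<in> base" using w lim_subset by blast
    obtain C where C: "\<And>p. C \<le> p \<Longrightarrow> gedge p u w \<in> X" using w(1) unfolding limit_set_def by auto
    obtain D where D: "\<And>p. D \<le> p \<Longrightarrow> gedge p w v \<in> Y" using w(2) unfolding limit_set_def by auto
    obtain m where m: "0 < m" "\<And>s t. s \<in> points S \<Longrightarrow> t \<in> points S \<Longrightarrow> nsim m (ct s) (ct t)
        \<Longrightarrow> s \<in> comp (Cm S) X Y \<longleftrightarrow> t \<in> comp (Cm S) X Y"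
      using invsE[OF XY] by metis
    define p where "p = max m (max k (max B (max C D)))"
    have p: "k \<le> p" "B \<le> p" "C \<le> p" "D \<le> p" "0 < p" "m \<le> p" using k by (auto simp: p_def)
    obtain q q' q'' where t: "tri (glab q p (lam u w)) (glab q' p (lam w v)) (glab q'' p (lam u v))"
      using tri_glab[OF tri_lam[OF uv(1) wb uv(2)] p(5)] by blast
    have g: "cpt (glab q p l) \<in> points S" "ct (cpt (glab q p l)) = glab q p l" for q l
      using glab_std[OF p(5)] by (simp_all add: cpt_points ct_cpt)
    have "cpt (glab q p (lam u w)) \<in> X"
      using k(4)[OF gedge(1)[OF p(5), of u w] g(1)[of q "lam u w"]] C[OF p(3)] gedge(2)[OF p(5), of u w]
        g(2)[of q "lam u w"] glab_nsim[OF p(1,1), of 0 "lam u w" q] by simp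
    moreover have "cpt (glab q' p (lam w v)) \<in> Y"
      using k(5)[OF gedge(1)[OF p(5), of w v] g(1)[of q' "lam w v"]] D[OF p(4)] gedge(2)[OF p(5), of w v]
        g(2)[of q' "lam w v"] glab_nsim[OF p(1,1), of 0 "lam w v" q'] by simp
    ultimately have "cpt (glab q'' p (lam u v)) \<in> comp (Cm S) X Y"
      unfolding comp_iff[OF k(2,3)] g(2) using t g(1)
      by (intro conjI bexI[of _ "cpt (glab q p (lam u w))"] bexI[of _ "cpt (glab q' p (lam w v))"]) (simp_all add: g(2))
    then have "gedge p u v \<in> comp (Cm S) X Y"
      using m(2)[OF gedge(1)[OF p(5), of u v] g(1)[of q'' "lam u v"]] gedge(2)[OF p(5), of u v]
        g(2)[of q'' "lam u v"] glab_nsim[OF p(6,6), of 0 "lam u v" q''] by simp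
    then show "(u, v) \<in> lim (comp (Cm S) X Y)" using B[OF p(2)] by blast
  qed
  then show ?thesis using lim_subset by blast
qed

lemma RA_weakly_representable: "RA_weakly_representable S"
proof -
  have sub: "invs \<subseteq> Pow (points S)" using invs_subset by blast
  let ?A = "(Cm S)\<lparr>univ := invs\<rparr>"
  have "is_hom ra_sig lim ?A (rel_alg base)"
  proof -
    have "lim (oper (Cm S) f Xs) = rel_op base f (map lim Xs)"
      if f: "ra_sig f = Some k" "length Xs = k" "set Xs \<subseteq> invs" for f k Xs
      using f(3) invs_subset lim_comp lim_ident lim_conv
      by (cases rule: ra_argsE[OF f(1,2)]) (simp_all add: ra_ops(1,2))
    then show ?thesis
      unfolding is_hom_def using lim_subset lim_empty lim_all lim_compl lim_Int lim_Un
      by (simp add: rel_alg_def image_subset_iff)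
  qed
  moreover have "inj_on lim invs"
  proof (rule inj_on_lim[OF subset_refl subuniverse_invs refl])
    fix s assume s: "s \<in> points S"
    obtain u where u: "u \<in> base" "lam u (Node []) = ct s"
      using base_extend[of "[(Node [], ct s)]"] n_gt_2 root_base std_lab[OF ct_std[OF s]] by auto
    have "gedge p u (Node []) = s" for p
      using u(2) ct_std[OF s] cpt_ct[OF s] by (auto simp: gedge_def glab_def std_def)
    then show "\<exists>w\<in>base \<times> base. \<forall>p. edge p w = s"
      using u(1) root_base by (intro bexI[of _ "(u, Node [])"]) auto
  qed
  ultimately have "ra_representable ?A"
    using algebra_subuniverse[OF subuniverse_invs] by (intro ra_representable_of_hom) auto
  moreover have "RA ?A" by (rule RA_subuniverse[OF RA_Cm subuniverse_invs])
  ultimately show ?thesis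
    unfolding weakly_representable_def
    using atomic_Cm[OF sub invs_singleton] At_Cm_iso[OF sub invs_singleton] by blast
qed

lemma not_ra_representable_Cm: "\<not> ra_representable (Cm S)"
proof
  assume rep: "ra_representable (Cm S)"
  have "points S \<noteq> {}" using cpt_points[OF zero_std] by blast
  then obtain h and U :: "'s set list set" where h: "is_hom ra_sig h (Cm S) (rel_alg U)" and U: "U \<noteq> {}"
    using ra_representable_homE[OF rep algebra_Cm] by auto
  have h0: "h {} = {}" and h1: "h (points S) = U \<times> U"
    and hU: "\<And>X Y. X \<subseteq> points S \<Longrightarrow> Y \<subseteq> points S \<Longrightarrow> h (X \<union> Y) = h X \<union> h Y"
    and hI: "\<And>X Y. X \<subseteq> points S \<Longrightarrow> Y \<subseteq> points S \<Longrightarrow> h (X \<inter> Y) = h X \<inter> h Y"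
    and hsub: "\<And>X. X \<subseteq> points S \<Longrightarrow> h X \<subseteq> U \<times> U"
    using h by (auto simp: is_hom_def rel_alg_def)
  have hmono: "h X \<subseteq> h Y" if "X \<subseteq> Y" "Y \<subseteq> points S" for X Y
    using hU[of X Y] that by (metis Un_upper1 subset_Un_eq subset_trans)
  have hc: "h (comp (Cm S) X Y) = h X O h Y" if "X \<subseteq> points S" "Y \<subseteq> points S" for X Y
  proof -
    have "ra_sig Comp = Some 2 \<and> length [X, Y] = 2 \<and> set [X, Y] \<subseteq> univ (Cm S)"
      using that by (simp add: ra_sig_def)
    then have "h (oper (Cm S) Comp [X, Y]) = oper (rel_alg U) Comp (map h [X, Y])"
      using h unfolding is_hom_def by blast
    then show ?thesis by (simp add: rel_alg_def)
  qed
  have hv: "(v, u) \<in> h X" if "(u, v) \<in> h X" "X \<subseteq> points S" for u v X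
  proof -
    have "ra_sig Conv = Some 1 \<and> length [X] = 1 \<and> set [X] \<subseteq> univ (Cm S)"
      using that by (simp add: ra_sig_def)
    then have "h (oper (Cm S) Conv [X]) = oper (rel_alg U) Conv (map h [X])"
      using h unfolding is_hom_def by blast
    then have "h X = (h X)\<inverse>" using ra_ops(2)[OF that(2)] by (simp add: rel_alg_def)
    then show ?thesis using that(1) by blast
  qed
  define E where "E A = {s \<in> points S. ct s \<in> A}" for A
  have esub: "E A \<subseteq> points S" for A by (auto simp: E_def)
  have hi: "h (E {0}) = Id_on U"
  proof -
    have "ra_sig Ident = Some 0 \<and> length ([] :: 's set list) = 0 \<and> set [] \<subseteq> univ (Cm S)"
      by (simp add: ra_sig_def)
    then have "h (oper (Cm S) Ident []) = oper (rel_alg U) Ident (map h [])"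
      using h unfolding is_hom_def by blast
    then show ?thesis by (simp add: rel_alg_def ra_ops(1) E_def)
  qed
  obtain u where u: "u \<in> U" using U by blast
  have "\<exists>v. (u, v) \<in> h (E {L + a})" for a
  proof -
    have "L + a \<in> std" by (simp add: std_def)
    then have "cpt (L + a) \<in> E {L + a}" by (simp add: E_def cpt_points ct_cpt)
    then have "E {0} \<subseteq> comp (Cm S) (E {L + a}) (E {L + a})"
      unfolding ra_ops(3)[OF esub esub] by (auto simp: E_def)
    then have "(u, u) \<in> h (E {L + a}) O h (E {L + a})"
      using hmono[OF _ comp_sub[OF esub esub]] hc[OF esub esub] hi u by blast
    then show ?thesis by blast
  qed
  then obtain v where v: "\<And>a. (u, v a) \<in> h (E {L + a})" by metis
  have vU: "v a \<in> U" for a using v hsub[OF esub] by blast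
  have distinct: "v a \<noteq> v b" if "a \<noteq> b" for a b
  proof
    assume "v a = v b"
    then have "(u, v a) \<in> h (E {L + a} \<inter> E {L + b})" using v[of a] v[of b] hI[OF esub esub] by simp
    moreover have "E {L + a} \<inter> E {L + b} = {}" using that by (auto simp: E_def)
    ultimately show False using h0 by simp
  qed
  have "\<exists>c<L. (v a, v b) \<in> h (E (colour_class c))" if "a < b" for a b
    unfolding E_def
  proof (rule colour_class_cover[where h = h])
    show "(v a, v b) \<in> h (points S)" using vU h1 by simp
    show "(v a, v b) \<notin> h {s \<in> points S. ct s \<in> {0}}"
      using distinct[of a b] that hi by (auto simp: E_def)
  qed (use ct_std h0 hU in auto)
  then obtain col where col: "\<And>a b. a < b \<Longrightarrow> col a b < L" "\<And>a b. a < b \<Longrightarrow> (v a, v b) \<in> h (E (colour_class (col a b)))"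
    by metis
  obtain a b c where abc: "a < b" "b < c" "col a b = col b c" "col a b = col a c"
    using infinite_triangle[of col L] col(1) by blast
  define A where "A = E (colour_class (col a b))"
  have "(v a, v b) \<in> h A" "(v b, v c) \<in> h A" "(v a, v c) \<in> h A"
    using col(2)[of a b] col(2)[of b c] col(2)[of a c] abc by (simp_all add: A_def)
  then have "(v a, v c) \<in> h (comp (Cm S) A A \<inter> A)"
    using hc[of A A] hI[OF comp_sub, of A A A] esub by (auto simp: A_def)
  moreover have "comp (Cm S) A A \<inter> A = {}"
    using no_triangle by (auto simp: A_def ra_ops(3)[OF esub esub]) (auto simp: E_def)
  ultimately show False using h0 by simp
qed

end

section \<open>The relation algebra and its matrices\<close>

context dimension
begin

text \<open>
  The atom structure of the relation algebra, which is its complex algebra, so that the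
  elements are sets of numbers and the atoms are singletons.
\<close>

definition tri_atoms :: "(ra_op, nat) atom_structure" where
  "tri_atoms = \<lparr> points = std, rel = (\<lambda>f s ss. case f of Ident \<Rightarrow> s = 0 | Conv \<Rightarrow> s = ss ! 0
     | Comp \<Rightarrow> tri (ss ! 0) (ss ! 1) s) \<rparr>"

definition ra :: "(ra_op, nat set) alg" where
  "ra = Cm tri_atoms"

lemma points_tri_atoms [simp]: "points tri_atoms = std"
  by (simp add: tri_atoms_def)

lemma triangle_structure_tri_atoms: "triangle_structure n tri_atoms id"
  by unfold_locales (auto simp: tri_atoms_def)

lemma atoms_ra: "atoms ra = (\<lambda>m. {m}) ` std"
  unfolding ra_def atoms_Cm_full by simp

lemma below_ra [simp]: "below ra X Y \<longleftrightarrow> X \<subseteq> Y"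
  by (simp add: ra_def)

lemma ra_atoms:
  "a \<in> std \<Longrightarrow> a \<in> ident ra \<longleftrightarrow> a = 0"
  "b \<in> std \<Longrightarrow> conv ra {b} = {b}"
  "a \<in> std \<Longrightarrow> b \<in> std \<Longrightarrow> c \<in> std \<Longrightarrow> c \<in> comp ra {a} {b} \<longleftrightarrow> tri a b c"
proof -
  interpret triangle_structure n tri_atoms id by (rule triangle_structure_tri_atoms)
  show "a \<in> std \<Longrightarrow> a \<in> ident ra \<longleftrightarrow> a = 0" "b \<in> std \<Longrightarrow> conv ra {b} = {b}"
    "a \<in> std \<Longrightarrow> b \<in> std \<Longrightarrow> c \<in> std \<Longrightarrow> c \<in> comp ra {a} {b} \<longleftrightarrow> tri a b c"
    by (simp_all add: ra_def ra_ops)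
qed

lemma triangle_structure_At: "triangle_structure n (At ra) the_elem"
proof unfold_locales
  show "bij_betw the_elem (points (At ra)) std"
    by (auto simp: At_def atoms_ra bij_betw_def inj_on_def image_image)
qed (auto simp: At_def atoms_ra ra_atoms)

text \<open>
  The translation between matrices of labels and matrices of atoms \<open>{m}\<close>.
\<close>

definition up :: "(nat \<Rightarrow> nat \<Rightarrow> nat) \<Rightarrow> nat set mat" where
  "up f = (\<lambda>(x, y) \<in> {..<n} \<times> {..<n}. {f x y})"

definition down :: "nat set mat \<Rightarrow> nat \<Rightarrow> nat \<Rightarrow> nat" where
  "down f = (\<lambda>x y. if x < n \<and> y < n then the_elem (f (x, y)) else 0)"

lemma up_apply: "x < n \<Longrightarrow> y < n \<Longrightarrow> up f (x, y) = {f x y}"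
  by (simp add: up_def)

lemma down_up: "f \<in> mats \<Longrightarrow> down (up f) = f"
  using netD(2)[OF mats_net] by (intro ext) (auto simp: up_def down_def)

lemma up_basic:
  assumes "f \<in> mats"
  shows "up f \<in> basic_matrices n ra"
proof -
  have "up f \<in> {..<n} \<times> {..<n} \<rightarrow>\<^sub>E atoms ra"
    using mats_std[OF assms] by (auto simp: up_def atoms_ra)
  then show ?thesis
    using netD(3,4)[OF mats_net[OF assms]] netD(5)[OF mats_net[OF assms]] mats_std[OF assms]
    by (simp add: basic_matrices_def up_apply ra_atoms)
qed

lemma basic_up:
  assumes "f \<in> basic_matrices n ra"
  shows "down f \<in> mats" "f = up (down f)"
proof -
  have f': "f \<in> {..<n} \<times> {..<n} \<rightarrow>\<^sub>E atoms ra \<and> (\<forall>x<n. f (x, x) \<subseteq> ident ra)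
      \<and> (\<forall>x<n. \<forall>y<n. f (y, x) = conv ra (f (x, y)))
      \<and> (\<forall>x<n. \<forall>y<n. \<forall>z<n. f (x, z) \<subseteq> comp ra (f (x, y)) (f (y, z)))"
    using assms unfolding basic_matrices_def below_ra mem_Collect_eq .
  note f = f'[THEN conjunct1] f'[THEN conjunct2, THEN conjunct1, rule_format]
    f'[THEN conjunct2, THEN conjunct2, THEN conjunct2, rule_format]
  have s: "f (x, y) = {down f x y}" "down f x y \<in> std" if "x < n" "y < n" for x y
  proof -
    have "f (x, y) \<in> atoms ra" by (rule PiE_mem[OF f(1)]) (use that in simp)
    then obtain m where m: "f (x, y) = {m}" "m \<in> std" unfolding atoms_ra by blast
    then have "down f x y = m" using that by (simp add: down_def)
    then show "f (x, y) = {down f x y}" "down f x y \<in> std" using m by simp_all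
  qed
  show "f = up (down f)"
  proof (rule extensionalityI)
    show "f \<in> extensional ({..<n} \<times> {..<n})" using f(1) by (simp add: PiE_iff)
    show "up (down f) \<in> extensional ({..<n} \<times> {..<n})" unfolding up_def by (rule restrict_extensional)
    show "f p = up (down f) p" if "p \<in> {..<n} \<times> {..<n}" for p
      using that s(1) by (cases p) (simp add: up_apply)
  qed
  have z: "down f x y = 0" if "\<not> (x < n \<and> y < n)" for x y using that by (auto simp: down_def)
  have "down f x y \<in> std" for x y using s(2)[of x y] z[of x y] by fastforce
  moreover have "down f x x = 0" if "x < n" for x
    using f(2)[OF that] s[OF that that] ra_atoms(1) by simp
  moreover have "tri (down f x y) (down f y z) (down f x z)" if "x < n" "y < n" "z < n" for x y z
    using f(3)[OF that] s[OF that(1,2)] s[OF that(2,3)] s[OF that(1,3)] ra_atoms(3) by simp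
  ultimately show "down f \<in> mats" using z std_lab by (simp add: mats_def net_def)
qed

lemma bij_down: "bij_betw down (basic_matrices n ra) mats"
  by (rule bij_betw_byWitness[where f' = up]) (use down_up up_basic basic_up in auto)

lemma agree_off_up: "agree_off n D (up f) (up g) \<longleftrightarrow> agree D f g"
  by (auto simp: agree_off_def agree_def up_apply)

lemma mat_comp_up:
  assumes "\<tau> ` {..<n} \<subseteq> {..<n}"
  shows "mat_comp n (up f) \<tau> = up (reind f \<tau>)"
proof -
  have "\<tau> x < n" if "x < n" for x using assms that by auto
  then have "mat_comp n (up f) \<tau> (x, y) = up (reind f \<tau>) (x, y)" for x y
    by (cases "x < n"; cases "y < n") (simp_all add: mat_comp_def up_def reind_def)
  then show ?thesis by (intro ext) (simp add: split_paired_all)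
qed

lemma matrix_structure_Mat: "matrix_structure n (Mat n ra) down"
proof unfold_locales
  have comp: "mat_comp n s \<tau> = t \<longleftrightarrow> down t = reind (down s) \<tau>"
    if "s \<in> basic_matrices n ra" "t \<in> basic_matrices n ra" "\<tau> ` {..<n} \<subseteq> {..<n}" for s t \<tau>
  proof -
    have "mat_comp n s \<tau> = up (reind (down s) \<tau>)"
      using mat_comp_up[OF that(3), of "down s"] basic_up(2)[OF that(1)] by simp
    moreover have "reind (down s) \<tau> \<in> mats" by (rule mats_reind[OF basic_up(1)[OF that(1)] that(3)])
    ultimately show ?thesis using basic_up(2)[OF that(2)] down_up by metis
  qed
  show "bij_betw down (points (Mat n ra)) mats" using bij_down by (simp add: Mat_def)
  show "rel (Mat n ra) (Cyl i) s [t] \<longleftrightarrow> agree {i} (down s) (down t)"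
    if "i < n" "s \<in> points (Mat n ra)" "t \<in> points (Mat n ra)" for i s t
    using that basic_up(2)[of s] basic_up(2)[of t] agree_off_up[of "{i}" "down s" "down t"] by (simp add: Mat_def)
  show "rel (Mat n ra) (Diag i j) s [] \<longleftrightarrow> down s i j = 0"
    if "i < n" "j < n" "s \<in> points (Mat n ra)" for i j s
  proof -
    have s: "s \<in> basic_matrices n ra" using that by (simp add: Mat_def)
    have "s (i, j) = {down s i j}" using basic_up(2)[OF s] up_apply[OF that(1,2)] by metis
    then show ?thesis using ra_atoms(1)[OF mats_std[OF basic_up(1)[OF s]]] by (simp add: Mat_def)
  qed
  show "rel (Mat n ra) (Repl i j) s [t] \<longleftrightarrow> down t = reind (down s) (id(i := j))"
    if "i < n" "j < n" "s \<in> points (Mat n ra)" "t \<in> points (Mat n ra)" for i j s t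
    using that comp[of s t "id(i := j)"] by (auto simp: Mat_def)
  show "rel (Mat n ra) (Swap i j) s [t] \<longleftrightarrow> down t = reind (down s) (transpose i j)"
    if "i < n" "j < n" "s \<in> points (Mat n ra)" "t \<in> points (Mat n ra)" for i j s t
    using that comp[of s t "transpose i j"] by (auto simp: Mat_def transpose_def)
qed

lemma polyadic_equality_basis: "polyadic_equality_basis n ra (basic_matrices n ra)"
proof -
  have n3: "0 < n" "1 < n" using n_gt_2 by auto
  have B: "\<exists>F\<in>mats. f = up F" if "f \<in> basic_matrices n ra" for f
    using basic_up[OF that] by blast
  have atom: "\<exists>f\<in>basic_matrices n ra. f (0, 1) = a" if a: "a \<in> atoms ra" for a
  proof -
    obtain m where m: "a = {m}" "m \<in> std" using a by (auto simp: atoms_ra)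
    have "(\<lambda>x y. 0) \<in> mats" by (simp add: mats_def net_def)
    then obtain g where "g \<in> mats" "g 0 1 = m"
      using mats_extend[of "\<lambda>x y. 0" 1 "{0}" "\<lambda>_. m"] n3 m(2) by auto
    then show ?thesis using up_basic up_apply[OF n3] m(1) by (intro bexI[of _ "up g"]) auto
  qed
  have ext: "\<exists>g\<in>basic_matrices n ra. agree_off n {z} f g \<and> g (x, z) = a \<and> g (z, y) = b"
    if f: "f \<in> basic_matrices n ra" and ab: "a \<in> atoms ra" "b \<in> atoms ra" and xyz: "x < n" "y < n" "z < n"
      and le: "below ra (f (x, y)) (comp ra a b)" and ne: "z \<noteq> x" "z \<noteq> y" for f a b x y z
  proof -
    obtain F where F: "F \<in> mats" "f = up F" using B[OF f] by blast
    obtain k l where kl: "a = {k}" "b = {l}" "k \<in> std" "l \<in> std" using ab by (auto simp: atoms_ra)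
    have t: "tri k l (F x y)" using le ra_atoms(3)[OF kl(3,4) mats_std[OF F(1)]] F kl up_apply[OF xyz(1,2)] by simp
    have F0: "F x x = 0" "F y y = 0" using netD(3)[OF mats_net[OF F(1)]] xyz by auto
    define e where "e d = (if d = x then k else l)" for d
    have ey: "e y = l" using t F0 by (auto simp: e_def)
    have te: "tri (e d) (e d') (F d d')" if "d \<in> {x, y}" "d' \<in> {x, y}" for d d'
      using that t F0 ey tri_swapI[OF t] netD(5)[OF mats_net[OF F(1)], of y x] by (auto simp: e_def)
    have es: "e d \<in> std" for d using kl by (simp add: e_def)
    have "{x, y} \<subseteq> {..<n} - {z}" using xyz ne by auto
    from mats_extend[OF F(1) xyz(3) this es te]
    obtain g where g: "g \<in> mats" "agree {z} F g" "\<And>d. d \<in> {x, y} \<Longrightarrow> g z d = e d" "\<And>d. d \<in> {x, y} \<Longrightarrow> g d z = e d"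
      by metis
    have "g x z = k" "g z y = l" using g(4)[of x] g(3)[of y] ey by (simp_all add: e_def)
    then show ?thesis
      using up_basic[OF g(1)] g(2) up_apply[OF xyz(1,3), of g] up_apply[OF xyz(3,2), of g] kl(1,2)
      by (intro bexI[of _ "up g"]) (simp_all add: F(2) agree_off_up)
  qed
  have amalg: "\<exists>h\<in>basic_matrices n ra. agree_off n {x} f h \<and> agree_off n {y} g h"
    if fg: "f \<in> basic_matrices n ra" "g \<in> basic_matrices n ra" and xy: "x < n" "y < n" "agree_off n {x, y} f g" for f g x y
  proof -
    obtain F G where FG: "F \<in> mats" "f = up F" "G \<in> mats" "g = up G" using B[OF fg(1)] B[OF fg(2)] by blast
    have "agree {x, y} F G" using xy(3) FG agree_off_up by simp
    then obtain h where "h \<in> mats" "agree {x} F h" "agree {y} G h"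
      using mats_amalgamate[OF FG(1,3) xy(1,2)] by blast
    then show ?thesis using FG up_basic agree_off_up by (intro bexI[of _ "up h"]) auto
  qed
  have "mat_comp n f \<tau> \<in> basic_matrices n ra" if "f \<in> basic_matrices n ra" "\<tau> ` {..<n} \<subseteq> {..<n}" for f \<tau>
  proof -
    from B[OF that(1)] obtain F where F: "F \<in> mats" "f = up F" by blast
    show ?thesis
      unfolding F(2) mat_comp_up[OF that(2)] by (rule up_basic[OF mats_reind[OF F(1) that(2)]])
  qed
  then show ?thesis
    unfolding polyadic_equality_basis_def cylindric_basis_def
    by (intro conjI ballI allI impI subset_refl) (rule atom ext amalg; (elim conjE)?; assumption)+
qed


section \<open>A copy of the matrices on sets of natural numbers\<close>

text \<open>
  A matrix is coded by the graph of the corresponding function, as a set of numbers.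
\<close>

definition code :: "(nat \<Rightarrow> nat \<Rightarrow> nat) \<Rightarrow> nat set" where
  "code f = (\<lambda>(x, y). prod_encode (prod_encode (x, y), f x y)) ` UNIV"

definition decode :: "nat set \<Rightarrow> nat \<Rightarrow> nat \<Rightarrow> nat" where
  "decode = inv code"

definition coded_mats :: "(pea_op, nat set) atom_structure" where
  "coded_mats = \<lparr> points = code ` mats, rel = (\<lambda>f s ss. case f of
     Cyl i \<Rightarrow> agree {i} (decode s) (decode (ss ! 0))
   | Diag i j \<Rightarrow> decode s i j = 0
   | Repl i j \<Rightarrow> decode (ss ! 0) = reind (decode s) (id(i := j))
   | Swap i j \<Rightarrow> decode (ss ! 0) = reind (decode s) (transpose i j)) \<rparr>"

lemma decode_code: "decode (code f) = f"
proof -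
  have "inj code"
  proof (rule injI)
    fix f g assume e: "code f = code g"
    have m: "prod_encode (prod_encode (x, y), f x y) \<in> code g" for x y
      unfolding e[symmetric] unfolding code_def by (rule image_eqI[of _ _ "(x, y)"]) auto
    have "f x y = g x y" for x y
      using m[of x y] unfolding code_def by (elim imageE) (auto simp: prod_encode_eq)
    then show "f = g" by blast
  qed
  then show ?thesis by (simp add: decode_def)
qed

lemma matrix_structure_coded: "matrix_structure n coded_mats decode"
proof unfold_locales
  show "bij_betw decode (points coded_mats) mats"
    by (rule bij_betw_byWitness[where f' = code]) (auto simp: coded_mats_def decode_code)
qed (simp_all add: coded_mats_def)

end

theorem theorem3p3:
  fixes n :: nat
  assumes "n > 2"
  shows "(\<exists>S :: (pea_op, nat set) atom_structure.
            PEA_atom_structure n S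
          \<and> representable n (pea_sig n UNIV) (Tm (pea_sig n UNIV) S)
          \<and> \<not> PEA_strongly_representable n S
          \<and> (\<forall>F. \<not> representable n (pea_sig n F) (Cm S)))
       \<and> (\<exists>R :: (ra_op, nat set) alg.
            RA R \<and> atomic R
          \<and> polyadic_equality_basis n R (basic_matrices n R)
          \<and> representable n (pea_sig n UNIV) (Tm (pea_sig n UNIV) (Mat n R))
          \<and> \<not> representable n (pea_sig n {}) (Cm (Mat n R))
          \<and> RA_weakly_representable (At R)
          \<and> \<not> RA_strongly_representable (At R))"
proof -
  interpret dimension n by unfold_locales (rule assms)
  interpret S: matrix_structure n coded_mats decode by (rule matrix_structure_coded)
  interpret M: matrix_structure n "Mat n ra" down by (rule matrix_structure_Mat)
  interpret T: triangle_structure n tri_atoms id by (rule triangle_structure_tri_atoms)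
  interpret A: triangle_structure n "At ra" the_elem by (rule triangle_structure_At)
  have "PEA_atom_structure n coded_mats \<and> representable n (pea_sig n UNIV) (Tm (pea_sig n UNIV) coded_mats)
      \<and> \<not> PEA_strongly_representable n coded_mats \<and> (\<forall>F. \<not> representable n (pea_sig n F) (Cm coded_mats))"
    using atstr_of_classI[where K = "PEA n", OF S.PEA_Cm] S.representable_Tm
      not_strongly_representableI[where K = "PEA n" and Rep = "representable n (pea_sig n UNIV)",
        OF S.PEA_Cm S.not_representable_Cm] S.not_representable_Cm
    by blast
  moreover have "RA ra \<and> atomic ra" using T.RA_Cm atomic_Cm_full by (simp add: ra_def)
  moreover have "RA_weakly_representable (At ra) \<and> \<not> RA_strongly_representable (At ra)"
    using A.RA_weakly_representable not_strongly_representableI[where K = RA and Rep = ra_representable, OF A.RA_Cm A.not_ra_representable_Cm] by blast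
  ultimately show ?thesis
    using polyadic_equality_basis M.representable_Tm M.not_representable_Cm by blast
qed

end
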